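(* Let $X$ be a Banach space and let $n=2k+1$ with $k\in\mathbb{N}$, $k\ge1$. Assume that $F:\mathbb{R}^n\to X$ is $L^1$-integrable and $k$-times continuously differentiable. If for every compact $K\subset\mathbb{R}^n$ there exist $g\in L^1(\mathbb{R}^n)$ and $\delta>0$ such that $$\sup_{\alpha\in\mathbb{N}_0^n,\ |\alpha|\le k}\ \sup_{x\in K}\ |y|^{-n+k}\,\|\nabla^\alpha F(x+y)\|\le g(y)\quad\text{for all } |y|\ge\delta,$$ then $S_R(F)(x)\to F(x)$ as $R\to\infty$, locally uniformly in $x\in\mathbb{R}^n$.
   Context: $X$ is a Banach space with complex scalars and norm $\|\cdot\|$. For $L^1$-integrable $F:\mathbb{R}^n\to X$ the Fourier transform is $\hat F(\xi)=\int_{\mathbb{R}^n}e^{-i\xi\cdot s}F(s)\,ds$, and $S_R(F)(x)=\frac{1}{(2\pi)^n}\int_{|\xi|\le R}e^{ix\cdot\xi}\hat F(\xi)\,d\xi$ for $R\ge1$, $x\in\mathbb{R}^n$. For a multi-index $\alpha\in\mathbb{N}_0^n$, $\nabla^\alpha F$ denotes the partial derivative of $F$ of order $\alpha$ (with $\nabla^0F=F$). Locally uniformly means uniformly on every compact subset of $\mathbb{R}^n$, with convergence in the norm of $X$. *)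

theory Defs
  imports "HOL-Analysis.Analysis"
begin

section \<open>Complex Banach spaces\<close>

text \<open>Unitality is not assumed: it is the case \<open>r = 1\<close> of \<open>scaleC_of_real\<close>.\<close>

class complex_banach = banach +
  fixes scaleC :: "complex \<Rightarrow> 'a \<Rightarrow> 'a"  (infixr \<open>*\<^sub>C\<close> 75)
  assumes scaleC_add_right: "a *\<^sub>C (x + y) = a *\<^sub>C x + a *\<^sub>C y"
    and scaleC_add_left: "(a + b) *\<^sub>C x = a *\<^sub>C x + b *\<^sub>C x"
    and scaleC_scaleC: "a *\<^sub>C (b *\<^sub>C x) = (a * b) *\<^sub>C x"
    and scaleC_of_real: "complex_of_real r *\<^sub>C x = r *\<^sub>R x"
    and norm_scaleC: "norm (a *\<^sub>C x) = cmod a * norm x"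

instantiation complex :: complex_banach
begin

definition scaleC_complex :: "complex \<Rightarrow> complex \<Rightarrow> complex" where
  "scaleC_complex a x = a * x"

instance
  by standard
    (simp_all add: scaleC_complex_def distrib_left distrib_right mult.assoc norm_mult
      scaleR_conv_of_real)

end

section \<open>The Bochner integral without separability\<close>

text \<open>
  The Bochner integral of HOL-Analysis is restricted to second countable (separable) target
  spaces. Here is the same definition for an arbitrary normed target space. The
  \<open>L\<^sup>1\<close>-approximation by simple functions forces an integrable function to be essentially
  separably valued, so Borel measurability suffices as measurability requirement.
\<close>

inductive has_gen_bochner_integral ::
    "'a measure \<Rightarrow> ('a \<Rightarrow> 'b) \<Rightarrow> 'b::real_normed_vector \<Rightarrow> bool"
  for M f x where
  "f \<in> borel_measurable M \<Longrightarrow>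
    (\<And>i. Bochner_Integration.simple_bochner_integrable M (s i)) \<Longrightarrow>
    (\<lambda>i. \<integral>\<^sup>+y. ennreal (norm (f y - s i y)) \<partial>M) \<longlonglongrightarrow> 0 \<Longrightarrow>
    (\<lambda>i. Bochner_Integration.simple_bochner_integral M (s i)) \<longlonglongrightarrow> x \<Longrightarrow>
    has_gen_bochner_integral M f x"

definition gen_bochner_integrable ::
    "'a measure \<Rightarrow> ('a \<Rightarrow> 'b::real_normed_vector) \<Rightarrow> bool" where
  "gen_bochner_integrable M f \<longleftrightarrow> (\<exists>x. has_gen_bochner_integral M f x)"

definition gen_bochner_integral ::
    "'a measure \<Rightarrow> ('a \<Rightarrow> 'b::real_normed_vector) \<Rightarrow> 'b" where
  "gen_bochner_integral M f =
    (if gen_bochner_integrable M f then THE x. has_gen_bochner_integral M f x else 0)"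

lemma has_gen_bochner_integral_iff:
  fixes f :: "'a \<Rightarrow> 'b::{real_normed_vector, second_countable_topology}"
  shows "has_gen_bochner_integral M f = has_bochner_integral M f"
  by (simp add: fun_eq_iff has_gen_bochner_integral.simps has_bochner_integral.simps)

lemma gen_bochner_integrable_iff:
  fixes f :: "'a \<Rightarrow> 'b::{banach, second_countable_topology}"
  shows "gen_bochner_integrable M f \<longleftrightarrow> integrable M f"
  by (simp add: gen_bochner_integrable_def has_gen_bochner_integral_iff integrable.simps)

lemma gen_bochner_integral_eq:
  fixes f :: "'a \<Rightarrow> 'b::{banach, second_countable_topology}"
  shows "gen_bochner_integral M f = integral\<^sup>L M f"
  by (simp add: gen_bochner_integral_def gen_bochner_integrable_def
      has_gen_bochner_integral_iff lebesgue_integral_def)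

section \<open>Partial derivatives\<close>

definition partial_at_exists ::
    "'n::finite \<Rightarrow> (real ^ 'n \<Rightarrow> 'a::real_normed_vector) \<Rightarrow> real ^ 'n \<Rightarrow> bool" where
  "partial_at_exists i F x \<longleftrightarrow> (\<lambda>t. F (x + t *\<^sub>R axis i 1)) differentiable (at (0::real))"

definition partial ::
    "'n::finite \<Rightarrow> (real ^ 'n \<Rightarrow> 'a::real_normed_vector) \<Rightarrow> real ^ 'n \<Rightarrow> 'a" where
  "partial i F x = vector_derivative (\<lambda>t. F (x + t *\<^sub>R axis i 1)) (at (0::real))"

text \<open>All iterated partial derivatives of order at most \<open>k\<close> exist and are continuous.\<close>

primrec cont_diff :: "nat \<Rightarrow> (real ^ 'n::finite \<Rightarrow> 'a::real_normed_vector) \<Rightarrow> bool" where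
  "cont_diff 0 F \<longleftrightarrow> continuous_on UNIV F"
| "cont_diff (Suc k) F \<longleftrightarrow> continuous_on UNIV F \<and>
     (\<forall>i. (\<forall>x. partial_at_exists i F x) \<and> cont_diff k (partial i F))"

text \<open>
  A multi-index is a function \<open>\<alpha> :: 'n \<Rightarrow> nat\<close>. The index type carries no order, so the
  coordinates are listed in an arbitrary but fixed order; for
  \<open>|\<alpha>| \<le> k\<close> and \<open>k\<close> times continuously differentiable functions this order does not
  affect the value of \<open>nabla \<alpha>\<close>.
\<close>

definition coords :: "'n::finite list" where
  "coords = (SOME is. distinct is \<and> set is = UNIV)"

definition nabla ::
    "('n::finite \<Rightarrow> nat) \<Rightarrow> (real ^ 'n \<Rightarrow> 'a::real_normed_vector) \<Rightarrow> real ^ 'n \<Rightarrow> 'a" where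
  "nabla \<alpha> F = foldr (\<lambda>i. partial i ^^ \<alpha> i) coords F"

definition multi_order :: "('n::finite \<Rightarrow> nat) \<Rightarrow> nat" where
  "multi_order \<alpha> = (\<Sum>i\<in>UNIV. \<alpha> i)"

section \<open>Fourier transform and spherical partial Fourier integrals\<close>

definition fourier :: "(real ^ 'n::finite \<Rightarrow> 'a::complex_banach) \<Rightarrow> real ^ 'n \<Rightarrow> 'a" where
  "fourier F \<xi> =
    gen_bochner_integral lebesgue (\<lambda>s. exp (- \<i> * complex_of_real (\<xi> \<bullet> s)) *\<^sub>C F s)"

definition S_R ::
    "real \<Rightarrow> (real ^ 'n::finite \<Rightarrow> 'a::complex_banach) \<Rightarrow> real ^ 'n \<Rightarrow> 'a" where
  "S_R R F x = (1 / (2 * pi) ^ CARD('n)) *\<^sub>R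
    gen_bochner_integral lebesgue
      (\<lambda>\<xi>. indicat_real {\<xi>. norm \<xi> \<le> R} \<xi> *\<^sub>R
        (exp (\<i> * complex_of_real (x \<bullet> \<xi>)) *\<^sub>C fourier F \<xi>))"

end

theory Submission
  imports Defs "HOL-Probability.Sinc_Integral"
begin

text \<open>
  Up to the factor \<open>(2\<pi>)\<^sup>n\<close>, the partial Fourier integral is a convolution,
  \<open>S\<^sub>R F(x) = \<integral> D\<^sub>R(y) F(x + y) dy\<close>, with the Fourier transform \<open>D\<^sub>R\<close> of the ball of radius \<open>R\<close>
  (\<open>S_R_eq_ball_kernel_integral\<close>). In odd dimension \<open>n = 2k + 1\<close> this kernel is elementary: slicing
  the ball by hyperplanes shows that \<open>D\<^sub>R(y)\<close> is a multiple of \<open>R\<^sup>n \<phi>\<^sub>k(R|y|)\<close>, where \<open>\<phi>\<^sub>0(r) = 2 sin r / r\<close>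
  and \<open>\<phi>\<^sub>p' = - r \<phi>\<^bsub>p+1\<^esub> / (2p + 2)\<close> (\<open>ball_kernel_eq_slice_cos\<close>, \<open>has_real_derivative_slice_cos\<close>). So
  \<open>D\<^sub>R\<close> is a \<open>k\<close>-fold radial derivative of the Dirichlet kernel \<open>sin(Rs) / s\<close> of the line.

  In polar coordinates around \<open>x\<close>, \<open>k\<close> integrations by parts on the ray in direction \<open>w\<close> move these
  derivatives to \<open>F\<close>, and what remains is \<open>\<integral> sin(Rs) / s V(s) ds\<close>, where \<open>V(s)\<close> is a combination of
  the terms \<open>s\<^sup>j (d/ds)\<^sup>j F(x + s w)\<close> with \<open>j \<le> k\<close> (\<open>integral_slice_cos_iterated_by_parts\<close>). This explains
  both hypotheses on \<open>F\<close>. The \<open>k\<close> continuous derivatives are the ones spent on the integrations by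
  parts. As \<open>k \<ge> 1\<close>, also \<open>V(s) - V(0) = O(s)\<close>, so that on a bounded interval the sine integral and the
  Riemann-Lebesgue lemma give a multiple of \<open>F(x)\<close> as limit, uniformly in \<open>x\<close> and \<open>w\<close>
  (\<open>near_estimate\<close>). For large \<open>s\<close> the integrand is bounded by \<open>s\<^bsup>k-1\<^esup>\<close> times derivatives of \<open>F\<close> of order at
  most \<open>k\<close>; averaged over \<open>w\<close> this is an integral of \<open>|y|\<^bsup>k-n\<^esup> |\<nabla>\<^sup>\<alpha> F(x + y)|\<close> over a neighbourhood of
  infinity, which is small uniformly in \<open>R\<close> and locally uniformly in \<open>x\<close> (\<open>far_estimate\<close>,
  \<open>norm_integral_spherical_mean_error\<close>). The constants fit by the volumes of the unit balls of
  dimensions \<open>2k\<close> and \<open>2k + 1\<close> (\<open>normalisation_constant\<close>).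

  Three devices make this rigorous. Values in a possibly non-separable space are handled by
  approximation with finite sums of scalar functions times vectors, which reduces Fubini's theorem
  and the polar formula to the scalar case (\<open>has_gen_bochner_integral_tensor_sum\<close>,
  \<open>finite_tensor_approximation\<close>). Spherical means are averages over \<open>z / |z|\<close> with \<open>z\<close> in the unit
  ball, so that the polar formula follows from Tonelli's theorem and dilations
  (\<open>polar_nn_integral\<close>). Finally, the kernel carries a cut-off \<open>(1 - |y| / T)\<^sub>+\<^sup>k\<close>: its zero of order \<open>k\<close>
  removes the boundary terms at \<open>T\<close>, it is a function of \<open>|y| / T\<close> so that all estimates are uniform
  in \<open>T\<close>, and it disappears as \<open>T\<close> tends to infinity (\<open>norm_S_R_diff_le\<close>).
\<close>

section \<open>Bochner integrals with values in a non-separable space\<close>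

abbreviation "sb_integrable \<equiv> Bochner_Integration.simple_bochner_integrable"
abbreviation "sb_integral \<equiv> Bochner_Integration.simple_bochner_integral"

text \<open>
  Sums of measurable functions into a non-separable space need not be measurable. If one
  of the two is simple there is no problem: on each of its finitely many level sets only
  one member of the family \<open>g\<close> is seen.
\<close>

lemma measurable_simple_selection:
  assumes "simple_function M s" "\<And>c. c \<in> s ` space M \<Longrightarrow> g c \<in> measurable M N"
  shows "(\<lambda>t. g (s t) t) \<in> measurable M N"
proof (rule measurable_compose_countable'[where I = "s ` space M"])
  show "s \<in> measurable M (count_space (s ` space M))"
    using assms(1) by (auto simp: simple_function_def measurable_count_space_eq2)
  show "countable (s ` space M)"
    using assms(1) by (simp add: simple_function_def countable_finite)
qed (use assms(2) in auto)

lemma simple_bochner_integrable_imp_simple: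
  "sb_integrable M s \<Longrightarrow> simple_function M s"
  by (auto elim: Bochner_Integration.simple_bochner_integrable.cases)

lemma borel_measurable_norm_diff_simple:
  fixes f :: "'a \<Rightarrow> 'b::real_normed_vector"
  assumes "f \<in> borel_measurable M" "sb_integrable M s"
  shows "(\<lambda>t. ennreal (norm (f t - s t))) \<in> borel_measurable M"
proof (rule measurable_simple_selection[where s = s and g = "\<lambda>c t. ennreal (norm (f t - c))"])
  show "simple_function M s" by (rule simple_bochner_integrable_imp_simple) fact
  fix c :: 'b
  have "(\<lambda>v. norm (v - c)) \<in> borel_measurable borel"
    by (intro borel_measurable_continuous_onI continuous_intros)
  from measurable_compose[OF measurable_compose[OF assms(1) this] measurable_ennreal]
  show "(\<lambda>t. ennreal (norm (f t - c))) \<in> borel_measurable M" .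
qed

lemma simple_bochner_integral_diff_le:
  fixes f g :: "'a \<Rightarrow> 'b::real_normed_vector"
  assumes f: "f \<in> borel_measurable M" and g: "g \<in> borel_measurable M"
    and s: "sb_integrable M s"
    and t: "sb_integrable M t"
    and b [measurable]: "b \<in> borel_measurable M"
    and le: "\<And>y. y \<in> space M \<Longrightarrow> ennreal (norm (f y - g y)) \<le> b y"
  shows "ennreal (norm (sb_integral M s
             - sb_integral M t))
     \<le> (\<integral>\<^sup>+y. ennreal (norm (f y - s y)) \<partial>M) + (\<integral>\<^sup>+y. b y \<partial>M)
        + (\<integral>\<^sup>+y. ennreal (norm (g y - t y)) \<partial>M)"
    (is "ennreal (norm (?s - ?t)) \<le> _")
proof -
  have m: "(\<lambda>y. ennreal (norm (f y - s y))) \<in> borel_measurable M"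
      "(\<lambda>y. ennreal (norm (g y - t y))) \<in> borel_measurable M"
    using borel_measurable_norm_diff_simple f g s t by blast+
  have "ennreal (norm (?s - ?t))
      = norm (sb_integral M (\<lambda>x. s x - t x))"
    using s t by (subst simple_bochner_integral_diff) auto
  also have "\<dots> \<le> sb_integral M (\<lambda>x. norm (s x - t x))"
    using simple_bochner_integrable_compose2[of "(-)" M "s" "t"] s t
    by (auto intro!: simple_bochner_integral_norm_bound)
  also have "\<dots> = (\<integral>\<^sup>+x. norm (s x - t x) \<partial>M)"
    using simple_bochner_integrable_compose2[of "\<lambda>x y. norm (x - y)" M "s" "t"] s t
    by (auto intro!: simple_bochner_integral_eq_nn_integral)
  also have "\<dots> \<le> (\<integral>\<^sup>+y. ennreal (norm (f y - s y)) + b y + ennreal (norm (g y - t y)) \<partial>M)"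
  proof (rule nn_integral_mono)
    fix y assume y: "y \<in> space M"
    have "s y - t y = (f y - g y) - (f y - s y) + (g y - t y)" by simp
    then have "norm (s y - t y) \<le> norm (f y - s y) + norm (f y - g y) + norm (g y - t y)"
      by (smt (verit) norm_triangle_ineq norm_triangle_ineq4)
    then have "ennreal (norm (s y - t y))
        \<le> ennreal (norm (f y - s y)) + ennreal (norm (f y - g y)) + ennreal (norm (g y - t y))"
      by (metis add_nonneg_nonneg ennreal_leI ennreal_plus norm_ge_zero)
    also have "\<dots> \<le> ennreal (norm (f y - s y)) + b y + ennreal (norm (g y - t y))"
      using le[OF y] by (intro add_mono) auto
    finally show "ennreal (norm (s y - t y)) \<le> \<dots>" .
  qed
  also have "\<dots> = (\<integral>\<^sup>+y. ennreal (norm (f y - s y)) \<partial>M) + (\<integral>\<^sup>+y. b y \<partial>M)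
        + (\<integral>\<^sup>+y. ennreal (norm (g y - t y)) \<partial>M)"
    by (simp only: nn_integral_add[OF borel_measurable_add[OF m(1) b] m(2)] nn_integral_add[OF m(1) b])
  finally show ?thesis .
qed

text \<open>
  Uniqueness of the integral and all later comparisons of integrals are instances of this
  bound. The majorant \<open>b\<close> stands in for \<open>norm (f t - g t)\<close>, which need not be measurable.
\<close>

lemma has_gen_bochner_integral_norm_diff_le:
  assumes f: "has_gen_bochner_integral M f x" and g: "has_gen_bochner_integral M g y"
    and b: "b \<in> borel_measurable M"
    and le: "\<And>t. t \<in> space M \<Longrightarrow> ennreal (norm (f t - g t)) \<le> b t"
  shows "ennreal (norm (x - y)) \<le> (\<integral>\<^sup>+t. b t \<partial>M)"
proof -
  from f obtain s where f': "f \<in> borel_measurable M"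
      "\<And>i. sb_integrable M (s i)"
      "(\<lambda>i. \<integral>\<^sup>+y. ennreal (norm (f y - s i y)) \<partial>M) \<longlonglongrightarrow> 0"
      "(\<lambda>i. sb_integral M (s i)) \<longlonglongrightarrow> x"
    by (auto simp: has_gen_bochner_integral.simps)
  from g obtain t where g': "g \<in> borel_measurable M"
      "\<And>i. sb_integrable M (t i)"
      "(\<lambda>i. \<integral>\<^sup>+y. ennreal (norm (g y - t i y)) \<partial>M) \<longlonglongrightarrow> 0"
      "(\<lambda>i. sb_integral M (t i)) \<longlonglongrightarrow> y"
    by (auto simp: has_gen_bochner_integral.simps)
  have lim1: "(\<lambda>i. ennreal (norm (sb_integral M (s i)
             - sb_integral M (t i)))) \<longlonglongrightarrow> ennreal (norm (x - y))"
    by (intro tendsto_intros f' g')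
  have "(\<lambda>i. (\<integral>\<^sup>+y. ennreal (norm (f y - s i y)) \<partial>M) + (\<integral>\<^sup>+y. b y \<partial>M)
        + (\<integral>\<^sup>+y. ennreal (norm (g y - t i y)) \<partial>M)) \<longlonglongrightarrow> 0 + (\<integral>\<^sup>+y. b y \<partial>M) + 0"
    by (intro tendsto_intros f' g')
  then have lim2: "(\<lambda>i. (\<integral>\<^sup>+y. ennreal (norm (f y - s i y)) \<partial>M) + (\<integral>\<^sup>+y. b y \<partial>M)
        + (\<integral>\<^sup>+y. ennreal (norm (g y - t i y)) \<partial>M)) \<longlonglongrightarrow> (\<integral>\<^sup>+y. b y \<partial>M)" by simp
  show ?thesis
    by (rule LIMSEQ_le[OF lim1 lim2])
       (use simple_bochner_integral_diff_le[OF f'(1) g'(1) f'(2) g'(2) b le] in blast)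
qed

lemma has_gen_bochner_integral_unique:
  assumes "has_gen_bochner_integral M f x" "has_gen_bochner_integral M f y"
  shows "x = y"
  using has_gen_bochner_integral_norm_diff_le[OF assms, of "\<lambda>_. 0"] by simp

lemma gen_bochner_integral_eqI:
  assumes "has_gen_bochner_integral M f x"
  shows "gen_bochner_integral M f = x"
  using assms has_gen_bochner_integral_unique[of M f]
  by (auto simp: gen_bochner_integral_def gen_bochner_integrable_def intro!: the_equality)

text \<open>
  Completeness of the integrable functions. A diagonal choice of simple functions, close to
  \<open>h i\<close> up to \<open>1 / (i + 1)\<close>, approximates \<open>f\<close>, and their integrals form a Cauchy sequence.
\<close>

lemma has_gen_bochner_integral_limit:
  fixes f :: "'a \<Rightarrow> 'b::banach"
  assumes f: "f \<in> borel_measurable M"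
    and h: "\<And>i. has_gen_bochner_integral M (h i) (X i)"
    and b: "\<And>i. b i \<in> borel_measurable M"
    and le: "\<And>i t. t \<in> space M \<Longrightarrow> ennreal (norm (f t - h i t)) \<le> b i t"
    and lim: "(\<lambda>i. \<integral>\<^sup>+t. b i t \<partial>M) \<longlonglongrightarrow> (0::ennreal)"
  obtains x where "has_gen_bochner_integral M f x" "X \<longlonglongrightarrow> x"
proof -
  have "\<exists>s. sb_integrable M s \<and>
      (\<integral>\<^sup>+y. ennreal (norm (h i y - s y)) \<partial>M) < ennreal (inverse (real (Suc i))) \<and>
      dist (sb_integral M s) (X i) < inverse (real (Suc i))" for i
  proof -
    from h[of i] obtain s where
        "\<And>j. sb_integrable M (s j)"
        "(\<lambda>j. \<integral>\<^sup>+y. ennreal (norm (h i y - s j y)) \<partial>M) \<longlonglongrightarrow> 0"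
        "(\<lambda>j. sb_integral M (s j)) \<longlonglongrightarrow> X i"
      by (auto simp: has_gen_bochner_integral.simps)
    note s = this
    have "\<forall>\<^sub>F j in sequentially. (\<integral>\<^sup>+y. ennreal (norm (h i y - s j y)) \<partial>M) < ennreal (inverse (real (Suc i)))"
      by (rule order_tendstoD(2)[OF s(2)]) simp
    moreover have "\<forall>\<^sub>F j in sequentially. dist (sb_integral M (s j)) (X i)
            < inverse (real (Suc i))"
      by (rule tendstoD[OF s(3)]) simp
    ultimately have "\<exists>j. (\<integral>\<^sup>+y. ennreal (norm (h i y - s j y)) \<partial>M) < ennreal (inverse (real (Suc i)))
        \<and> dist (sb_integral M (s j)) (X i) < inverse (real (Suc i))"
      by (intro eventually_happens'[OF sequentially_bot] eventually_conj)
    with s(1) show ?thesis by blast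
  qed
  then have "\<forall>i. \<exists>s. sb_integrable M s \<and>
      (\<integral>\<^sup>+y. ennreal (norm (h i y - s y)) \<partial>M) < ennreal (inverse (real (Suc i))) \<and>
      dist (sb_integral M s) (X i) < inverse (real (Suc i))" ..
  from choice[OF this]
  obtain s where s: "\<And>i. sb_integrable M (s i)"
      and s1: "\<And>i. (\<integral>\<^sup>+y. ennreal (norm (h i y - s i y)) \<partial>M) < ennreal (inverse (real (Suc i)))"
      and s2: "\<And>i. dist (sb_integral M (s i)) (X i) < inverse (real (Suc i))"
    by blast
  let ?S = "\<lambda>i. sb_integral M (s i)"
  let ?d = "\<lambda>i. \<integral>\<^sup>+y. ennreal (norm (f y - s i y)) \<partial>M"
  have inv0: "(\<lambda>i. ennreal (inverse (real (Suc i)))) \<longlonglongrightarrow> 0"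
    using tendsto_ennrealI[OF LIMSEQ_inverse_real_of_nat] by simp
  have hm: "h i \<in> borel_measurable M" for i
    using h[of i] by (auto simp: has_gen_bochner_integral.simps)
  have dle: "?d i \<le> (\<integral>\<^sup>+t. b i t \<partial>M) + ennreal (inverse (real (Suc i)))" for i
  proof -
    have "?d i \<le> (\<integral>\<^sup>+t. b i t + ennreal (norm (h i t - s i t)) \<partial>M)"
    proof (rule nn_integral_mono)
      fix t assume t: "t \<in> space M"
      have "norm (f t - s i t) \<le> norm (f t - h i t) + norm (h i t - s i t)"
        using norm_triangle_ineq[of "f t - h i t" "h i t - s i t"] by simp
      then have "ennreal (norm (f t - s i t)) \<le> ennreal (norm (f t - h i t)) + ennreal (norm (h i t - s i t))"
        by (metis ennreal_leI ennreal_plus norm_ge_zero)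
      also have "\<dots> \<le> b i t + ennreal (norm (h i t - s i t))"
        using le[OF t] by (intro add_mono) auto
      finally show "ennreal (norm (f t - s i t)) \<le> \<dots>" .
    qed
    also have "\<dots> = (\<integral>\<^sup>+t. b i t \<partial>M) + (\<integral>\<^sup>+y. ennreal (norm (h i y - s i y)) \<partial>M)"
      by (intro nn_integral_add b borel_measurable_norm_diff_simple hm s)
    finally show ?thesis using s1[of i] by (meson add_left_mono less_imp_le order_trans)
  qed
  have d0: "?d \<longlonglongrightarrow> 0"
  proof (rule tendsto_sandwich[OF _ _ tendsto_const])
    show "(\<lambda>i. (\<integral>\<^sup>+t. b i t \<partial>M) + ennreal (inverse (real (Suc i)))) \<longlonglongrightarrow> 0"
      using tendsto_add[OF lim inv0] by simp
  qed (use dle in auto)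
  have SS: "ennreal (norm (?S i - ?S j)) \<le> ?d i + ?d j" for i j
    using simple_bochner_integral_diff_le[OF f f s s, of "\<lambda>_. 0"] by simp
  have "Cauchy ?S"
  proof (rule CauchyI)
    fix e :: real assume e: "0 < e"
    then have "\<forall>\<^sub>F i in sequentially. ?d i < ennreal (e / 4)"
      by (intro order_tendstoD(2)[OF d0]) auto
    then obtain N where N: "\<And>i. i \<ge> N \<Longrightarrow> ?d i < ennreal (e / 4)"
      unfolding eventually_sequentially by blast
    have "norm (?S i - ?S j) < e" if "i \<ge> N" "j \<ge> N" for i j
    proof -
      have "ennreal (norm (?S i - ?S j)) \<le> ?d i + ?d j" by (rule SS)
      also have "\<dots> \<le> ennreal (e / 4) + ennreal (e / 4)"
        using N[OF that(1)] N[OF that(2)] by (intro add_mono less_imp_le)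
      also have "\<dots> = ennreal (e / 2)" using e by (simp flip: ennreal_plus)
      finally show ?thesis using e by (simp add: ennreal_le_iff)
    qed
    then show "\<exists>M. \<forall>m\<ge>M. \<forall>n\<ge>M. norm (?S m - ?S n) < e" by blast
  qed
  then obtain x where x: "?S \<longlonglongrightarrow> x"
    using Cauchy_convergent convergent_def by blast
  have "(\<lambda>i. X i - ?S i) \<longlonglongrightarrow> 0"
  proof (rule Lim_null_comparison[OF _ LIMSEQ_inverse_real_of_nat], rule always_eventually, rule allI)
    fix i show "norm (X i - ?S i) \<le> inverse (real (Suc i))"
      using s2[of i] by (simp add: dist_norm norm_minus_commute)
  qed
  from tendsto_add[OF this x] have "X \<longlonglongrightarrow> x" by simp
  moreover have "has_gen_bochner_integral M f x"
    using f s d0 x by (auto simp: has_gen_bochner_integral.simps)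
  ultimately show ?thesis using that by blast
qed

lemma has_gen_bochner_integral_add:
  assumes f: "has_gen_bochner_integral M f x" and g: "has_gen_bochner_integral M g y"
    and m: "(\<lambda>t. f t + g t) \<in> borel_measurable M"
  shows "has_gen_bochner_integral M (\<lambda>t. f t + g t) (x + y)"
proof -
  from f obtain s where f': "f \<in> borel_measurable M"
      "\<And>i. sb_integrable M (s i)"
      "(\<lambda>i. \<integral>\<^sup>+y. ennreal (norm (f y - s i y)) \<partial>M) \<longlonglongrightarrow> 0"
      "(\<lambda>i. sb_integral M (s i)) \<longlonglongrightarrow> x"
    by (auto simp: has_gen_bochner_integral.simps)
  from g obtain t where g': "g \<in> borel_measurable M"
      "\<And>i. sb_integrable M (t i)"
      "(\<lambda>i. \<integral>\<^sup>+y. ennreal (norm (g y - t i y)) \<partial>M) \<longlonglongrightarrow> 0"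
      "(\<lambda>i. sb_integral M (t i)) \<longlonglongrightarrow> y"
    by (auto simp: has_gen_bochner_integral.simps)
  show ?thesis
  proof (rule has_gen_bochner_integral.intros[where s = "\<lambda>i y. s i y + t i y"])
    show "(\<lambda>i. sb_integral M (\<lambda>y. s i y + t i y)) \<longlonglongrightarrow> x + y"
      using f' g' by (simp add: simple_bochner_integral_add tendsto_add)
    show "sb_integrable M (\<lambda>y. s i y + t i y)" for i
      using f' g' by (simp add: simple_bochner_integrable_compose2)
    show "(\<lambda>i. \<integral>\<^sup>+ y. ennreal (norm (f y + g y - (s i y + t i y))) \<partial>M) \<longlonglongrightarrow> 0"
    proof (rule tendsto_sandwich[OF _ _ tendsto_const])
      show "(\<lambda>i. (\<integral>\<^sup>+y. ennreal (norm (f y - s i y)) \<partial>M) + (\<integral>\<^sup>+y. ennreal (norm (g y - t i y)) \<partial>M)) \<longlonglongrightarrow> 0"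
        using tendsto_add[OF f'(3) g'(3)] by simp
      show "\<forall>\<^sub>F i in sequentially. (\<integral>\<^sup>+ y. ennreal (norm (f y + g y - (s i y + t i y))) \<partial>M)
          \<le> (\<integral>\<^sup>+y. ennreal (norm (f y - s i y)) \<partial>M) + (\<integral>\<^sup>+y. ennreal (norm (g y - t i y)) \<partial>M)"
      proof (intro always_eventually allI)
        fix i
        have "(\<integral>\<^sup>+ y. ennreal (norm (f y + g y - (s i y + t i y))) \<partial>M)
           \<le> (\<integral>\<^sup>+y. ennreal (norm (f y - s i y)) + ennreal (norm (g y - t i y)) \<partial>M)"
          by (auto intro!: nn_integral_mono norm_diff_triangle_ineq simp flip: ennreal_plus)
        also have "\<dots> = (\<integral>\<^sup>+y. ennreal (norm (f y - s i y)) \<partial>M) + (\<integral>\<^sup>+y. ennreal (norm (g y - t i y)) \<partial>M)"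
          by (intro nn_integral_add borel_measurable_norm_diff_simple f' g')
        finally show "(\<integral>\<^sup>+ y. ennreal (norm (f y + g y - (s i y + t i y))) \<partial>M) \<le> \<dots>" .
      qed
    qed auto
  qed (rule m)
qed

lemma has_gen_bochner_integral_zero: "has_gen_bochner_integral M (\<lambda>_. 0) 0"
  by (rule has_gen_bochner_integral.intros[where s = "\<lambda>_ _. 0"])
    (auto simp: Bochner_Integration.simple_bochner_integral_def sum.neutral
       intro!: Bochner_Integration.simple_bochner_integrable.intros)

lemma bounded_bilinear_scaleC:
  "bounded_bilinear (scaleC :: complex \<Rightarrow> 'a::complex_banach \<Rightarrow> 'a)"
proof
  show "(r *\<^sub>R a) *\<^sub>C b = r *\<^sub>R (a *\<^sub>C b)" for r and a :: complex and b :: 'a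
    by (simp add: scaleR_conv_of_real flip: scaleC_scaleC scaleC_of_real)
  show "a *\<^sub>C (r *\<^sub>R b) = r *\<^sub>R (a *\<^sub>C b)" for r and a :: complex and b :: 'a
    by (simp add: scaleC_scaleC mult.commute flip: scaleC_of_real)
  show "\<exists>K. \<forall>a (b::'a). norm (a *\<^sub>C b) \<le> norm a * norm b * K"
    by (rule exI[of _ 1]) (simp add: norm_scaleC)
qed (simp_all add: scaleC_add_left scaleC_add_right)

lemmas continuous_on_scaleC [continuous_intros] =
    bounded_bilinear.continuous_on[OF bounded_bilinear_scaleC]
  and scaleC_sum_right = bounded_bilinear.sum_right[OF bounded_bilinear_scaleC]
  and scaleC_diff_right = bounded_bilinear.diff_right[OF bounded_bilinear_scaleC]
  and scaleC_zero_left [simp] = bounded_bilinear.zero_left[OF bounded_bilinear_scaleC]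
  and scaleC_zero_right [simp] = bounded_bilinear.zero_right[OF bounded_bilinear_scaleC]
  and bounded_linear_scaleC_left = bounded_bilinear.bounded_linear_left[OF bounded_bilinear_scaleC]

lemma has_gen_bochner_integral_bounded_linear:
  assumes T: "bounded_linear T" and f: "has_gen_bochner_integral M f x"
  shows "has_gen_bochner_integral M (\<lambda>t. T (f t)) (T x)"
proof -
  interpret T: bounded_linear T by fact
  have [measurable]: "T \<in> borel_measurable borel"
    by (intro borel_measurable_continuous_onI T.continuous_on continuous_on_id)
  from f obtain s where f': "f \<in> borel_measurable M"
      "\<And>i. sb_integrable M (s i)"
      "(\<lambda>i. \<integral>\<^sup>+y. ennreal (norm (f y - s i y)) \<partial>M) \<longlonglongrightarrow> 0"
      "(\<lambda>i. sb_integral M (s i)) \<longlonglongrightarrow> x"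
    by (auto simp: has_gen_bochner_integral.simps)
  obtain K where K: "K > 0" "\<And>x. norm (T x) \<le> norm x * K" using T.pos_bounded by blast
  show ?thesis
  proof (rule has_gen_bochner_integral.intros[where s = "\<lambda>i y. T (s i y)"])
    show "(\<lambda>t. T (f t)) \<in> borel_measurable M" using f'(1) by measurable
    show "sb_integrable M (\<lambda>y. T (s i y))" for i
      by (rule simple_bochner_integrable_compose2[where p = "\<lambda>x y. T x", OF _ f'(2) f'(2)]) (rule T.zero)
    show "(\<lambda>i. sb_integral M (\<lambda>y. T (s i y))) \<longlonglongrightarrow> T x"
      using f' T.linear_axioms by (simp add: simple_bochner_integral_linear T.tendsto)
    show "(\<lambda>i. \<integral>\<^sup>+ y. ennreal (norm (T (f y) - T (s i y))) \<partial>M) \<longlonglongrightarrow> 0"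
    proof (rule tendsto_sandwich[OF _ _ tendsto_const])
      show "(\<lambda>i. ennreal K * (\<integral>\<^sup>+y. ennreal (norm (f y - s i y)) \<partial>M)) \<longlonglongrightarrow> 0"
        using ennreal_tendsto_cmult[OF _ f'(3), of "ennreal K"] by simp
      show "\<forall>\<^sub>F i in sequentially. (\<integral>\<^sup>+ y. ennreal (norm (T (f y) - T (s i y))) \<partial>M)
          \<le> ennreal K * (\<integral>\<^sup>+y. ennreal (norm (f y - s i y)) \<partial>M)"
      proof (intro always_eventually allI)
        fix i
        have "(\<integral>\<^sup>+ y. ennreal (norm (T (f y) - T (s i y))) \<partial>M)
          \<le> (\<integral>\<^sup>+y. ennreal K * ennreal (norm (f y - s i y)) \<partial>M)"
          using K by (auto intro!: nn_integral_mono ennreal_leI simp: mult.commute simp flip: ennreal_mult T.diff)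
        also have "\<dots> = ennreal K * (\<integral>\<^sup>+y. ennreal (norm (f y - s i y)) \<partial>M)"
          by (intro nn_integral_cmult borel_measurable_norm_diff_simple f')
        finally show "(\<integral>\<^sup>+ y. ennreal (norm (T (f y) - T (s i y))) \<partial>M) \<le> \<dots>" .
      qed
    qed auto
  qed
qed

lemma has_gen_bochner_integral_scaleC_const:
  fixes c :: "'a::complex_banach"
  assumes "integrable M \<phi>"
  shows "has_gen_bochner_integral M (\<lambda>t. \<phi> t *\<^sub>C c) ((\<integral>t. \<phi> t \<partial>M) *\<^sub>C c)"
  using assms has_bochner_integral_integrable[OF assms]
  by (intro has_gen_bochner_integral_bounded_linear[OF bounded_linear_scaleC_left])
     (simp add: has_gen_bochner_integral_iff)

text \<open>
  Finitely many scalar functions are jointly measurable as one map into the second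
  countable space of sequences, and the sum is a continuous function of that map. This is
  why finite sums of scalar functions times vectors are the test functions of this theory:
  they may be added freely, and Fubini's theorem and changes of variables hold for them
  because they hold for scalars.
\<close>

lemma borel_measurable_tensor_sum:
  fixes C :: "'a::complex_banach set"
  assumes C: "finite C" and \<phi>: "\<And>c. c \<in> C \<Longrightarrow> \<phi> c \<in> borel_measurable M"
  shows "(\<lambda>t. \<Sum>c\<in>C. \<phi> c t *\<^sub>C c) \<in> borel_measurable M"
proof -
  obtain e where e: "bij_betw e {..<card C} C"
    using ex_bij_betw_nat_finite[OF C] by (auto simp: atLeast0LessThan)
  define h where "h = (\<lambda>t j. if j < card C then \<phi> (e j) t else 0)"
  have "h \<in> borel_measurable M"
  proof (rule measurable_coordinatewise_then_product)
    fix j show "(\<lambda>t. h t j) \<in> borel_measurable M"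
      using \<phi>[of "e j"] bij_betwE[OF e] by (cases "j < card C") (simp_all add: h_def)
  qed
  moreover have "continuous_on UNIV (\<lambda>a :: nat \<Rightarrow> complex. \<Sum>j<card C. a j *\<^sub>C e j)"
    by (intro continuous_intros continuous_on_product_coordinates)
  ultimately have "(\<lambda>t. \<Sum>j<card C. h t j *\<^sub>C e j) \<in> borel_measurable M"
    by (rule measurable_compose[OF _ borel_measurable_continuous_onI])
  also have "(\<lambda>t. \<Sum>j<card C. h t j *\<^sub>C e j) = (\<lambda>t. \<Sum>c\<in>C. \<phi> c t *\<^sub>C c)"
    using sum.reindex_bij_betw[OF e, of "\<lambda>c. \<phi> c _ *\<^sub>C c"] by (auto simp: h_def)
  finally show ?thesis .
qed

lemma has_gen_bochner_integral_tensor_sum: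
  fixes C :: "'a::complex_banach set"
  assumes C: "finite C" and \<phi>: "\<And>c. c \<in> C \<Longrightarrow> integrable M (\<phi> c)"
  shows "has_gen_bochner_integral M (\<lambda>t. \<Sum>c\<in>C. \<phi> c t *\<^sub>C c) (\<Sum>c\<in>C. (\<integral>t. \<phi> c t \<partial>M) *\<^sub>C c)"
  using assms
proof (induction C rule: finite_induct)
  case empty
  then show ?case by (simp add: has_gen_bochner_integral_zero)
next
  case (insert c C)
  have "(\<lambda>t. \<Sum>c\<in>insert c C. \<phi> c t *\<^sub>C c) \<in> borel_measurable M"
    using insert by (intro borel_measurable_tensor_sum) auto
  then show ?case
    using insert by (auto intro!: has_gen_bochner_integral_add has_gen_bochner_integral_scaleC_const)
qed

lemma gen_bochner_nn_integral_finite: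
  assumes "has_gen_bochner_integral M f x"
  shows "(\<integral>\<^sup>+t. ennreal (norm (f t)) \<partial>M) < \<infinity>"
proof -
  from assms obtain s where f': "f \<in> borel_measurable M"
      "\<And>i. sb_integrable M (s i)"
      "(\<lambda>i. \<integral>\<^sup>+y. ennreal (norm (f y - s i y)) \<partial>M) \<longlonglongrightarrow> 0"
    by (auto simp: has_gen_bochner_integral.simps)
  from order_tendstoD(2)[OF f'(3), of 1] obtain i
    where i: "(\<integral>\<^sup>+y. ennreal (norm (f y - s i y)) \<partial>M) < 1"
    by (auto simp: eventually_sequentially)
  have sn: "sb_integrable M (\<lambda>y. norm (s i y))"
    by (rule simple_bochner_integrable_compose2[where p = "\<lambda>x y. norm x", OF _ f'(2) f'(2)]) simp
  have fin: "(\<integral>\<^sup>+y. ennreal (norm (s i y)) \<partial>M) < \<infinity>"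
    using simple_bochner_integral_eq_nn_integral[OF sn] by (metis ennreal_less_top infinity_ennreal_def norm_ge_zero)
  have "(\<integral>\<^sup>+t. ennreal (norm (f t)) \<partial>M)
      \<le> (\<integral>\<^sup>+t. ennreal (norm (f t - s i t)) + ennreal (norm (s i t)) \<partial>M)"
  proof (rule nn_integral_mono)
    fix t
    show "ennreal (norm (f t)) \<le> ennreal (norm (f t - s i t)) + ennreal (norm (s i t))"
      using norm_triangle_ineq[of "f t - s i t" "s i t"] by (simp add: ennreal_leI flip: ennreal_plus)
  qed
  also have "\<dots> = (\<integral>\<^sup>+t. ennreal (norm (f t - s i t)) \<partial>M) + (\<integral>\<^sup>+t. ennreal (norm (s i t)) \<partial>M)"
    using borel_measurable_norm_diff_simple[OF f'(1) f'(2)]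
      measurable_compose[OF borel_measurable_simple_function[OF
        simple_bochner_integrable_imp_simple[OF sn]] measurable_ennreal]
    by (rule nn_integral_add)
  also have "\<dots> < \<infinity>"
    using fin order.strict_trans[OF i ennreal_one_less_top] by (simp add: ennreal_add_less_top)
  finally show ?thesis .
qed

lemma simple_bochner_completion:
  assumes "simple_function M s"
  shows "sb_integrable (completion M) s
      \<longleftrightarrow> sb_integrable M s"
    and "sb_integral (completion M) s
      = sb_integral M s"
proof -
  have s: "{y \<in> space M. P (s y)} \<in> sets M" for P
  proof -
    have "s -` {v. P v} \<inter> space M = {y \<in> space M. P (s y)}" by auto
    then show ?thesis
      using measurable_sets[OF measurable_simple_function[OF assms], of "{v. P v}"] by simp
  qed
  show "sb_integrable (completion M) s
      \<longleftrightarrow> sb_integrable M s"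
    using assms s[of "\<lambda>v. v \<noteq> 0"]
    by (simp add: Bochner_Integration.simple_bochner_integrable.simps simple_function_completion)
  show "sb_integral (completion M) s
      = sb_integral M s"
    unfolding Bochner_Integration.simple_bochner_integral_def space_completion
    by (rule sum.cong) (use s[of "\<lambda>v. v = _"] in \<open>simp_all add: measure_def\<close>)
qed

text \<open>
  Product measures and Fubini's theorem live on Borel sets, so the integrals of Borel
  functions are moved from \<open>lebesgue\<close> to \<open>lborel\<close>. A simple function for the completed measure
  agrees almost everywhere with a simple function for the original one.
\<close>

lemma has_gen_bochner_integral_completion:
  assumes f: "f \<in> borel_measurable M"
  shows "has_gen_bochner_integral (completion M) f x \<longleftrightarrow> has_gen_bochner_integral M f x"
proof
  assume h: "has_gen_bochner_integral M f x"
  then obtain s where s: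
      "\<And>i. sb_integrable M (s i)"
      "(\<lambda>i. \<integral>\<^sup>+y. ennreal (norm (f y - s i y)) \<partial>M) \<longlonglongrightarrow> 0"
      "(\<lambda>i. sb_integral M (s i)) \<longlonglongrightarrow> x"
    by (auto simp: has_gen_bochner_integral.simps)
  have sf: "simple_function M (s i)" for i
    using s(1) by (rule simple_bochner_integrable_imp_simple)
  show "has_gen_bochner_integral (completion M) f x"
  proof (rule has_gen_bochner_integral.intros[where s = s])
    show "f \<in> borel_measurable (completion M)" using f by (rule measurable_completion)
    show "(\<lambda>i. \<integral>\<^sup>+y. ennreal (norm (f y - s i y)) \<partial>completion M) \<longlonglongrightarrow> 0"
      using s(2) by (subst nn_integral_completion) (use f s(1) borel_measurable_norm_diff_simple in blast)+
  qed (use s simple_bochner_completion[OF sf] in simp_all)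
next
  assume h: "has_gen_bochner_integral (completion M) f x"
  then obtain s where s:
      "\<And>i. sb_integrable (completion M) (s i)"
      "(\<lambda>i. \<integral>\<^sup>+y. ennreal (norm (f y - s i y)) \<partial>completion M) \<longlonglongrightarrow> 0"
      "(\<lambda>i. sb_integral (completion M) (s i)) \<longlonglongrightarrow> x"
    unfolding has_gen_bochner_integral.simps by blast
  have "\<exists>s'. simple_function M s' \<and> (AE y in M. s i y = s' y)" for i
    by (intro completion_ex_simple_function simple_bochner_integrable_imp_simple s)
  then have "\<forall>i. \<exists>s'. simple_function M s' \<and> (AE y in M. s i y = s' y)" ..
  from choice[OF this] obtain t where
      t: "\<And>i. simple_function M (t i)" "\<And>i. AE y in M. s i y = t i y"
    by blast
  have tc: "AE y in completion M. s i y = t i y" for i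
    using t(2)[of i] by (rule AE_completion)
  have t_int: "sb_integrable (completion M) (t i)" for i
  proof (rule simple_bochner_integrableI_bounded)
    show "simple_function (completion M) (t i)" by (rule simple_function_completion[OF t(1)])
    have sn: "sb_integrable (completion M) (\<lambda>y. norm (s i y))"
      by (rule simple_bochner_integrable_compose2[where p = "\<lambda>x y. norm x", OF _ s(1) s(1)]) simp
    have "(\<integral>\<^sup>+y. ennreal (norm (t i y)) \<partial>completion M) = (\<integral>\<^sup>+y. ennreal (norm (s i y)) \<partial>completion M)"
      by (rule nn_integral_cong_AE) (use tc[of i] in eventually_elim, simp)
    also have "\<dots> < \<infinity>"
      using simple_bochner_integral_eq_nn_integral[OF sn]
      by (metis ennreal_less_top infinity_ennreal_def norm_ge_zero)
    finally show "(\<integral>\<^sup>+y. ennreal (norm (t i y)) \<partial>completion M) < \<infinity>" .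
  qed
  have d: "(\<integral>\<^sup>+y. ennreal (norm (f y - t i y)) \<partial>completion M)
      = (\<integral>\<^sup>+y. ennreal (norm (f y - s i y)) \<partial>completion M)" for i
    by (rule nn_integral_cong_AE) (use tc[of i] in eventually_elim, simp)
  have t_int': "sb_integrable M (t i)" for i
    using t_int simple_bochner_completion(1)[OF t(1)] by blast
  have d': "(\<integral>\<^sup>+y. ennreal (norm (f y - t i y)) \<partial>M)
      = (\<integral>\<^sup>+y. ennreal (norm (f y - s i y)) \<partial>completion M)" for i
    unfolding d[symmetric]
    by (intro nn_integral_completion[symmetric] borel_measurable_norm_diff_simple f t_int')
  have "(\<lambda>i. ennreal (norm (sb_integral (completion M) (t i)
          - sb_integral (completion M) (s i)))) \<longlonglongrightarrow> 0"
  proof (rule tendsto_sandwich[OF _ _ tendsto_const])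
    show "(\<lambda>i. (\<integral>\<^sup>+y. ennreal (norm (f y - s i y)) \<partial>completion M)
        + (\<integral>\<^sup>+y. ennreal (norm (f y - s i y)) \<partial>completion M)) \<longlonglongrightarrow> 0"
      using tendsto_add[OF s(2) s(2)] by simp
    show "\<forall>\<^sub>F i in sequentially. ennreal (norm (sb_integral (completion M) (t i)
          - sb_integral (completion M) (s i)))
       \<le> (\<integral>\<^sup>+y. ennreal (norm (f y - s i y)) \<partial>completion M)
        + (\<integral>\<^sup>+y. ennreal (norm (f y - s i y)) \<partial>completion M)"
      using simple_bochner_integral_diff_le[OF _ _ t_int s(1), of f f "\<lambda>_. 0"] f d
      by (simp add: measurable_completion)
  qed auto
  then have "(\<lambda>i. norm (sb_integral (completion M) (t i)
          - sb_integral (completion M) (s i))) \<longlonglongrightarrow> 0"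
    by (subst tendsto_ennreal_iff[symmetric]) auto
  from Lim_transform[OF s(3) tendsto_norm_zero_cancel[OF this]]
  have lim: "(\<lambda>i. sb_integral M (t i)) \<longlonglongrightarrow> x"
    by (simp add: simple_bochner_completion(2)[OF t(1)])
  show "has_gen_bochner_integral M f x"
    by (rule has_gen_bochner_integral.intros[where s = t]) (use f t_int' d' s(2) lim in auto)
qed

section \<open>The partial Fourier integral as a convolution\<close>

text \<open>
  The Fourier transform of the indicator of the ball of radius \<open>R\<close>; divided by \<open>(2 * pi) ^ n\<close> it
  is the Dirichlet kernel of spherical summation.
\<close>

definition ball_kernel :: "real \<Rightarrow> real ^ 'n::finite \<Rightarrow> complex" where
  "ball_kernel R y =
     (\<integral>\<xi>. indicat_real {\<xi>. norm \<xi> \<le> R} \<xi> *\<^sub>R exp (\<i> * complex_of_real (\<xi> \<bullet> y)) \<partial>lborel)"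

lemma emeasure_norm_le_finite: "emeasure lborel {\<xi> :: 'b::euclidean_space. norm \<xi> \<le> R} < \<infinity>"
proof -
  have "{\<xi> :: 'b. norm \<xi> \<le> R} = cball 0 R" by auto
  then show ?thesis using emeasure_lborel_cball_finite by simp
qed

lemma norm_ball_kernel_le:
  "norm (ball_kernel R (y :: real ^ 'n::finite)) \<le> measure lborel {\<xi> :: real ^ 'n. norm \<xi> \<le> R}"
proof -
  let ?B = "{\<xi> :: real ^ 'n. norm \<xi> \<le> R}"
  have "norm (ball_kernel R y) \<le> (\<integral>\<xi>. indicat_real ?B \<xi> \<partial>lborel)"
    unfolding ball_kernel_def
  proof (rule Bochner_Integration.integral_norm_bound_integral)
    show "integrable lborel (\<lambda>\<xi>. indicat_real ?B \<xi> *\<^sub>R exp (\<i> * complex_of_real (\<xi> \<bullet> y)))"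
      using emeasure_norm_le_finite by (intro integrableI_bounded_set_indicator[where B = 1]) auto
    show "integrable lborel (indicat_real ?B)"
      using emeasure_norm_le_finite[of R, where ?'b = "real ^ 'n"] by (intro integrable_real_indicator) auto
  qed (simp add: indicator_def)
  then show ?thesis by simp
qed

lemma ball_kernel_Fubini:
  fixes x :: "real ^ 'n::finite"
  assumes A [measurable]: "A \<in> sets lborel" and fin: "emeasure lborel A < \<infinity>"
  shows "(\<integral>\<xi>. indicat_real {\<xi>. norm \<xi> \<le> R} \<xi> *\<^sub>R (exp (\<i> * complex_of_real (x \<bullet> \<xi>))
             * (\<integral>y. exp (- \<i> * complex_of_real (\<xi> \<bullet> y)) * indicator A y \<partial>lborel)) \<partial>lborel)
       = (\<integral>y. ball_kernel R (x - y) * indicator A y \<partial>lborel)"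
proof -
  let ?B = "{\<xi> :: real ^ 'n. norm \<xi> \<le> R}"
  define f :: "real ^ 'n \<Rightarrow> real ^ 'n \<Rightarrow> complex" where
    "f = (\<lambda>\<xi> y. indicat_real ?B \<xi> *\<^sub>R (exp (\<i> * complex_of_real (\<xi> \<bullet> (x - y))) * indicator A y))"
  have int: "integrable (lborel \<Otimes>\<^sub>M lborel) (case_prod f)"
  proof (rule integrableI_bounded_set[where A = "?B \<times> A" and B = 1])
    have "?B \<in> sets lborel" by simp
    then show "?B \<times> A \<in> sets (lborel \<Otimes>\<^sub>M lborel)" by (intro pair_measureI A)
    show "case_prod f \<in> borel_measurable (lborel \<Otimes>\<^sub>M lborel)" unfolding f_def by measurable
    have "emeasure (lborel \<Otimes>\<^sub>M lborel) (?B \<times> A) = emeasure lborel ?B * emeasure lborel A"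
      using \<open>?B \<in> sets lborel\<close> by (intro lborel.emeasure_pair_measure_Times A)
    then show "emeasure (lborel \<Otimes>\<^sub>M lborel) (?B \<times> A) < \<infinity>"
      using emeasure_norm_le_finite[of R, where ?'b = "real ^ 'n"] fin
      by (simp add: ennreal_mult_less_top)
    show "AE z in lborel \<Otimes>\<^sub>M lborel. z \<in> ?B \<times> A \<longrightarrow> norm (case_prod f z) \<le> 1"
      by (auto simp: f_def norm_mult indicator_def split: prod.splits)
    show "AE z in lborel \<Otimes>\<^sub>M lborel. z \<notin> ?B \<times> A \<longrightarrow> case_prod f z = 0"
      by (auto simp: f_def indicator_def split: prod.splits)
  qed
  have "(\<integral>y. (\<integral>\<xi>. f \<xi> y \<partial>lborel) \<partial>lborel) = (\<integral>\<xi>. (\<integral>y. f \<xi> y \<partial>lborel) \<partial>lborel)"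
    by (rule lborel_pair.Fubini_integral[OF int])
  moreover have "(\<integral>\<xi>. f \<xi> y \<partial>lborel) = ball_kernel R (x - y) * indicator A y" for y
    unfolding f_def ball_kernel_def by (cases "y \<in> A") simp_all
  moreover have "(\<integral>y. f \<xi> y \<partial>lborel) = indicat_real ?B \<xi> *\<^sub>R (exp (\<i> * complex_of_real (x \<bullet> \<xi>))
             * (\<integral>y. exp (- \<i> * complex_of_real (\<xi> \<bullet> y)) * indicator A y \<partial>lborel))" for \<xi>
  proof -
    have "f \<xi> y = indicat_real ?B \<xi> *\<^sub>R (exp (\<i> * complex_of_real (x \<bullet> \<xi>))
             * (exp (- \<i> * complex_of_real (\<xi> \<bullet> y)) * indicator A y))" for y
      by (simp add: f_def inner_diff_right inner_commute ring_distribs flip: exp_add)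
    then show ?thesis by simp
  qed
  ultimately show ?thesis by simp
qed

text \<open>
  \<open>S_R\<close> is the convolution with the ball kernel. Both sides depend continuously on \<open>F\<close> in the
  \<open>L\<^sup>1\<close> norm, since the transform of \<open>F\<close> and the kernel are bounded and the frequencies lie in
  a ball of finite measure. It therefore suffices to compare them on simple functions, where
  the claim is Fubini's theorem for the indicators of the level sets.
\<close>

lemma S_R_eq_ball_kernel_integral:
  fixes F :: "real ^ 'n::finite \<Rightarrow> 'a::complex_banach"
  assumes int: "gen_bochner_integrable lebesgue F" and F: "continuous_on UNIV F"
    and K: "continuous_on UNIV (ball_kernel R :: real ^ 'n \<Rightarrow> complex)"
  shows "has_gen_bochner_integral lborel (\<lambda>y. ball_kernel R (x - y) *\<^sub>C F y)
           ((2 * pi) ^ CARD('n) *\<^sub>R S_R R F x)"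
proof -
  have F_meas: "F \<in> borel_measurable lborel"
    using F by (simp add: borel_measurable_continuous_onI)
  obtain I where "has_gen_bochner_integral lborel F I"
    using int has_gen_bochner_integral_completion[OF F_meas] by (auto simp: gen_bochner_integrable_def)
  then obtain s where s: "\<And>i. sb_integrable lborel (s i)"
    and d0: "(\<lambda>i. \<integral>\<^sup>+y. ennreal (norm (F y - s i y)) \<partial>lborel) \<longlonglongrightarrow> 0"
    unfolding has_gen_bochner_integral.simps by blast
  define d where "d = (\<lambda>i. \<integral>\<^sup>+y. ennreal (norm (F y - s i y)) \<partial>lborel)"
  have d0: "d \<longlonglongrightarrow> 0" using d0 by (simp add: d_def)
  have dm: "(\<lambda>y. ennreal (norm (F y - s i y))) \<in> borel_measurable lborel" for i
    by (rule borel_measurable_norm_diff_simple[OF F_meas s])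
  \<comment> \<open>The level set of the value 0 has infinite measure and is left out.\<close>
  define C where "C = (\<lambda>i. s i ` UNIV - {0})"
  have finC: "finite (C i)" for i
    using simple_bochner_integrable_imp_simple[OF s[of i]] by (simp add: C_def simple_function_def)
  define lev where "lev = (\<lambda>i c. s i -` {c})"
  have lev_sets [measurable]: "lev i c \<in> sets borel" if "c \<in> C i" for i c
    using simple_bochner_integrable_imp_simple[OF s[of i]] that
    by (auto simp: C_def lev_def simple_function_def)
  have lev_fin: "emeasure lborel (lev i c) < \<infinity>" if "c \<in> C i" for i c
  proof -
    have "emeasure lborel (lev i c) \<le> emeasure lborel {y \<in> space lborel. s i y \<noteq> 0}"
    proof (rule emeasure_mono)
      have "s i -` {v. v \<noteq> 0} \<inter> space lborel \<in> sets lborel"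
        using measurable_sets[OF measurable_simple_function[OF simple_bochner_integrable_imp_simple[OF s[of i]]], of "{v. v \<noteq> 0}"]
        by (simp only: sets_count_space Pow_UNIV UNIV_I)
      also have "s i -` {v. v \<noteq> 0} \<inter> space lborel = {y \<in> space lborel. s i y \<noteq> 0}" by auto
      finally show "{y \<in> space lborel. s i y \<noteq> 0} \<in> sets lborel" .
    qed (use that in \<open>auto simp: C_def lev_def\<close>)
    also have "\<dots> < \<infinity>"
      using s[of i] by (auto simp: Bochner_Integration.simple_bochner_integrable.simps less_top)
    finally show ?thesis .
  qed
  have decomp: "k y *\<^sub>C s i y = (\<Sum>c\<in>C i. (k y * indicator (lev i c) y) *\<^sub>C c)" for k y i
  proof (cases "s i y = 0")
    case True
    then show ?thesis by (auto simp: lev_def C_def indicator_def intro!: sum.neutral[symmetric])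
  next
    case False
    then have "s i y \<in> C i" by (auto simp: C_def)
    moreover have "(\<Sum>c\<in>C i - {s i y}. (k y * indicator (lev i c) y) *\<^sub>C c) = 0"
      by (rule sum.neutral) (simp add: lev_def indicator_def)
    ultimately have "(\<Sum>c\<in>C i. (k y * indicator (lev i c) y) *\<^sub>C c)
        = (k y * indicator (lev i (s i y)) y) *\<^sub>C s i y"
      by (subst sum.remove[OF finC]) auto
    then show ?thesis by (simp add: lev_def)
  qed
  have int_ind: "integrable lborel (\<lambda>y. k y * indicator (lev i c) y :: complex)"
    if "c \<in> C i" "k \<in> borel_measurable borel" "\<And>y. norm (k y) \<le> B" for k i c B
  proof (rule integrableI_bounded_set[where A = "lev i c" and B = B])
    show "lev i c \<in> sets lborel" using lev_sets[OF that(1)] by simp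
    then show "(\<lambda>y. k y * indicator (lev i c) y) \<in> borel_measurable lborel"
      using that(2) by (intro borel_measurable_times borel_measurable_indicator) auto
    have "0 \<le> B" using that(3)[of undefined] norm_ge_zero order_trans by blast
    then show "AE y in lborel. y \<in> lev i c \<longrightarrow> norm (k y * indicator (lev i c) y) \<le> B"
      using that(3) by (auto simp: indicator_def norm_mult)
  qed (use lev_fin[OF that(1)] in \<open>auto simp: indicator_def\<close>)
  define e :: "real ^ 'n \<Rightarrow> real ^ 'n \<Rightarrow> complex"
    where "e = (\<lambda>\<xi> y. exp (- \<i> * complex_of_real (\<xi> \<bullet> y)))"
  have norm_e: "norm (e \<xi> y) = 1" for \<xi> y by (simp add: e_def)
  have e_cont: "continuous_on UNIV (e \<xi>)" for \<xi> unfolding e_def by (intro continuous_intros)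
  define a where "a = (\<lambda>i c \<xi>. \<integral>y. e \<xi> y * indicator (lev i c) y \<partial>lborel)"
  have int_e: "integrable lborel (\<lambda>y. e \<xi> y * indicator (lev i c) y)" if "c \<in> C i" for i c \<xi>
    using that norm_e by (intro int_ind[where B = 1] borel_measurable_continuous_onI e_cont) auto
  have hat_s: "has_gen_bochner_integral lborel (\<lambda>y. \<Sum>c\<in>C i. (e \<xi> y * indicator (lev i c) y) *\<^sub>C c)
     (\<Sum>c\<in>C i. a i c \<xi> *\<^sub>C c)" for i \<xi>
    unfolding a_def by (intro has_gen_bochner_integral_tensor_sum finC int_e)
  \<comment> \<open>The one estimate behind all three limits below, with k a character or the ball kernel.\<close>
  have diff_s: "ennreal (norm (k y *\<^sub>C F y - (\<Sum>c\<in>C i. (k y * indicator (lev i c) y) *\<^sub>C c)))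
      \<le> ennreal B * ennreal (norm (F y - s i y))" if "norm (k y) \<le> B" for k y i B
  proof -
    have "norm (k y *\<^sub>C F y - k y *\<^sub>C s i y) = norm (k y) * norm (F y - s i y)"
      by (simp add: norm_scaleC flip: scaleC_diff_right)
    also have "\<dots> \<le> B * norm (F y - s i y)" using that by (intro mult_right_mono) auto
    finally show ?thesis
      using order_trans[OF norm_ge_zero that] by (simp add: decomp ennreal_leI flip: ennreal_mult)
  qed
  have hat_F: "has_gen_bochner_integral lborel (\<lambda>y. e \<xi> y *\<^sub>C F y) (fourier F \<xi>)" for \<xi>
  proof -
    have m: "(\<lambda>y. e \<xi> y *\<^sub>C F y) \<in> borel_measurable lborel"
      using e_cont F by (simp add: borel_measurable_continuous_onI continuous_on_scaleC)
    obtain X where X: "has_gen_bochner_integral lborel (\<lambda>y. e \<xi> y *\<^sub>C F y) X"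
    proof (rule has_gen_bochner_integral_limit[OF m hat_s dm])
      show "ennreal (norm (e \<xi> y *\<^sub>C F y - (\<Sum>c\<in>C i. (e \<xi> y * indicator (lev i c) y) *\<^sub>C c)))
         \<le> ennreal (norm (F y - s i y))" for i y
        using diff_s[of "e \<xi>" y 1 i] norm_e by simp
    qed (use d0 in \<open>simp add: d_def\<close>)
    then have "has_gen_bochner_integral lebesgue (\<lambda>y. e \<xi> y *\<^sub>C F y) X"
      using has_gen_bochner_integral_completion[OF m] by simp
    then have "fourier F \<xi> = X"
      unfolding fourier_def e_def by (rule gen_bochner_integral_eqI)
    with X show ?thesis by simp
  qed
  have hat_diff: "ennreal (norm (fourier F \<xi> - (\<Sum>c\<in>C i. a i c \<xi> *\<^sub>C c))) \<le> d i" for i \<xi>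
    unfolding d_def
  proof (rule has_gen_bochner_integral_norm_diff_le[OF hat_F hat_s dm])
    show "ennreal (norm (e \<xi> y *\<^sub>C F y - (\<Sum>c\<in>C i. (e \<xi> y * indicator (lev i c) y) *\<^sub>C c)))
         \<le> ennreal (norm (F y - s i y))" for y
      using diff_s[of "e \<xi>" y 1 i] norm_e by simp
  qed
  let ?B = "{\<xi> :: real ^ 'n. norm \<xi> \<le> R}"
  define H where "H = (\<lambda>\<xi>. indicat_real ?B \<xi> *\<^sub>R (exp (\<i> * complex_of_real (x \<bullet> \<xi>)) *\<^sub>C fourier F \<xi>))"
  define b where "b = (\<lambda>i c \<xi>. indicat_real ?B \<xi> *\<^sub>R (exp (\<i> * complex_of_real (x \<bullet> \<xi>)) * a i c \<xi>))"
  have H_diff: "ennreal (norm (H \<xi> - (\<Sum>c\<in>C i. b i c \<xi> *\<^sub>C c))) \<le> d i * indicator ?B \<xi>" for i \<xi>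
  proof (cases "\<xi> \<in> ?B")
    case True
    have "H \<xi> - (\<Sum>c\<in>C i. b i c \<xi> *\<^sub>C c)
        = exp (\<i> * complex_of_real (x \<bullet> \<xi>)) *\<^sub>C (fourier F \<xi> - (\<Sum>c\<in>C i. a i c \<xi> *\<^sub>C c))"
      using True by (simp add: H_def b_def scaleC_diff_right scaleC_sum_right scaleC_scaleC)
    then have "norm (H \<xi> - (\<Sum>c\<in>C i. b i c \<xi> *\<^sub>C c)) = norm (fourier F \<xi> - (\<Sum>c\<in>C i. a i c \<xi> *\<^sub>C c))"
      by (simp add: norm_scaleC)
    then show ?thesis using hat_diff[of \<xi> i] True by simp
  next
    case False
    then show ?thesis by (simp add: H_def b_def)
  qed
  have a_meas: "a i c \<in> borel_measurable lborel" if "c \<in> C i" for i c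
  proof -
    note [measurable] = lev_sets[OF that]
    have "(\<lambda>(\<xi>, y). e \<xi> y * indicator (lev i c) y :: complex) \<in> borel_measurable (lborel \<Otimes>\<^sub>M lborel)"
      unfolding e_def by measurable
    from lborel.borel_measurable_lebesgue_integral[OF this] show ?thesis unfolding a_def .
  qed
  have b_int: "integrable lborel (b i c)" if "c \<in> C i" for i c
  proof (rule integrableI_bounded_set[where A = ?B and B = "measure lborel (lev i c)"])
    show "b i c \<in> borel_measurable lborel"
      unfolding b_def using a_meas[OF that] by measurable
    have "norm (a i c \<xi>) \<le> measure lborel (lev i c)" for \<xi>
    proof -
      have "norm (a i c \<xi>) \<le> (\<integral>y. indicat_real (lev i c) y \<partial>lborel)"
        unfolding a_def
      proof (rule Bochner_Integration.integral_norm_bound_integral[OF int_e[OF that]])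
        show "integrable lborel (indicat_real (lev i c))"
          using lev_sets[OF that] lev_fin[OF that] by (intro integrable_real_indicator) auto
      qed (simp add: norm_mult norm_e indicator_def)
      then show ?thesis using lev_sets[OF that] by simp
    qed
    then show "AE \<xi> in lborel. \<xi> \<in> ?B \<longrightarrow> norm (b i c \<xi>) \<le> measure lborel (lev i c)"
      by (auto simp: b_def norm_mult indicator_def)
  qed (use emeasure_norm_le_finite in \<open>auto simp: b_def indicator_def\<close>)
  have H_s: "has_gen_bochner_integral lborel (\<lambda>\<xi>. \<Sum>c\<in>C i. b i c \<xi> *\<^sub>C c)
     (\<Sum>c\<in>C i. (\<integral>\<xi>. b i c \<xi> \<partial>lborel) *\<^sub>C c)" for i
    by (intro has_gen_bochner_integral_tensor_sum finC b_int)
  have H_meas: "H \<in> borel_measurable lborel"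
  proof (rule borel_measurable_LIMSEQ_metric)
    show "(\<lambda>\<xi>. \<Sum>c\<in>C i. b i c \<xi> *\<^sub>C c) \<in> borel_measurable lborel" for i
      using b_int by (intro borel_measurable_tensor_sum finC) auto
    fix \<xi>
    have "(\<lambda>i. ennreal (norm (H \<xi> - (\<Sum>c\<in>C i. b i c \<xi> *\<^sub>C c)))) \<longlonglongrightarrow> 0"
    proof (rule tendsto_sandwich[OF _ _ tendsto_const d0])
      have "d i * indicator ?B \<xi> \<le> d i" for i by (simp add: indicator_def)
      with H_diff show "\<forall>\<^sub>F i in sequentially. ennreal (norm (H \<xi> - (\<Sum>c\<in>C i. b i c \<xi> *\<^sub>C c))) \<le> d i"
        by (blast intro: always_eventually order_trans)
    qed simp
    then have "(\<lambda>i. norm (H \<xi> - (\<Sum>c\<in>C i. b i c \<xi> *\<^sub>C c))) \<longlonglongrightarrow> 0"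
      by (subst tendsto_ennreal_iff[symmetric]) auto
    from tendsto_norm_zero_cancel[OF this]
    have "(\<lambda>i. H \<xi> - (H \<xi> - (\<Sum>c\<in>C i. b i c \<xi> *\<^sub>C c))) \<longlonglongrightarrow> H \<xi> - 0"
      by (intro tendsto_diff tendsto_const)
    then show "(\<lambda>i. \<Sum>c\<in>C i. b i c \<xi> *\<^sub>C c) \<longlonglongrightarrow> H \<xi>" by simp
  qed
  have lim1: "(\<lambda>i. \<integral>\<^sup>+\<xi>. d i * indicator ?B \<xi> \<partial>lborel) \<longlonglongrightarrow> 0"
  proof -
    have "(\<integral>\<^sup>+\<xi>. d i * indicator ?B \<xi> \<partial>lborel) = emeasure lborel ?B * d i" for i
      by (simp add: nn_integral_cmult_indicator mult.commute)
    moreover have "(\<lambda>i. emeasure lborel ?B * d i) \<longlonglongrightarrow> emeasure lborel ?B * 0"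
      using emeasure_norm_le_finite by (intro ennreal_tendsto_cmult d0) auto
    ultimately show ?thesis by simp
  qed
  obtain X where X: "has_gen_bochner_integral lborel H X"
      "(\<lambda>i. \<Sum>c\<in>C i. (\<integral>\<xi>. b i c \<xi> \<partial>lborel) *\<^sub>C c) \<longlonglongrightarrow> X"
    by (rule has_gen_bochner_integral_limit[OF H_meas H_s _ H_diff lim1]) auto
  have X_eq: "(2 * pi) ^ CARD('n) *\<^sub>R S_R R F x = X"
  proof -
    have "has_gen_bochner_integral lebesgue H X"
      using has_gen_bochner_integral_completion[OF H_meas] X(1) by simp
    then have "gen_bochner_integral lebesgue H = X" by (rule gen_bochner_integral_eqI)
    then show ?thesis by (simp add: S_R_def H_def)
  qed
  let ?k = "\<lambda>y. ball_kernel R (x - y) :: complex"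
  let ?V = "measure lborel ?B"
  have k_cont: "continuous_on UNIV ?k"
    by (rule continuous_on_compose2[OF K]) (auto intro!: continuous_intros)
  have k_le: "norm (?k y) \<le> ?V" for y by (rule norm_ball_kernel_le)
  have k_s: "has_gen_bochner_integral lborel (\<lambda>y. \<Sum>c\<in>C i. (?k y * indicator (lev i c) y) *\<^sub>C c)
     (\<Sum>c\<in>C i. (\<integral>\<xi>. b i c \<xi> \<partial>lborel) *\<^sub>C c)" for i
  proof -
    have "(\<Sum>c\<in>C i. (\<integral>\<xi>. b i c \<xi> \<partial>lborel) *\<^sub>C c)
        = (\<Sum>c\<in>C i. (\<integral>y. ?k y * indicator (lev i c) y \<partial>lborel) *\<^sub>C c)"
      unfolding b_def a_def e_def
      by (intro sum.cong refl arg_cong2[where f = scaleC] ball_kernel_Fubini)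
         (use lev_sets lev_fin in auto)
    then show ?thesis
      using k_cont k_le
      by (simp only:) (intro has_gen_bochner_integral_tensor_sum finC int_ind borel_measurable_continuous_onI)
  qed
  have k_meas: "(\<lambda>y. ?k y *\<^sub>C F y) \<in> borel_measurable lborel"
    using k_cont F by (simp add: borel_measurable_continuous_onI continuous_on_scaleC)
  have lim2: "(\<lambda>i. \<integral>\<^sup>+y. ennreal ?V * ennreal (norm (F y - s i y)) \<partial>lborel) \<longlonglongrightarrow> 0"
  proof -
    have "(\<integral>\<^sup>+y. ennreal ?V * ennreal (norm (F y - s i y)) \<partial>lborel) = ennreal ?V * d i" for i
      unfolding d_def by (rule nn_integral_cmult[OF dm])
    then show ?thesis using ennreal_tendsto_cmult[OF _ d0, of "ennreal ?V"] by simp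
  qed
  have vm: "(\<lambda>y. ennreal ?V * ennreal (norm (F y - s i y))) \<in> borel_measurable lborel" for i
    by (rule borel_measurable_times_ennreal[OF borel_measurable_const dm])
  obtain X' where X': "has_gen_bochner_integral lborel (\<lambda>y. ?k y *\<^sub>C F y) X'"
      "(\<lambda>i. \<Sum>c\<in>C i. (\<integral>\<xi>. b i c \<xi> \<partial>lborel) *\<^sub>C c) \<longlonglongrightarrow> X'"
    by (rule has_gen_bochner_integral_limit[OF k_meas k_s vm diff_s[where k = ?k, OF k_le] lim2]) auto
  \<comment> \<open>Both integrals are the limit of the same sequence, by Fubini's theorem for simple functions.\<close>
  have "X = X'" using X(2) X'(2) LIMSEQ_unique by blast
  with X' X_eq show ?thesis by simp
qed

section \<open>The Fourier transform of the ball in odd dimensions\<close>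

text \<open>
  The Fourier transform in one variable of the profile \<open>(1 - s\<^sup>2) ^ p\<close> of the hyperplane sections
  of the unit ball in dimension \<open>2 * p + 1\<close>. It is a constant multiple of
  \<open>J\<^bsub>p+1/2\<^esub>(r) / r\<^bsup>p+1/2\<^esup>\<close>, a Bessel function of half-integral order and hence elementary.
\<close>

definition slice_cos :: "nat \<Rightarrow> real \<Rightarrow> real" where
  "slice_cos p r = integral {-1..1} (\<lambda>s. cos (s * r) * (1 - s\<^sup>2) ^ p)"

lemma slice_cos_0: "slice_cos 0 r * r = 2 * sin r"
proof (cases "r = 0")
  case False
  have "((\<lambda>s. cos (s * r)) has_integral (sin (1 * r) / r - sin (-1 * r) / r)) {-1..1}"
    using False
    by (intro fundamental_theorem_of_calculus)
       (auto intro!: derivative_eq_intros simp flip: has_real_derivative_iff_has_vector_derivative)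
  then show ?thesis using False by (simp add: slice_cos_def integral_unique field_simps)
qed simp

lemma slice_cos_by_parts:
  "integral {-1..1} (\<lambda>s. s * sin (s * r) * (1 - s\<^sup>2) ^ p)
     = r / (2 * (p + 1)) * slice_cos (Suc p) r"
proof -
  let ?h = "\<lambda>s. - ((1 - s\<^sup>2) ^ Suc p * sin (s * r)) / (2 * (p + 1))"
  let ?u = "\<lambda>s. s * sin (s * r) * (1 - s\<^sup>2) ^ p"
  let ?v = "\<lambda>s. cos (s * r) * (1 - s\<^sup>2) ^ Suc p"
  have "((\<lambda>s. ?u s - r / (2 * (p + 1)) * ?v s) has_integral ?h 1 - ?h (-1)) {-1..1}"
  proof (intro fundamental_theorem_of_calculus)
    fix s :: real assume "s \<in> {-1..1}"
    have "(?h has_real_derivative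
        - ((real (Suc p) * (- 2 * s) * (1 - s\<^sup>2) ^ p) * sin (s * r) + (1 - s\<^sup>2) ^ Suc p * (cos (s * r) * r))
           / (2 * (p + 1))) (at s within {-1..1})"
      by (auto intro!: derivative_eq_intros simp del: power_Suc) (simp add: field_simps del: power_Suc)
    also have "- ((real (Suc p) * (- 2 * s) * (1 - s\<^sup>2) ^ p) * sin (s * r) + (1 - s\<^sup>2) ^ Suc p * (cos (s * r) * r))
           / (2 * (p + 1)) = ?u s - r / (2 * (p + 1)) * ?v s"
      by (simp add: field_simps)
    finally show "(?h has_vector_derivative ?u s - r / (2 * (p + 1)) * ?v s) (at s within {-1..1})"
      by (simp add: has_real_derivative_iff_has_vector_derivative)
  qed simp
  then have "integral {-1..1} (\<lambda>s. ?u s - r / (2 * (p + 1)) * ?v s) = 0"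
    by (simp add: integral_unique)
  moreover have "integral {-1..1} (\<lambda>s. ?u s - r / (2 * (p + 1)) * ?v s)
      = integral {-1..1} ?u - r / (2 * (p + 1)) * integral {-1..1} ?v"
    by (subst Henstock_Kurzweil_Integration.integral_diff)
       (auto intro!: integrable_continuous_real continuous_intros)
  ultimately show ?thesis by (simp add: slice_cos_def)
qed

text \<open>
  Passing from \<open>p\<close> to \<open>p + 1\<close>, that is, raising the dimension by 2, costs one radial derivative
  \<open>(1 / r) (d / dr)\<close>. The kernel in dimension \<open>2 * k + 1\<close> is thus a \<open>k\<close>-fold radial derivative of the
  one-dimensional kernel \<open>sin r / r\<close>, and integration by parts can undo these derivatives.
\<close>

lemma has_real_derivative_slice_cos:
  "(slice_cos p has_real_derivative - (r / (2 * (p + 1))) * slice_cos (Suc p) r) (at r)"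
proof -
  have "((\<lambda>r. integral (cbox (-1) 1) (\<lambda>s. cos (s * r) * (1 - s\<^sup>2) ^ p)) has_field_derivative
     integral (cbox (-1) 1) (\<lambda>s. - sin (s * r) * s * (1 - s\<^sup>2) ^ p)) (at r within UNIV)"
    by (rule leibniz_rule_field_derivative)
       (auto intro!: derivative_eq_intros integrable_continuous_real continuous_intros simp: split_beta)
  moreover have "integral {-1..1} (\<lambda>s. - sin (s * r) * s * (1 - s\<^sup>2) ^ p)
      = - integral {-1..1} (\<lambda>s. s * sin (s * r) * (1 - s\<^sup>2) ^ p)"
    by (subst Henstock_Kurzweil_Integration.integral_neg[symmetric])
       (auto intro!: arg_cong[where f = "integral _"])
  ultimately show ?thesis
    by (simp add: slice_cos_by_parts slice_cos_def[abs_def])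
qed

lemma continuous_on_slice_cos [continuous_intros]:
  "continuous_on A f \<Longrightarrow> continuous_on A (\<lambda>x. slice_cos p (f x))"
  by (rule continuous_on_compose2[OF DERIV_continuous_on[of UNIV, OF has_real_derivative_slice_cos]])
     auto

lemma nn_integral_lborel_shift:
  fixes g :: "'b::euclidean_space \<Rightarrow> ennreal"
  assumes "g \<in> borel_measurable borel"
  shows "(\<integral>\<^sup>+y. g (a + y) \<partial>lborel) = (\<integral>\<^sup>+y. g y \<partial>lborel)"
proof -
  have "(\<integral>\<^sup>+y. g y \<partial>lborel) = (\<integral>\<^sup>+y. g y \<partial>distr lborel borel ((+) a))"
    by (simp add: lborel_distr_plus)
  also have "\<dots> = (\<integral>\<^sup>+y. g (a + y) \<partial>lborel)"
    using assms by (subst nn_integral_distr) auto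
  finally show ?thesis by simp
qed

text \<open>
  The uniqueness argument for Haar measure: with \<open>h\<close> the indicator of the unit ball, the double
  integral of \<open>g (f x) * h (y - f x)\<close> is evaluated in both orders. One order gives the left-hand
  side, the other, after a translation in \<open>x\<close> by a preimage of \<open>y\<close>, the right-hand side, both
  times the volume of the ball.
\<close>

lemma nn_integral_lborel_isometry:
  fixes f :: "'b::euclidean_space \<Rightarrow> 'b" and g :: "'b \<Rightarrow> ennreal"
  assumes f: "linear f" "\<And>x. norm (f x) = norm x" and g [measurable]: "g \<in> borel_measurable borel"
  shows "(\<integral>\<^sup>+x. g (f x) \<partial>lborel) = (\<integral>\<^sup>+x. g x \<partial>lborel)"
proof -
  have f_cont: "continuous_on UNIV f"
    using f(1) by (simp add: linear_conv_bounded_linear linear_continuous_on)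
  have [measurable]: "f \<in> borel_measurable borel" by (rule borel_measurable_continuous_onI[OF f_cont])
  have "inj f"
    using f by (metis (no_types) linear_injective_0 norm_eq_zero)
  then obtain f' where f': "\<And>y. f (f' y) = y"
    using linear_injective_imp_surjective[OF f(1)] by (metis surj_f_inv_f)
  let ?V = "emeasure lborel (cball 0 1 :: 'b set)"
  define h :: "'b \<Rightarrow> ennreal" where "h = indicator (cball 0 1)"
  have h [measurable]: "h \<in> borel_measurable borel" unfolding h_def by (intro borel_measurable_indicator) simp
  have h_int: "(\<integral>\<^sup>+x. h x \<partial>lborel) = ?V" by (simp add: h_def)
  have h_f: "h (- f x) = h x" for x by (simp add: h_def f(2) indicator_def)
  have "(\<integral>\<^sup>+x. g (f x) \<partial>lborel) * ?V = (\<integral>\<^sup>+x. (\<integral>\<^sup>+y. g (f x) * h (y - f x) \<partial>lborel) \<partial>lborel)"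
  proof -
    have "(\<integral>\<^sup>+y. g (f x) * h (y - f x) \<partial>lborel) = g (f x) * ?V" for x
      using nn_integral_lborel_shift[OF h, of "- f x"] h_int by (simp add: nn_integral_cmult)
    then show ?thesis by (simp add: nn_integral_multc)
  qed
  also have "\<dots> = (\<integral>\<^sup>+y. (\<integral>\<^sup>+x. g (f x) * h (y - f x) \<partial>lborel) \<partial>lborel)"
    by (rule lborel_pair.Fubini') measurable
  also have "\<dots> = (\<integral>\<^sup>+y. (\<integral>\<^sup>+x. g (y + f x) * h x \<partial>lborel) \<partial>lborel)"
  proof (rule nn_integral_cong)
    fix y :: 'b
    have "(\<integral>\<^sup>+x. g (f x) * h (y - f x) \<partial>lborel)
        = (\<integral>\<^sup>+x. g (f (f' y + x)) * h (y - f (f' y + x)) \<partial>lborel)"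
      by (rule nn_integral_lborel_shift[symmetric]) measurable
    then show "(\<integral>\<^sup>+x. g (f x) * h (y - f x) \<partial>lborel) = (\<integral>\<^sup>+x. g (y + f x) * h x \<partial>lborel)"
      by (simp add: linear_add[OF f(1)] f' h_f)
  qed
  also have "\<dots> = (\<integral>\<^sup>+x. (\<integral>\<^sup>+y. g (y + f x) * h x \<partial>lborel) \<partial>lborel)"
    by (rule lborel_pair.Fubini') measurable
  also have "\<dots> = (\<integral>\<^sup>+x. g x \<partial>lborel) * ?V"
  proof -
    have "(\<integral>\<^sup>+y. g (y + f x) * h x \<partial>lborel) = (\<integral>\<^sup>+x. g x \<partial>lborel) * h x" for x
      using nn_integral_lborel_shift[OF g, of "f x"] by (simp add: nn_integral_multc add.commute)
    then show ?thesis by (simp add: nn_integral_cmult h_int)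
  qed
  finally have eq: "(\<integral>\<^sup>+x. g (f x) \<partial>lborel) * ?V = (\<integral>\<^sup>+x. g x \<partial>lborel) * ?V" .
  have "unit_ball_vol (real DIM('b)) \<noteq> 0" by (metis less_irrefl of_nat_0_le_iff unit_ball_vol_pos)
  then have "?V \<noteq> 0" "?V \<noteq> \<infinity>" by (simp_all add: emeasure_cball)
  then show ?thesis using eq by (metis ennreal_mult_cancel_left infinity_ennreal_def mult.commute)
qed

lemma distr_lborel_isometry:
  fixes f :: "'b::euclidean_space \<Rightarrow> 'b"
  assumes f: "linear f" "\<And>x. norm (f x) = norm x"
  shows "distr lborel borel f = lborel"
proof (rule measure_eqI)
  have f_cont: "continuous_on UNIV f"
    using f(1) by (simp add: linear_conv_bounded_linear linear_continuous_on)
  have [measurable]: "f \<in> borel_measurable borel" by (rule borel_measurable_continuous_onI[OF f_cont])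
  fix A assume "A \<in> sets (distr lborel borel f)"
  then have [measurable]: "A \<in> sets borel" by simp
  have "emeasure (distr lborel borel f) A = (\<integral>\<^sup>+x. indicator A x \<partial>distr lborel borel f)" by simp
  also have "\<dots> = (\<integral>\<^sup>+x. indicator A (f x) \<partial>lborel)" by (subst nn_integral_distr) auto
  also have "\<dots> = (\<integral>\<^sup>+x. indicator A x \<partial>lborel)" by (rule nn_integral_lborel_isometry[OF f]) simp
  finally show "emeasure (distr lborel borel f) A = emeasure lborel A" by simp
qed simp

text \<open>
  The section of the ball at height \<open>s\<close> along a coordinate axis is an \<open>m\<close>-dimensional ball of
  radius \<open>sqrt (R\<^sup>2 - s\<^sup>2)\<close>.
\<close>

lemma nn_integral_ball_slices:
  fixes e :: "'b::euclidean_space" and g :: "real \<Rightarrow> ennreal"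
  assumes e: "e \<in> Basis" and R: "R > 0" and g [measurable]: "g \<in> borel_measurable borel"
    and dim: "DIM('b) = Suc m"
  shows "(\<integral>\<^sup>+\<xi>. g (\<xi> \<bullet> e) * indicator {\<xi>. norm \<xi> \<le> R} \<xi> \<partial>lborel)
       = (\<integral>\<^sup>+s. g s * (indicator {-R..R} s * ennreal (unit_ball_vol m * sqrt (R\<^sup>2 - s\<^sup>2) ^ m)) \<partial>lborel)"
proof -
  interpret product_sigma_finite "\<lambda>_. lborel" by standard
  define A where "A = Basis - {e}"
  have A: "finite A" "e \<notin> A" "insert e A = Basis" "card A = m"
    using e dim by (auto simp: A_def)
  let ?P = "\<lambda>I. Pi\<^sub>M I (\<lambda>_. lborel :: real measure)"
  have norm_eq: "norm (\<Sum>b\<in>Basis. f b *\<^sub>R b :: 'b) = sqrt ((f e)\<^sup>2 + (\<Sum>b\<in>A. (f b)\<^sup>2))" for f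
  proof -
    have "norm (\<Sum>b\<in>Basis. f b *\<^sub>R b :: 'b) = sqrt (\<Sum>b\<in>Basis. (f b)\<^sup>2)"
      by (subst euclidean_dist_l2[of 0, simplified dist_0_norm]) (auto simp: L2_set_def)
    also have "(\<Sum>b\<in>Basis. (f b)\<^sup>2) = (f e)\<^sup>2 + (\<Sum>b\<in>A. (f b)\<^sup>2)"
      using A by (simp flip: A(3))
    finally show ?thesis .
  qed
  have inner_eq: "(\<Sum>b\<in>Basis. f b *\<^sub>R b :: 'b) \<bullet> e = f e" for f
    using e by simp
  have "(\<integral>\<^sup>+\<xi>. g (\<xi> \<bullet> e) * indicator {\<xi>. norm \<xi> \<le> R} \<xi> \<partial>lborel)
     = (\<integral>\<^sup>+f. g (f e) * indicator {x. x \<le> R} (sqrt ((f e)\<^sup>2 + (\<Sum>b\<in>A. (f b)\<^sup>2))) \<partial>?P (insert e A))"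
    unfolding A(3)
    by (subst lborel_eq, subst nn_integral_distr)
       (auto simp: norm_eq inner_eq indicator_def intro!: nn_integral_cong)
  also have "\<dots> = (\<integral>\<^sup>+y. \<integral>\<^sup>+x. g y * indicator {x. x \<le> R} (sqrt (y\<^sup>2 + (\<Sum>b\<in>A. ((x(e := y)) b)\<^sup>2)))
       \<partial>?P A \<partial>lborel)"
  proof -
    have "(\<lambda>f. g (f e) * indicator {x. x \<le> R} (sqrt ((f e)\<^sup>2 + (\<Sum>b\<in>A. (f b)\<^sup>2))))
        \<in> borel_measurable (?P (insert e A))"
    proof (rule borel_measurable_times_ennreal)
      have c: "(\<lambda>f. f b) \<in> borel_measurable (?P (insert e A))" if "b \<in> insert e A" for b
        using measurable_component_singleton[OF that, of "\<lambda>_. lborel"] by simp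
      show "(\<lambda>f. g (f e)) \<in> borel_measurable (?P (insert e A))"
        using measurable_compose[OF c g] by simp
      have [measurable]: "(\<lambda>f. (f e)\<^sup>2 + (\<Sum>b\<in>A. (f b)\<^sup>2)) \<in> borel_measurable (?P (insert e A))"
        by (intro borel_measurable_add borel_measurable_power borel_measurable_sum c) auto
      have "(\<lambda>f. sqrt ((f e)\<^sup>2 + (\<Sum>b\<in>A. (f b)\<^sup>2))) \<in> borel_measurable (?P (insert e A))"
        by measurable
      then show "(\<lambda>f. indicator {x. x \<le> R} (sqrt ((f e)\<^sup>2 + (\<Sum>b\<in>A. (f b)\<^sup>2))) :: ennreal)
          \<in> borel_measurable (?P (insert e A))"
        by (rule measurable_compose) (intro borel_measurable_indicator, simp)
    qed
    from product_nn_integral_insert_rev[OF A(1,2) this] show ?thesis by (simp only: fun_upd_same)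
  qed
  also have "\<dots> = (\<integral>\<^sup>+y. \<integral>\<^sup>+x. (g y * indicator {-R..R} y) * indicator
       ({f. sqrt (\<Sum>i\<in>A. (f i)\<^sup>2) \<le> sqrt (R\<^sup>2 - y\<^sup>2)} \<inter> space (?P A)) x \<partial>?P A \<partial>lborel)"
  proof (intro nn_integral_cong)
    fix y f assume f: "f \<in> space (?P A)"
    have eq: "(\<Sum>b\<in>A. ((f(e := y)) b)\<^sup>2) = (\<Sum>b\<in>A. (f b)\<^sup>2)"
      using A by (intro sum.cong) auto
    let ?c = "\<Sum>b\<in>A. (f b)\<^sup>2"
    have c: "0 \<le> ?c" by (intro sum_nonneg) auto
    have "sqrt (y\<^sup>2 + ?c) \<le> R \<longleftrightarrow> y\<^sup>2 + ?c \<le> R\<^sup>2"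
      using c R by (intro real_sqrt_le_iff') auto
    moreover have "sqrt ?c \<le> sqrt (R\<^sup>2 - y\<^sup>2) \<longleftrightarrow> y\<^sup>2 + ?c \<le> R\<^sup>2" by auto
    moreover have "y \<in> {-R..R}" if "y\<^sup>2 + ?c \<le> R\<^sup>2"
    proof -
      have "y\<^sup>2 \<le> R\<^sup>2" using that c by simp
      then show ?thesis using R by (simp add: power2_le_iff_abs_le abs_if split: if_splits)
    qed
    ultimately show "g y * indicator {x. x \<le> R} (sqrt (y\<^sup>2 + (\<Sum>b\<in>A. ((f(e := y)) b)\<^sup>2)))
      = (g y * indicator {-R..R} y) * indicator ({f. sqrt (\<Sum>i\<in>A. (f i)\<^sup>2) \<le> sqrt (R\<^sup>2 - y\<^sup>2)} \<inter> space (?P A)) f"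
      unfolding eq using f by (auto simp: indicator_def)
  qed
  also have "\<dots> = (\<integral>\<^sup>+y. (g y * indicator {-R..R} y) * emeasure (?P A)
       ({f. sqrt (\<Sum>i\<in>A. (f i)\<^sup>2) \<le> sqrt (R\<^sup>2 - y\<^sup>2)} \<inter> space (?P A)) \<partial>lborel)"
    using A(1) by (intro nn_integral_cong, subst nn_integral_cmult_indicator) auto
  also have "\<dots> = (\<integral>\<^sup>+y. g y * (indicator {-R..R} y * ennreal (unit_ball_vol m * sqrt (R\<^sup>2 - y\<^sup>2) ^ m)) \<partial>lborel)"
  proof (rule nn_integral_cong_AE)
    have "AE y in lborel. y \<notin> {-R,R}"
      by (intro AE_not_in countable_imp_null_set_lborel) auto
    then show "AE y in lborel. g y * indicator {-R..R} y * emeasure (?P A)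
       ({f. sqrt (\<Sum>i\<in>A. (f i)\<^sup>2) \<le> sqrt (R\<^sup>2 - y\<^sup>2)} \<inter> space (?P A))
        = g y * (indicator {-R..R} y * ennreal (unit_ball_vol m * sqrt (R\<^sup>2 - y\<^sup>2) ^ m))"
    proof eventually_elim
      case (elim y)
      show ?case
      proof (cases "y \<in> {-R<..<R}")
        case True
        hence "y\<^sup>2 < R\<^sup>2" by (subst real_sqrt_less_iff [symmetric]) auto
        thus ?thesis using A by (subst emeasure_cball_aux) (auto simp: mult.assoc)
      qed (use elim in auto)
    qed
  qed
  finally show ?thesis .
qed

text \<open>
  After a rotation \<open>y\<close> lies on a coordinate axis, and the ball is sliced perpendicularly to it.
  The sections have the even dimension \<open>2 * k\<close>, so that their volume is a polynomial in \<open>s\<close>;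
  the imaginary part is an odd function of \<open>s\<close> and integrates to 0.
\<close>

lemma ball_kernel_eq_slice_cos:
  fixes y :: "real ^ 'n::finite"
  assumes R: "R > 0" and n: "CARD('n) = 2 * k + 1"
  shows "ball_kernel R y = complex_of_real
     (unit_ball_vol (real (2 * k)) * R ^ CARD('n) * slice_cos k (R * norm y))"
proof -
  let ?B = "{\<xi> :: real ^ 'n. norm \<xi> \<le> R}"
  let ?r = "norm y"
  let ?V = "unit_ball_vol (real (2 * k))"
  obtain i :: 'n where True by simp
  define e :: "real ^ 'n" where "e = axis i 1"
  have e: "e \<in> Basis" by (simp add: e_def axis_in_Basis_iff)
  have "norm (?r *\<^sub>R e) = norm y" using e by simp
  then obtain f where f: "orthogonal_transformation f" "f (?r *\<^sub>R e) = y"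
    using orthogonal_transformation_exists by blast
  have lin: "linear f" "norm (f x) = norm x" for x
    using f(1) by (auto simp: orthogonal_transformation orthogonal_transformation_linear)
  have f_meas [measurable]: "f \<in> borel_measurable borel"
    using lin(1) by (intro borel_measurable_continuous_onI) (simp add: linear_conv_bounded_linear linear_continuous_on)
  define D where "D = (\<lambda>s. indicator {-R..R} s * (?V * (R\<^sup>2 - s\<^sup>2) ^ k))"
  have D_nonneg: "0 \<le> D s" for s
  proof (cases "s \<in> {-R..R}")
    case True
    then have "s\<^sup>2 \<le> R\<^sup>2" using R by (simp add: power2_le_iff_abs_le abs_le_iff)
    then show ?thesis by (simp add: D_def)
  qed (simp add: D_def)
  have D_meas [measurable]: "D \<in> borel_measurable borel" unfolding D_def by measurable
  have distr_eq: "distr (density lborel (indicator ?B)) borel (\<lambda>\<xi>. \<xi> \<bullet> e)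
      = density lborel (\<lambda>s. ennreal (D s))" (is "?L = ?Rm")
  proof (rule measure_eqI)
    fix A assume "A \<in> sets ?L"
    then have [measurable]: "A \<in> sets borel" by simp
    have "emeasure ?L A = (\<integral>\<^sup>+\<xi>. indicator A \<xi> \<partial>?L)" by simp
    also have "\<dots> = (\<integral>\<^sup>+\<xi>. indicator A (\<xi> \<bullet> e) \<partial>density lborel (indicator ?B))"
      by (subst nn_integral_distr) auto
    also have "\<dots> = (\<integral>\<^sup>+\<xi>. indicator A (\<xi> \<bullet> e) * indicator ?B \<xi> \<partial>lborel)"
      by (subst nn_integral_density) (auto simp: mult.commute)
    also have "\<dots> = (\<integral>\<^sup>+s. indicator A s * (indicator {-R..R} s * ennreal (?V * sqrt (R\<^sup>2 - s\<^sup>2) ^ (2 * k))) \<partial>lborel)"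
      using n by (intro nn_integral_ball_slices e R) auto
    also have "\<dots> = (\<integral>\<^sup>+s. ennreal (D s) * indicator A s \<partial>lborel)"
    proof (rule nn_integral_cong)
      fix s
      show "indicator A s * (indicator {-R..R} s * ennreal (?V * sqrt (R\<^sup>2 - s\<^sup>2) ^ (2 * k)))
          = ennreal (D s) * indicator A s"
      proof (cases "s \<in> {-R..R}")
        case True
        then have "s\<^sup>2 \<le> R\<^sup>2" using R by (simp add: power2_le_iff_abs_le abs_le_iff)
        then have "sqrt (R\<^sup>2 - s\<^sup>2) ^ (2 * k) = (R\<^sup>2 - s\<^sup>2) ^ k" by (simp only: power_mult) simp
        then show ?thesis using True by (simp add: D_def mult.commute)
      qed (simp add: D_def)
    qed
    also have "\<dots> = emeasure ?Rm A" by (subst emeasure_density) auto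
    finally show "emeasure ?L A = emeasure ?Rm A" .
  qed simp
  have "ball_kernel R y = (\<integral>\<xi>. indicat_real ?B \<xi> *\<^sub>R exp (\<i> * complex_of_real (\<xi> \<bullet> y)) \<partial>distr lborel borel f)"
    unfolding ball_kernel_def distr_lborel_isometry[OF lin] ..
  also have "\<dots> = (\<integral>\<xi>. indicat_real ?B (f \<xi>) *\<^sub>R exp (\<i> * complex_of_real (f \<xi> \<bullet> y)) \<partial>lborel)"
    by (subst integral_distr) auto
  also have "\<dots> = (\<integral>\<xi>. indicat_real ?B \<xi> *\<^sub>R exp (\<i> * complex_of_real ((\<xi> \<bullet> e) * ?r)) \<partial>lborel)"
  proof -
    have "f \<xi> \<bullet> y = (\<xi> \<bullet> e) * ?r" for \<xi>
    proof -
      have "f \<xi> \<bullet> y = f \<xi> \<bullet> f (?r *\<^sub>R e)" by (simp only: f(2))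
      also have "\<dots> = \<xi> \<bullet> (?r *\<^sub>R e)" using f(1) by (simp add: orthogonal_transformation_def)
      finally show ?thesis by (simp add: mult.commute)
    qed
    then show ?thesis by (simp add: lin(2) indicator_def)
  qed
  also have "\<dots> = (\<integral>\<xi>. exp (\<i> * complex_of_real ((\<xi> \<bullet> e) * ?r)) \<partial>density lborel (\<lambda>\<xi>. ennreal (indicat_real ?B \<xi>)))"
    by (subst integral_density) auto
  also have "density lborel (\<lambda>\<xi>. ennreal (indicat_real ?B \<xi>)) = density lborel (indicator ?B)"
    by (simp add: ennreal_indicator)
  also have "(\<integral>\<xi>. exp (\<i> * complex_of_real ((\<xi> \<bullet> e) * ?r)) \<partial>density lborel (indicator ?B))
      = (\<integral>s. exp (\<i> * complex_of_real (s * ?r)) \<partial>?L)"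
    by (subst integral_distr) auto
  also have "\<dots> = (\<integral>s. D s *\<^sub>R exp (\<i> * complex_of_real (s * ?r)) \<partial>lborel)"
    unfolding distr_eq using D_nonneg by (subst integral_density) auto
  finally have ker: "ball_kernel R y = (\<integral>s. D s *\<^sub>R exp (\<i> * complex_of_real (s * ?r)) \<partial>lborel)" .
  have D_bound: "D s \<le> ?V * R ^ (2 * k)" for s
  proof (cases "s \<in> {-R..R}")
    case True
    then have "s\<^sup>2 \<le> R\<^sup>2" using R by (simp add: power2_le_iff_abs_le abs_le_iff)
    then have "(R\<^sup>2 - s\<^sup>2) ^ k \<le> (R\<^sup>2) ^ k" by (intro power_mono) auto
    then show ?thesis using True by (simp add: D_def power_mult mult_left_mono)
  qed (use R in \<open>simp add: D_def\<close>)
  have int: "integrable lborel (\<lambda>s. D s *\<^sub>R h s :: 'z::{banach,second_countable_topology})"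
    if h: "h \<in> borel_measurable borel" "\<And>s. norm (h s) \<le> 1" for h
  proof (rule integrableI_bounded_set[where A = "{-R..R}" and B = "?V * R ^ (2 * k)"])
    show "(\<lambda>s. D s *\<^sub>R h s) \<in> borel_measurable lborel" using h(1) by measurable
    show "AE s in lborel. s \<in> {-R..R} \<longrightarrow> norm (D s *\<^sub>R h s) \<le> ?V * R ^ (2 * k)"
    proof (rule AE_I2, rule impI)
      fix s
      have "norm (D s *\<^sub>R h s) \<le> D s * 1" using D_nonneg[of s] h(2)[of s] by (simp add: mult_left_le)
      then show "norm (D s *\<^sub>R h s) \<le> ?V * R ^ (2 * k)" using D_bound[of s] by simp
    qed
  qed (use R in \<open>auto simp: D_def\<close>)
  have split: "D s *\<^sub>R exp (\<i> * complex_of_real (s * ?r))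
      = complex_of_real (D s *\<^sub>R cos (s * ?r)) + \<i> * complex_of_real (D s *\<^sub>R sin (s * ?r))" for s
  proof -
    have "exp (\<i> * complex_of_real t) = complex_of_real (cos t) + \<i> * complex_of_real (sin t)" for t
      by (simp add: exp_Euler cos_of_real sin_of_real)
    then show ?thesis by (simp only:) (simp add: scaleR_conv_of_real distrib_left mult_ac)
  qed
  have odd: "(\<integral>s. D s *\<^sub>R sin (s * ?r) \<partial>lborel) = 0"
  proof -
    have "(\<integral>s. D s *\<^sub>R sin (s * ?r) \<partial>lborel) = (\<integral>s. D (- s) *\<^sub>R sin (- s * ?r) \<partial>lborel)"
      using lborel_integral_real_affine[of "-1" "\<lambda>s. D s *\<^sub>R sin (s * ?r)" 0] by simp
    also have "\<dots> = - (\<integral>s. D s *\<^sub>R sin (s * ?r) \<partial>lborel)"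
      by (subst Bochner_Integration.integral_minus[symmetric])
         (auto intro!: Bochner_Integration.integral_cong simp: D_def indicator_def)
    finally show ?thesis by simp
  qed
  have "ball_kernel R y = complex_of_real (\<integral>s. D s *\<^sub>R cos (s * ?r) \<partial>lborel)
      + \<i> * complex_of_real (\<integral>s. D s *\<^sub>R sin (s * ?r) \<partial>lborel)"
    unfolding ker split
    by (subst Bochner_Integration.integral_add)
       (auto intro!: integrable_of_real integrable_mult_right int simp del: of_real_mult real_scaleR_def)
  also have "\<dots> = complex_of_real (\<integral>s. D s *\<^sub>R cos (s * ?r) \<partial>lborel)" by (simp only: odd) simp
  also have "(\<integral>s. D s *\<^sub>R cos (s * ?r) \<partial>lborel) = R * (\<integral>s. D (R * s) *\<^sub>R cos (R * s * ?r) \<partial>lborel)"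
    using lborel_integral_real_affine[of R "\<lambda>s. D s *\<^sub>R cos (s * ?r)" 0] R by simp
  also have "(\<integral>s. D (R * s) *\<^sub>R cos (R * s * ?r) \<partial>lborel)
      = (\<integral>s. ?V * R ^ (2 * k) * (indicator {-1..1} s *\<^sub>R (cos (s * (R * ?r)) * (1 - s\<^sup>2) ^ k)) \<partial>lborel)"
  proof (rule Bochner_Integration.integral_cong[OF refl])
    fix s
    have "R * s \<in> {-R..R} \<longleftrightarrow> s \<in> {-1..1}"
      using mult_le_cancel_left_pos[OF R, of "-1" s] mult_le_cancel_left_pos[OF R, of s 1] by simp
    moreover have "R\<^sup>2 - (R * s)\<^sup>2 = R\<^sup>2 * (1 - s\<^sup>2)" by (simp add: algebra_simps power_mult_distrib)
    moreover have "(R\<^sup>2) ^ k = (R ^ k)\<^sup>2" by (simp add: mult.commute flip: power_mult)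
    ultimately show "D (R * s) *\<^sub>R cos (R * s * ?r)
       = ?V * R ^ (2 * k) * (indicator {-1..1} s *\<^sub>R (cos (s * (R * ?r)) * (1 - s\<^sup>2) ^ k))"
      by (simp add: D_def indicator_def power_mult power_mult_distrib mult_ac)
  qed
  also have "\<dots> = ?V * R ^ (2 * k) * slice_cos k (R * ?r)"
  proof -
    have "set_integrable lborel {-1..1} (\<lambda>s. cos (s * (R * ?r)) * (1 - s\<^sup>2) ^ k)"
      by (intro borel_integrable_atLeastAtMost' continuous_intros)
    from set_borel_integral_eq_integral(2)[OF this]
    show ?thesis by (simp add: slice_cos_def set_lebesgue_integral_def)
  qed
  finally show ?thesis using n by (simp add: mult_ac)
qed

section \<open>Polar coordinates as an average over dilations\<close>

text \<open>
  The weight of an average over the directions \<open>sgn z\<close>, with \<open>z\<close> in the unit ball, that plays the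
  role of the surface measure. It vanishes at 0, where the direction is undefined, which keeps
  weighted functions of the direction continuous there, and outside the unit ball.
\<close>

definition ang_weight :: "'b::euclidean_space \<Rightarrow> real" where
  "ang_weight z = norm z * max 0 (1 - norm z)"

lemma ang_weight_nonneg [simp]: "0 \<le> ang_weight z" and ang_weight_0 [simp]: "ang_weight 0 = 0"
  and ang_weight_le: "ang_weight z \<le> norm z"
  by (auto simp: ang_weight_def mult_left_le)

lemma ang_weight_eq_0: "1 \<le> norm z \<Longrightarrow> ang_weight z = 0"
  by (simp add: ang_weight_def)

lemma continuous_on_ang_weight [continuous_intros]:
  "continuous_on A f \<Longrightarrow> continuous_on A (\<lambda>x. ang_weight (f x))"
  unfolding ang_weight_def by (intro continuous_intros)

lemma borel_measurable_ang_weight [measurable]: "ang_weight \<in> borel_measurable borel"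
  by (intro borel_measurable_continuous_onI continuous_intros)

lemma nn_integral_lborel_scale:
  fixes G :: "'b::euclidean_space \<Rightarrow> ennreal"
  assumes [measurable]: "G \<in> borel_measurable borel" and t: "t > 0"
  shows "(\<integral>\<^sup>+z. G z \<partial>lborel) = ennreal (inverse t ^ DIM('b)) * (\<integral>\<^sup>+y. G (y /\<^sub>R t) \<partial>lborel)"
proof -
  have "(\<integral>\<^sup>+z. G z \<partial>lborel)
      = (\<integral>\<^sup>+z. G z \<partial>density (distr lborel borel (\<lambda>x. 0 + inverse t *\<^sub>R x)) (\<lambda>_. \<bar>inverse t\<bar> ^ DIM('b)))"
    using t by (subst lborel_affine[of "inverse t" 0]) auto
  also have "\<dots> = ennreal (inverse t ^ DIM('b)) * (\<integral>\<^sup>+y. G (y /\<^sub>R t) \<partial>lborel)"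
    using t by (simp add: nn_integral_density nn_integral_distr nn_integral_cmult divide_inverse)
  finally show ?thesis .
qed

text \<open>
  With the radial profile \<open>W r = r * max 0 (1 - r)\<close> of the weight, this is the integral of
  \<open>r ^ (n - 1) * W r\<close> over the half-line, written in the variable \<open>\<tau> = 1 / r\<close> in which it arises.
\<close>

definition polar_const :: "'b::euclidean_space itself \<Rightarrow> ennreal" where
  "polar_const _ = (\<integral>\<^sup>+\<tau>. indicator {0..} \<tau> * ennreal (inverse \<tau> ^ (DIM('b) + 1)
       * (inverse \<tau> * max 0 (1 - inverse \<tau>))) \<partial>lborel)"

lemma nn_integral_ray_rescale:
  fixes f :: "'b::euclidean_space \<Rightarrow> ennreal"
  assumes f [measurable]: "f \<in> borel_measurable borel" and z: "z \<noteq> 0"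
  shows "(\<integral>\<^sup>+s. indicator {0..} s * ennreal (s ^ (DIM('b) - 1)) * f ((s / norm z) *\<^sub>R z) \<partial>lborel)
    = ennreal (norm z ^ DIM('b)) *
      (\<integral>\<^sup>+t. indicator {0..} t * ennreal (t ^ (DIM('b) - 1)) * f (t *\<^sub>R z) \<partial>lborel)"
proof -
  let ?n = "DIM('b)"
  have n: "?n > 0" by simp
  from z have z: "norm z > 0" by simp
  let ?I = "\<integral>\<^sup>+t. indicator {0..} t * ennreal (t ^ (?n - 1)) * f (t *\<^sub>R z) \<partial>lborel"
  have "(\<integral>\<^sup>+s. indicator {0..} s * ennreal (s ^ (?n - 1)) * f ((s / norm z) *\<^sub>R z) \<partial>lborel)
     = ennreal \<bar>norm z\<bar> * (\<integral>\<^sup>+t. indicator {0..} (0 + norm z * t) * ennreal ((0 + norm z * t) ^ (?n - 1))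
          * f (((0 + norm z * t) / norm z) *\<^sub>R z) \<partial>lborel)"
    using z by (intro nn_integral_real_affine) auto
  also have "(\<integral>\<^sup>+t. indicator {0..} (0 + norm z * t) * ennreal ((0 + norm z * t) ^ (?n - 1))
          * f (((0 + norm z * t) / norm z) *\<^sub>R z) \<partial>lborel)
     = (\<integral>\<^sup>+t. ennreal (norm z ^ (?n - 1)) * (indicator {0..} t * ennreal (t ^ (?n - 1)) * f (t *\<^sub>R z)) \<partial>lborel)"
  proof (rule nn_integral_cong)
    fix t :: real
    have "(0 + norm z * t) / norm z = t" using z by simp
    moreover have "indicator {0..} (0 + norm z * t) = (indicator {0..} t :: ennreal)"
      using z by (auto simp: indicator_def zero_le_mult_iff)
    moreover have "indicator {0..} t * ennreal ((0 + norm z * t) ^ (?n - 1))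
        = ennreal (norm z ^ (?n - 1)) * (indicator {0..} t * ennreal (t ^ (?n - 1)))"
      by (cases "t \<ge> 0") (simp_all add: power_mult_distrib ennreal_mult)
    ultimately show "indicator {0..} (0 + norm z * t) * ennreal ((0 + norm z * t) ^ (?n - 1))
          * f (((0 + norm z * t) / norm z) *\<^sub>R z)
      = ennreal (norm z ^ (?n - 1)) * (indicator {0..} t * ennreal (t ^ (?n - 1)) * f (t *\<^sub>R z))"
      by (simp only: mult.assoc)
  qed
  also have "\<dots> = ennreal (norm z ^ (?n - 1)) * ?I"
    by (rule nn_integral_cmult) measurable
  also have "ennreal \<bar>norm z\<bar> * (ennreal (norm z ^ (?n - 1)) * ?I) = ennreal (norm z * norm z ^ (?n - 1)) * ?I"
    by (simp add: ennreal_mult mult.assoc)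
  also have "norm z * norm z ^ (?n - 1) = norm z ^ ?n"
    using power_minus_mult[OF n, of "norm z"] by (simp only: mult.commute)
  finally show ?thesis .
qed

lemma nn_integral_sphere_rescale:
  fixes f :: "'b::euclidean_space \<Rightarrow> ennreal"
  assumes f [measurable]: "f \<in> borel_measurable borel" and t: "t > 0"
  shows "ennreal (t ^ (DIM('b) - 1)) *
      (\<integral>\<^sup>+z. ennreal (ang_weight z * norm z ^ DIM('b)) * f (t *\<^sub>R z) \<partial>lborel)
    = ennreal (inverse t) *
      (\<integral>\<^sup>+y. ennreal (ang_weight (y /\<^sub>R t) * norm (y /\<^sub>R t) ^ DIM('b)) * f y \<partial>lborel)"
proof -
  let ?n = "DIM('b)"
  let ?I = "\<integral>\<^sup>+y. ennreal (ang_weight (y /\<^sub>R t) * norm (y /\<^sub>R t) ^ ?n) * f y \<partial>lborel"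
  have n: "?n > 0" by simp
  have "(\<integral>\<^sup>+z. ennreal (ang_weight z * norm z ^ ?n) * f (t *\<^sub>R z) \<partial>lborel)
    = ennreal (inverse t ^ ?n) * (\<integral>\<^sup>+y. ennreal (ang_weight (y /\<^sub>R t) * norm (y /\<^sub>R t) ^ ?n) * f (t *\<^sub>R (y /\<^sub>R t)) \<partial>lborel)"
    by (rule nn_integral_lborel_scale[OF _ t]) measurable
  also have "(\<lambda>y. f (t *\<^sub>R (y /\<^sub>R t))) = f" using t by auto
  finally have eq: "(\<integral>\<^sup>+z. ennreal (ang_weight z * norm z ^ ?n) * f (t *\<^sub>R z) \<partial>lborel)
     = ennreal (inverse t ^ ?n) * ?I" using t by simp
  have "inverse t ^ ?n = inverse t ^ (?n - 1) * inverse t"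
    using power_minus_mult[OF n, of "inverse t"] by simp
  then have "t ^ (?n - 1) * inverse t ^ ?n = (t * inverse t) ^ (?n - 1) * inverse t"
    by (simp only: power_mult_distrib mult.assoc)
  then have p: "t ^ (?n - 1) * inverse t ^ ?n = inverse t" using t by simp
  have "ennreal (t ^ (?n - 1)) * (ennreal (inverse t ^ ?n) * ?I) = ennreal (t ^ (?n - 1) * inverse t ^ ?n) * ?I"
    using t by (simp add: ennreal_mult mult.assoc)
  then show ?thesis unfolding eq p .
qed

lemma polar_const_eq:
  fixes y :: "'b::euclidean_space"
  assumes "y \<noteq> 0"
  shows "(\<integral>\<^sup>+t. indicator {0..} t * (ennreal (inverse t) *
     ennreal (ang_weight (y /\<^sub>R t) * norm (y /\<^sub>R t) ^ DIM('b))) \<partial>lborel) = polar_const TYPE('b)"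
proof -
  let ?n = "DIM('b)"
  from assms have y: "norm y > 0" by simp
  let ?g = "\<lambda>t. indicator {0..} t * (ennreal (inverse t) * ennreal (ang_weight (y /\<^sub>R t) * norm (y /\<^sub>R t) ^ ?n))"
  have "(\<integral>\<^sup>+t. ?g t \<partial>lborel) = ennreal \<bar>norm y\<bar> * (\<integral>\<^sup>+\<tau>. ?g (0 + norm y * \<tau>) \<partial>lborel)"
    using y by (intro nn_integral_real_affine) auto
  also have "\<dots> = ennreal (norm y) * (\<integral>\<^sup>+\<tau>. ?g (norm y * \<tau>) \<partial>lborel)" by simp
  also have "\<dots> = (\<integral>\<^sup>+\<tau>. ennreal (norm y) * ?g (norm y * \<tau>) \<partial>lborel)"
    by (rule nn_integral_cmult[symmetric]) measurable
  also have "\<dots> = polar_const TYPE('b)"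
    unfolding polar_const_def
  proof (rule nn_integral_cong)
    fix \<tau> :: real
    show "ennreal (norm y) * ?g (norm y * \<tau>) = indicator {0..} \<tau> *
        ennreal (inverse \<tau> ^ (?n + 1) * (inverse \<tau> * max 0 (1 - inverse \<tau>)))"
    proof (cases "\<tau> > 0")
      case True
      let ?m = "max 0 (1 - inverse \<tau>)"
      have nrm: "norm (y /\<^sub>R (norm y * \<tau>)) = inverse \<tau>" using True y by (simp add: field_simps)
      have "ennreal (norm y) * ?g (norm y * \<tau>) = ennreal (norm y) *
         (ennreal (inverse (norm y * \<tau>)) * ennreal (inverse \<tau> * ?m * inverse \<tau> ^ ?n))"
        using True y unfolding ang_weight_def nrm by simp
      also have "\<dots> = ennreal (norm y * (inverse (norm y * \<tau>) * (inverse \<tau> * ?m * inverse \<tau> ^ ?n)))"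
        using True y by (simp add: ennreal_mult)
      also have "norm y * (inverse (norm y * \<tau>) * (inverse \<tau> * ?m * inverse \<tau> ^ ?n))
         = (norm y * inverse (norm y)) * (inverse \<tau> ^ (?n + 1) * (inverse \<tau> * ?m))"
        by (simp only: inverse_mult_distrib power_add power_one_right mult_ac)
      also have "norm y * inverse (norm y) = 1" using y by simp
      finally show ?thesis using True by simp
    next
      case False
      then have "\<tau> = 0 \<or> norm y * \<tau> < 0" using y by (auto simp: mult_less_0_iff)
      then show ?thesis using False by (auto simp: indicator_def)
    qed
  qed
  finally show ?thesis .
qed

text \<open>
  Polar coordinates from dilations alone. On the ray through \<open>z\<close> the substitution
  \<open>s = t * norm z\<close> turns the argument of \<open>f\<close> into \<open>t *\<^sub>R z\<close>. Exchanging the integrals and substituting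
  \<open>y = t *\<^sub>R z\<close> for fixed \<open>t\<close> leaves \<open>f y\<close> times an integral over all dilations \<open>t\<close>, whose value does
  not depend on \<open>y\<close> by homogeneity.
\<close>

lemma polar_nn_integral:
  fixes f :: "'b::euclidean_space \<Rightarrow> ennreal"
  assumes f [measurable]: "f \<in> borel_measurable borel"
  shows "(\<integral>\<^sup>+z. ennreal (ang_weight z) * (\<integral>\<^sup>+s. indicator {0..} s * ennreal (s ^ (DIM('b) - 1))
           * f ((s / norm z) *\<^sub>R z) \<partial>lborel) \<partial>lborel)
       = polar_const TYPE('b) * (\<integral>\<^sup>+y. f y \<partial>lborel)"
proof -
  let ?n = "DIM('b)"
  have "(\<integral>\<^sup>+z. ennreal (ang_weight z) * (\<integral>\<^sup>+s. indicator {0..} s * ennreal (s ^ (?n - 1))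
           * f ((s / norm z) *\<^sub>R z) \<partial>lborel) \<partial>lborel)
     = (\<integral>\<^sup>+z. (\<integral>\<^sup>+t. ennreal (ang_weight z * norm z ^ ?n) *
           (indicator {0..} t * ennreal (t ^ (?n - 1)) * f (t *\<^sub>R z)) \<partial>lborel) \<partial>lborel)"
  proof (rule nn_integral_cong)
    fix z :: 'b
    let ?I = "\<integral>\<^sup>+t. indicator {0..} t * ennreal (t ^ (?n - 1)) * f (t *\<^sub>R z) \<partial>lborel"
    have "ennreal (ang_weight z) * (\<integral>\<^sup>+s. indicator {0..} s * ennreal (s ^ (?n - 1))
           * f ((s / norm z) *\<^sub>R z) \<partial>lborel) = ennreal (ang_weight z) * (ennreal (norm z ^ ?n) * ?I)"
      by (cases "z = 0") (simp_all only: nn_integral_ray_rescale[OF f] ang_weight_0 ennreal_0 mult_zero_left not_False_eq_True)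
    also have "\<dots> = ennreal (ang_weight z * norm z ^ ?n) * ?I"
      by (simp add: ennreal_mult mult.assoc)
    also have "\<dots> = (\<integral>\<^sup>+t. ennreal (ang_weight z * norm z ^ ?n) *
           (indicator {0..} t * ennreal (t ^ (?n - 1)) * f (t *\<^sub>R z)) \<partial>lborel)"
      by (rule nn_integral_cmult[symmetric]) measurable
    finally show "ennreal (ang_weight z) * (\<integral>\<^sup>+s. indicator {0..} s * ennreal (s ^ (?n - 1))
           * f ((s / norm z) *\<^sub>R z) \<partial>lborel) = \<dots>" .
  qed
  also have "\<dots> = (\<integral>\<^sup>+t. (\<integral>\<^sup>+z. ennreal (ang_weight z * norm z ^ ?n) *
           (indicator {0..} t * ennreal (t ^ (?n - 1)) * f (t *\<^sub>R z)) \<partial>lborel) \<partial>lborel)"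
    by (rule lborel_pair.Fubini') measurable
  also have "\<dots> = (\<integral>\<^sup>+t. (\<integral>\<^sup>+y. indicator {0..} t * (ennreal (inverse t) *
           ennreal (ang_weight (y /\<^sub>R t) * norm (y /\<^sub>R t) ^ ?n)) * f y \<partial>lborel) \<partial>lborel)"
  proof (rule nn_integral_cong_AE, rule AE_mp[OF AE_lborel_singleton[of 0]], rule AE_I2, rule impI)
    fix t :: real assume t0: "t \<noteq> 0"
    show "(\<integral>\<^sup>+z. ennreal (ang_weight z * norm z ^ ?n) *
           (indicator {0..} t * ennreal (t ^ (?n - 1)) * f (t *\<^sub>R z)) \<partial>lborel)
       = (\<integral>\<^sup>+y. indicator {0..} t * (ennreal (inverse t) *
           ennreal (ang_weight (y /\<^sub>R t) * norm (y /\<^sub>R t) ^ ?n)) * f y \<partial>lborel)"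
    proof (cases "t > 0")
      case True
      have "(\<integral>\<^sup>+z. ennreal (ang_weight z * norm z ^ ?n) *
           (indicator {0..} t * ennreal (t ^ (?n - 1)) * f (t *\<^sub>R z)) \<partial>lborel)
        = (\<integral>\<^sup>+z. ennreal (t ^ (?n - 1)) * (ennreal (ang_weight z * norm z ^ ?n) * f (t *\<^sub>R z)) \<partial>lborel)"
        using True by (intro nn_integral_cong) (simp add: mult.left_commute)
      also have "\<dots> = ennreal (t ^ (?n - 1)) * (\<integral>\<^sup>+z. ennreal (ang_weight z * norm z ^ ?n) * f (t *\<^sub>R z) \<partial>lborel)"
        by (rule nn_integral_cmult) measurable
      also have "\<dots> = ennreal (inverse t) *
          (\<integral>\<^sup>+y. ennreal (ang_weight (y /\<^sub>R t) * norm (y /\<^sub>R t) ^ ?n) * f y \<partial>lborel)"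
        by (rule nn_integral_sphere_rescale[OF f True])
      also have "\<dots> = (\<integral>\<^sup>+y. ennreal (inverse t) *
          (ennreal (ang_weight (y /\<^sub>R t) * norm (y /\<^sub>R t) ^ ?n) * f y) \<partial>lborel)"
        by (rule nn_integral_cmult[symmetric]) measurable
      finally show ?thesis using True by (simp add: mult.assoc)
    next
      case False
      then have "indicator {0..} t = (0 :: ennreal)" using t0 by simp
      then show ?thesis by simp
    qed
  qed
  also have "\<dots> = (\<integral>\<^sup>+y. (\<integral>\<^sup>+t. indicator {0..} t * (ennreal (inverse t) *
           ennreal (ang_weight (y /\<^sub>R t) * norm (y /\<^sub>R t) ^ ?n)) * f y \<partial>lborel) \<partial>lborel)"
    by (rule lborel_pair.Fubini') measurable
  also have "\<dots> = (\<integral>\<^sup>+y. polar_const TYPE('b) * f y \<partial>lborel)"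
  proof (rule nn_integral_cong_AE, rule AE_mp[OF AE_lborel_singleton[of 0]], rule AE_I2, rule impI)
    fix y :: 'b assume y0: "y \<noteq> 0"
    have "(\<integral>\<^sup>+t. indicator {0..} t * (ennreal (inverse t) *
           ennreal (ang_weight (y /\<^sub>R t) * norm (y /\<^sub>R t) ^ ?n)) * f y \<partial>lborel)
       = (\<integral>\<^sup>+t. indicator {0..} t * (ennreal (inverse t) *
           ennreal (ang_weight (y /\<^sub>R t) * norm (y /\<^sub>R t) ^ ?n)) \<partial>lborel) * f y"
      by (rule nn_integral_multc) measurable
    then show "(\<integral>\<^sup>+t. indicator {0..} t * (ennreal (inverse t) *
           ennreal (ang_weight (y /\<^sub>R t) * norm (y /\<^sub>R t) ^ ?n)) * f y \<partial>lborel)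
       = polar_const TYPE('b) * f y"
      by (simp only: polar_const_eq[OF y0])
  qed
  also have "\<dots> = polar_const TYPE('b) * (\<integral>\<^sup>+y. f y \<partial>lborel)"
    by (rule nn_integral_cmult) simp
  finally show ?thesis .
qed

text \<open>
  The polar formula for the indicator of the unit ball. It relates the two constants without
  computing either of them.
\<close>

lemma nn_integral_ang_weight:
  "(\<integral>\<^sup>+z. ennreal (ang_weight (z :: 'b::euclidean_space)) \<partial>lborel)
     = ennreal (DIM('b) * unit_ball_vol (DIM('b))) * polar_const TYPE('b)"
    (is "?W = _")
proof -
  let ?n = "DIM('b)"
  have n: "?n > 0" by simp
  have "((\<lambda>s. s ^ (?n - 1)) has_integral (1 ^ ?n / real ?n - 0 ^ ?n / real ?n)) {0..1 :: real}"
    using n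
    by (intro fundamental_theorem_of_calculus)
       (auto intro!: derivative_eq_intros simp flip: has_real_derivative_iff_has_vector_derivative)
  then have hi: "((\<lambda>s. s ^ (?n - 1)) has_integral (1 / real ?n)) {0..1 :: real}"
    using n by (simp add: zero_power)
  have "(\<integral>\<^sup>+z. ennreal (ang_weight (z :: 'b)) * ennreal (1 / real ?n) \<partial>lborel)
     = (\<integral>\<^sup>+z. ennreal (ang_weight z) * (\<integral>\<^sup>+s. indicator {0..} s * ennreal (s ^ (?n - 1))
           * indicator (cball 0 1 :: 'b set) ((s / norm z) *\<^sub>R z) \<partial>lborel) \<partial>lborel)"
  proof (rule nn_integral_cong)
    fix z :: 'b
    show "ennreal (ang_weight z) * ennreal (1 / real ?n) = ennreal (ang_weight z) *
       (\<integral>\<^sup>+s. indicator {0..} s * ennreal (s ^ (?n - 1))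
           * indicator (cball 0 1 :: 'b set) ((s / norm z) *\<^sub>R z) \<partial>lborel)"
    proof (cases "z = 0")
      case False
      have "(\<integral>\<^sup>+s. indicator {0..} s * ennreal (s ^ (?n - 1))
           * indicator (cball 0 1 :: 'b set) ((s / norm z) *\<^sub>R z) \<partial>lborel)
        = (\<integral>\<^sup>+s. ennreal (s ^ (?n - 1)) * indicator {0..1} s \<partial>lborel)"
        using False by (intro nn_integral_cong) (auto simp: indicator_def)
      also have "\<dots> = ennreal (1 / real ?n)"
        by (rule nn_integral_has_integral_lebesgue'[OF _ hi]) auto
      finally show ?thesis by simp
    qed simp
  qed
  also have "\<dots> = polar_const TYPE('b) * (\<integral>\<^sup>+y. indicator (cball 0 1 :: 'b set) y \<partial>lborel)"
    by (rule polar_nn_integral) (intro borel_measurable_indicator, simp)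
  also have "(\<integral>\<^sup>+y. indicator (cball 0 1 :: 'b set) y \<partial>lborel) = ennreal (unit_ball_vol ?n)"
    by (simp add: emeasure_cball)
  finally have eq: "?W * ennreal (1 / real ?n) = polar_const TYPE('b) * ennreal (unit_ball_vol ?n)"
    by (simp add: nn_integral_multc)
  have "ennreal (real ?n) * ennreal (1 / real ?n) = 1" using n by (simp flip: ennreal_mult)
  then have "?W = ?W * (ennreal (real ?n) * ennreal (1 / real ?n))" by (simp only: mult_1_right)
  also have "\<dots> = ennreal (real ?n) * (?W * ennreal (1 / real ?n))" by (simp only: mult_ac)
  also have "\<dots> = ennreal (?n * unit_ball_vol ?n) * polar_const TYPE('b)"
    unfolding eq by (simp add: ennreal_mult mult_ac)
  finally show ?thesis .
qed

lemma ang_weight_integral_pos_finite: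
  "0 < (\<integral>\<^sup>+z. ennreal (ang_weight (z :: 'b::euclidean_space)) \<partial>lborel)"
  "(\<integral>\<^sup>+z. ennreal (ang_weight (z :: 'b::euclidean_space)) \<partial>lborel) < \<infinity>"
proof -
  have "ennreal (ang_weight z) \<le> indicator (cball 0 1) z" for z :: 'b
    using ang_weight_le[of z] by (cases "norm z \<le> 1") (auto simp: ang_weight_eq_0 indicator_def)
  then have "(\<integral>\<^sup>+z. ennreal (ang_weight (z :: 'b)) \<partial>lborel) \<le> (\<integral>\<^sup>+z. indicator (cball 0 1 :: 'b set) z \<partial>lborel)"
    by (intro nn_integral_mono) auto
  also have "\<dots> < \<infinity>" by (simp add: emeasure_cball)
  finally show "(\<integral>\<^sup>+z. ennreal (ang_weight (z :: 'b)) \<partial>lborel) < \<infinity>" .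
  \<comment> \<open>On the ball of radius 1/4 around half a unit vector, both norm z and 1 - norm z exceed 1/4.\<close>
  obtain e :: 'b where e: "e \<in> Basis" using nonempty_Basis by blast
  have "ennreal (1/16) * indicator (ball ((1/2) *\<^sub>R e) (1/4)) z \<le> ennreal (ang_weight z)" for z :: 'b
  proof (cases "z \<in> ball ((1/2) *\<^sub>R e) (1/4)")
    case True
    then have "norm ((1/2) *\<^sub>R e - z) < 1/4" by (simp add: dist_norm)
    moreover have "norm ((1/2) *\<^sub>R e) = 1/2" using e by simp
    ultimately have "norm z > 1/4" "norm z < 3/4"
      using norm_triangle_ineq2[of "(1/2) *\<^sub>R e" z] norm_triangle_ineq3[of "(1/2) *\<^sub>R e" z] by linarith+
    then have "(1/4) * (1/4) \<le> norm z * max 0 (1 - norm z)" by (intro mult_mono) auto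
    then have "ennreal (1/16) \<le> ennreal (ang_weight z)" by (intro ennreal_leI) (simp add: ang_weight_def)
    then show ?thesis using True by simp
  qed simp
  then have "(\<integral>\<^sup>+z. ennreal (1/16) * indicator (ball ((1/2) *\<^sub>R e) (1/4) :: 'b set) z \<partial>lborel)
      \<le> (\<integral>\<^sup>+z. ennreal (ang_weight (z :: 'b)) \<partial>lborel)"
    by (rule nn_integral_mono)
  moreover have "(\<integral>\<^sup>+z. ennreal (1/16) * indicator (ball ((1/2) *\<^sub>R e) (1/4) :: 'b set) z \<partial>lborel) > 0"
    by (subst nn_integral_cmult_indicator)
       (auto simp: emeasure_ball ennreal_zero_less_mult_iff ennreal_zero_less_divide)
  ultimately show "0 < (\<integral>\<^sup>+z. ennreal (ang_weight (z :: 'b)) \<partial>lborel)" by (rule order.strict_trans2[rotated])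
qed

section \<open>Polar coordinates for vector-valued functions\<close>

text \<open>
  At \<open>z \<noteq> 0\<close> this is continuity of an integral in a parameter. At 0 the direction jumps, but the
  integral stays bounded and the weight tends to 0.
\<close>

lemma continuous_on_ang_weight_integral:
  fixes G :: "real \<Rightarrow> 'b::euclidean_space \<Rightarrow> 'a::banach"
  assumes G: "continuous_on (UNIV \<times> {a..b}) (\<lambda>(w, s). G s w)"
  shows "continuous_on UNIV (\<lambda>z. ang_weight z *\<^sub>R integral {a..b} (\<lambda>s. G s (sgn z)))"
proof (rule continuous_at_imp_continuous_on, rule ballI)
  fix z :: 'b
  let ?J = "\<lambda>z. integral {a..b} (\<lambda>s. G s (sgn z))"
  show "isCont (\<lambda>z. ang_weight z *\<^sub>R ?J z) z"
  proof (cases "z = 0")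
    case False
    let ?U = "- {0 :: 'b}"
    have "continuous_on ?U (\<lambda>z. integral (cbox a b) (\<lambda>s. G s (sgn z)))"
    proof (rule integral_continuous_on_param)
      have "continuous_on (?U \<times> cbox a b) (\<lambda>(z, s). (z /\<^sub>R norm z, s))"
        by (auto intro!: continuous_intros simp: split_beta)
      from continuous_on_compose2[OF G this]
      show "continuous_on (?U \<times> cbox a b) (\<lambda>(z, s). G s (sgn z))"
        by (simp add: split_beta sgn_div_norm image_subset_iff)
    qed
    then have "continuous_on ?U (\<lambda>z. ang_weight z *\<^sub>R ?J z)"
      by (auto intro!: continuous_intros)
    then show ?thesis using False by (simp add: continuous_on_eq_continuous_at open_Compl)
  next
    case True
    have "compact ((\<lambda>(w, s). G s w) ` (cball 0 1 \<times> {a..b}))"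
      by (intro compact_continuous_image continuous_on_subset[OF G] compact_Times) auto
    then obtain B where B: "\<And>w s. w \<in> cball 0 1 \<Longrightarrow> s \<in> {a..b} \<Longrightarrow> norm (G s w) \<le> B"
      by (force dest!: compact_imp_bounded simp: bounded_iff)
    have Bn: "norm (?J z) \<le> max 0 B * measure lborel (cbox a b)" for z
    proof -
      have "norm (integral (cbox a b) (\<lambda>s. G s (sgn z))) \<le> max 0 B * measure lborel (cbox a b)"
      proof (rule integrable_bound)
        have "continuous_on {a..b} (\<lambda>s. (sgn z, s))" by (intro continuous_intros)
        from continuous_on_compose2[OF G this]
        show "(\<lambda>s. G s (sgn z)) integrable_on cbox a b"
          by (auto intro!: integrable_continuous_real)
        show "norm (G s (sgn z)) \<le> max 0 B" if "s \<in> cbox a b" for s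
        proof -
          have "norm (sgn z) \<le> 1" by (simp add: norm_sgn)
          then show ?thesis using B[of "sgn z" s] that by auto
        qed
      qed simp
      then show ?thesis by simp
    qed
    have "((\<lambda>z. ang_weight z *\<^sub>R ?J z) \<longlongrightarrow> 0) (at 0)"
    proof (rule Lim_null_comparison)
      show "\<forall>\<^sub>F z in at 0. norm (ang_weight z *\<^sub>R ?J z) \<le> norm z * (max 0 B * measure lborel (cbox a b))"
        using Bn ang_weight_le by (intro always_eventually allI) (auto intro!: mult_mono)
      show "((\<lambda>z. norm z * (max 0 B * measure lborel (cbox a b))) \<longlongrightarrow> 0) (at 0)"
        by (auto intro!: tendsto_eq_intros)
    qed
    then show ?thesis using True by (simp add: isCont_def)
  qed
qed

definition polar_integral :: "real \<Rightarrow> ('b::euclidean_space \<Rightarrow> 'a::banach) \<Rightarrow> 'a" where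
  "polar_integral T h = integral (cbox (- One) One)
     (\<lambda>z. ang_weight z *\<^sub>R integral {0..T} (\<lambda>s. s ^ (DIM('b) - 1) *\<^sub>R h (s *\<^sub>R sgn z)))"

definition polar_factor :: "'b::euclidean_space itself \<Rightarrow> real" where
  "polar_factor _ = 1 / enn2real (polar_const TYPE('b))"

lemma polar_const_pos_finite:
  "0 < polar_const TYPE('b::euclidean_space)" "polar_const TYPE('b) < \<infinity>"
proof -
  have "unit_ball_vol (real DIM('b)) \<noteq> 0" by (metis less_irrefl of_nat_0_le_iff unit_ball_vol_pos)
  then have V: "ennreal (DIM('b) * unit_ball_vol (DIM('b))) \<noteq> 0"
    by (simp add: zero_less_mult_iff less_le)
  have "0 < ennreal (DIM('b) * unit_ball_vol (DIM('b))) * polar_const TYPE('b)"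
    "ennreal (DIM('b) * unit_ball_vol (DIM('b))) * polar_const TYPE('b) < \<infinity>"
    using ang_weight_integral_pos_finite[where 'b = 'b] unfolding nn_integral_ang_weight .
  then show "0 < polar_const TYPE('b)" "polar_const TYPE('b) < \<infinity>"
    using V by (auto simp: ennreal_zero_less_mult_iff ennreal_mult_less_top)
qed

lemma polar_const_eq_polar_factor:
  "polar_const TYPE('b::euclidean_space) = ennreal (1 / polar_factor TYPE('b))"
  "0 < polar_factor TYPE('b)"
  using polar_const_pos_finite[where 'b = 'b]
  by (auto simp: polar_factor_def less_top[symmetric] enn2real_positive_iff)

lemma cbox_One_superset: "norm z \<le> 1 \<Longrightarrow> z \<in> cbox (- One) (One :: 'b::euclidean_space)"
  using Basis_le_norm[of _ z] by (force simp: mem_box)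

lemma nn_integral_ang_weight_integral:
  fixes J :: "'b::euclidean_space \<Rightarrow> real"
  assumes "continuous_on UNIV (\<lambda>z. ang_weight z * J z)" "\<And>z. 0 \<le> J z"
  shows "(\<integral>\<^sup>+z. ennreal (ang_weight z) * ennreal (J z) \<partial>lborel)
    = ennreal (integral (cbox (- One) One) (\<lambda>z. ang_weight z * J z))"
proof -
  have "(\<integral>\<^sup>+z. ennreal (ang_weight z) * ennreal (J z) \<partial>lborel)
     = (\<integral>\<^sup>+z. ennreal (ang_weight z * J z) * indicator (cbox (- One) One) z \<partial>lborel)"
  proof (rule nn_integral_cong)
    fix z :: 'b
    show "ennreal (ang_weight z) * ennreal (J z)
        = ennreal (ang_weight z * J z) * indicator (cbox (- One) One) z"
      using cbox_One_superset[of z] ang_weight_eq_0[of z] assms(2)[of z]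
      by (cases "norm z \<le> 1") (auto simp: ennreal_mult)
  qed
  also have "\<dots> = ennreal (integral (cbox (- One) One) (\<lambda>z. ang_weight z * J z))"
    using assms
    by (intro nn_integral_has_integral_lebesgue' integrable_integral integrable_continuous
         continuous_on_subset[OF assms(1)]) auto
  finally show ?thesis .
qed

lemma nn_integral_polar_integral:
  fixes \<phi> :: "'b::euclidean_space \<Rightarrow> real"
  assumes cont: "continuous_on UNIV \<phi>" and nonneg: "\<And>y. 0 \<le> \<phi> y"
    and supp: "\<And>y. norm y > T \<Longrightarrow> \<phi> y = 0"
  shows "(\<integral>\<^sup>+y. ennreal (\<phi> y) \<partial>lborel) = ennreal (polar_factor TYPE('b) * polar_integral T \<phi>)"
    and "0 \<le> polar_integral T \<phi>"
proof -
  let ?n = "DIM('b)"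
  let ?J = "\<lambda>z. integral {0..T} (\<lambda>s. s ^ (?n - 1) * \<phi> (s *\<^sub>R sgn z))"
  have cont2: "continuous_on (UNIV \<times> {0..T}) (\<lambda>(w, s). s ^ (?n - 1) * \<phi> (s *\<^sub>R w))"
    unfolding split_beta
    by (intro continuous_intros continuous_on_compose2[OF cont]) auto
  have cont3: "continuous_on {0..T} (\<lambda>s. s ^ (?n - 1) * \<phi> (s *\<^sub>R w))" for w
    by (intro continuous_intros continuous_on_compose2[OF cont]) auto
  have J_nonneg: "0 \<le> ?J z" for z
    using nonneg cont3 by (intro integral_nonneg integrable_continuous_real) auto
  have wJ: "continuous_on UNIV (\<lambda>z. ang_weight z * ?J z)"
    using continuous_on_ang_weight_integral[OF cont2] by simp
  have inner: "ennreal (ang_weight z) * (\<integral>\<^sup>+s. indicator {0..} s * ennreal (s ^ (?n - 1))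
        * ennreal (\<phi> ((s / norm z) *\<^sub>R z)) \<partial>lborel) = ennreal (ang_weight z) * ennreal (?J z)" for z
  proof (cases "z = 0")
    case False
    have "(\<integral>\<^sup>+s. indicator {0..} s * ennreal (s ^ (?n - 1)) * ennreal (\<phi> ((s / norm z) *\<^sub>R z)) \<partial>lborel)
      = (\<integral>\<^sup>+s. ennreal (s ^ (?n - 1) * \<phi> (s *\<^sub>R sgn z)) * indicator {0..T} s \<partial>lborel)"
    proof (rule nn_integral_cong)
      fix s :: real
      have "(s / norm z) *\<^sub>R z = s *\<^sub>R sgn z" by (simp add: sgn_div_norm divide_inverse)
      moreover have "norm (s *\<^sub>R sgn z) = s" if "s \<ge> 0" using that False by (simp add: norm_sgn)
      ultimately show "indicator {0..} s * ennreal (s ^ (?n - 1)) * ennreal (\<phi> ((s / norm z) *\<^sub>R z))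
         = ennreal (s ^ (?n - 1) * \<phi> (s *\<^sub>R sgn z)) * indicator {0..T} s"
        using supp[of "s *\<^sub>R sgn z"] nonneg
        by (cases "s \<ge> 0"; cases "s \<le> T") (auto simp: ennreal_mult)
    qed
    also have "\<dots> = ennreal (?J z)"
      using nonneg cont3
      by (intro nn_integral_has_integral_lebesgue' integrable_integral integrable_continuous_real) auto
    finally show ?thesis by simp
  qed simp
  have "polar_const TYPE('b) * (\<integral>\<^sup>+y. ennreal (\<phi> y) \<partial>lborel)
      = (\<integral>\<^sup>+z. ennreal (ang_weight z) * ennreal (?J z) \<partial>lborel)"
  proof -
    have "(\<lambda>y. ennreal (\<phi> y)) \<in> borel_measurable borel"
      using borel_measurable_continuous_onI[OF cont] by simp
    from polar_nn_integral[OF this] show ?thesis unfolding inner by (rule sym)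
  qed
  also have "\<dots> = ennreal (polar_integral T \<phi>)"
    using nn_integral_ang_weight_integral[OF wJ J_nonneg] by (simp add: polar_integral_def)
  finally have eq: "polar_const TYPE('b) * (\<integral>\<^sup>+y. ennreal (\<phi> y) \<partial>lborel) = ennreal (polar_integral T \<phi>)" .
  show nn: "0 \<le> polar_integral T \<phi>"
    unfolding polar_integral_def real_scaleR_def using J_nonneg wJ
    by (intro integral_nonneg integrable_continuous continuous_on_subset[OF wJ]) auto
  have k: "0 < polar_factor TYPE('b)" by (rule polar_const_eq_polar_factor)
  have "(\<integral>\<^sup>+y. ennreal (\<phi> y) \<partial>lborel)
      = ennreal (polar_factor TYPE('b)) * (ennreal (1 / polar_factor TYPE('b)) * (\<integral>\<^sup>+y. ennreal (\<phi> y) \<partial>lborel))"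
    using k by (simp add: mult.assoc[symmetric] flip: ennreal_mult)
  also have "\<dots> = ennreal (polar_factor TYPE('b)) * ennreal (polar_integral T \<phi>)"
    using eq unfolding polar_const_eq_polar_factor(1) by simp
  finally show "(\<integral>\<^sup>+y. ennreal (\<phi> y) \<partial>lborel) = ennreal (polar_factor TYPE('b) * polar_integral T \<phi>)"
    using k nn by (simp add: ennreal_mult)
qed

lemma continuous_polar_integrand:
  fixes h :: "'b::euclidean_space \<Rightarrow> 'a::banach"
  assumes h: "continuous_on UNIV h"
  shows "continuous_on UNIV (\<lambda>z. ang_weight z *\<^sub>R integral {0..T} (\<lambda>s. s ^ (DIM('b) - 1) *\<^sub>R h (s *\<^sub>R sgn z)))"
    and "(\<lambda>s. s ^ (DIM('b) - 1) *\<^sub>R h (s *\<^sub>R w)) integrable_on {0..T}"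
    and "(\<lambda>z. ang_weight z *\<^sub>R integral {0..T} (\<lambda>s. s ^ (DIM('b) - 1) *\<^sub>R h (s *\<^sub>R sgn z)))
           integrable_on cbox (- One) One"
proof -
  have "continuous_on (UNIV \<times> {0..T}) (\<lambda>(w, s). s ^ (DIM('b) - 1) *\<^sub>R h (s *\<^sub>R w))"
    unfolding split_beta by (intro continuous_intros continuous_on_compose2[OF h]) auto
  from continuous_on_ang_weight_integral[OF this]
  show c: "continuous_on UNIV (\<lambda>z. ang_weight z *\<^sub>R integral {0..T} (\<lambda>s. s ^ (DIM('b) - 1) *\<^sub>R h (s *\<^sub>R sgn z)))"
    by simp
  then show "(\<lambda>z. ang_weight z *\<^sub>R integral {0..T} (\<lambda>s. s ^ (DIM('b) - 1) *\<^sub>R h (s *\<^sub>R sgn z)))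
           integrable_on cbox (- One) One"
    by (intro integrable_continuous continuous_on_subset[OF c]) auto
  show "(\<lambda>s. s ^ (DIM('b) - 1) *\<^sub>R h (s *\<^sub>R w)) integrable_on {0..T}"
    by (intro integrable_continuous_real continuous_intros continuous_on_compose2[OF h]) auto
qed

lemma polar_integral_diff:
  fixes h g :: "'b::euclidean_space \<Rightarrow> 'a::banach"
  assumes h: "continuous_on UNIV h" and g: "continuous_on UNIV g"
  shows "polar_integral T (\<lambda>y. h y - g y) = polar_integral T h - polar_integral T g"
  unfolding polar_integral_def scaleR_diff_right
    Henstock_Kurzweil_Integration.integral_diff[OF continuous_polar_integrand(2)[OF h]
      continuous_polar_integrand(2)[OF g]]
  by (rule Henstock_Kurzweil_Integration.integral_diff continuous_polar_integrand h g)+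

lemma polar_integral_sum:
  fixes c :: "'p \<Rightarrow> 'a::banach" and \<phi> :: "'p \<Rightarrow> 'b::euclidean_space \<Rightarrow> real"
  assumes P: "finite P" and \<phi>: "\<And>p. p \<in> P \<Longrightarrow> continuous_on UNIV (\<phi> p)"
  shows "polar_integral T (\<lambda>y. \<Sum>p\<in>P. \<phi> p y *\<^sub>R c p) = (\<Sum>p\<in>P. polar_integral T (\<phi> p) *\<^sub>R c p)"
proof -
  have g: "continuous_on UNIV (\<lambda>y. \<phi> p y *\<^sub>R c p)" if "p \<in> P" for p
    using \<phi>[OF that] by (intro continuous_intros)
  have one: "polar_integral T (\<lambda>y. \<phi> p y *\<^sub>R c p) = polar_integral T (\<phi> p) *\<^sub>R c p" if "p \<in> P" for p
  proof -
    note I = continuous_polar_integrand[OF \<phi>[OF that], where T = T]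
    have "integral {0..T} (\<lambda>s. s ^ (DIM('b) - 1) *\<^sub>R \<phi> p (s *\<^sub>R w) *\<^sub>R c p)
      = integral {0..T} (\<lambda>s. s ^ (DIM('b) - 1) *\<^sub>R \<phi> p (s *\<^sub>R w)) *\<^sub>R c p" for w :: 'b
      using integral_unique[OF has_integral_scaleR_left[OF integrable_integral[OF I(2)]]]
      by (simp only: scaleR_scaleR real_scaleR_def)
    then show ?thesis unfolding polar_integral_def
      using integral_unique[OF has_integral_scaleR_left[OF integrable_integral[OF I(3)]]]
      by (simp only: scaleR_scaleR real_scaleR_def)
  qed
  have "polar_integral T (\<lambda>y. \<Sum>p\<in>P. \<phi> p y *\<^sub>R c p) = integral (cbox (- One) One)
     (\<lambda>z. \<Sum>p\<in>P. ang_weight z *\<^sub>R integral {0..T} (\<lambda>s. s ^ (DIM('b) - 1) *\<^sub>R \<phi> p (s *\<^sub>R sgn z) *\<^sub>R c p))"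
    unfolding polar_integral_def scaleR_sum_right
    using continuous_polar_integrand(2)[OF g] P
    by (subst Henstock_Kurzweil_Integration.integral_sum) (auto simp: scaleR_sum_right)
  also have "\<dots> = (\<Sum>p\<in>P. polar_integral T (\<lambda>y. \<phi> p y *\<^sub>R c p))"
    unfolding polar_integral_def
    by (rule Henstock_Kurzweil_Integration.integral_sum[OF P continuous_polar_integrand(3)[OF g]])
  finally have "polar_integral T (\<lambda>y. \<Sum>p\<in>P. \<phi> p y *\<^sub>R c p) = (\<Sum>p\<in>P. polar_integral T (\<lambda>y. \<phi> p y *\<^sub>R c p))" .
  then show ?thesis using one by simp
qed

lemma norm_polar_integral_le:
  fixes h :: "'b::euclidean_space \<Rightarrow> 'a::banach"
  assumes h: "continuous_on UNIV h" and le: "\<And>y. norm (h y) \<le> B" and T: "0 \<le> T"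
  shows "norm (polar_integral T h) \<le> B * (T ^ (DIM('b) - 1) * T * measure lborel (cbox (- One) (One :: 'b)))"
proof -
  have B: "0 \<le> B" using order_trans[OF norm_ge_zero le] .
  let ?J = "\<lambda>z. integral {0..T} (\<lambda>s. s ^ (DIM('b) - 1) *\<^sub>R h (s *\<^sub>R sgn z))"
  have J: "norm (?J z) \<le> T ^ (DIM('b) - 1) * B * T" for z
  proof -
    have "norm (integral (cbox 0 T) (\<lambda>s. s ^ (DIM('b) - 1) *\<^sub>R h (s *\<^sub>R sgn z)))
       \<le> (T ^ (DIM('b) - 1) * B) * measure lborel (cbox 0 T)"
    proof (rule integrable_bound)
      fix s :: real assume s: "s \<in> cbox 0 T"
      then show "norm (s ^ (DIM('b) - 1) *\<^sub>R h (s *\<^sub>R sgn z)) \<le> T ^ (DIM('b) - 1) * B"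
        using le[of "s *\<^sub>R sgn z"] by (auto intro!: mult_mono power_mono)
    qed (use T B continuous_polar_integrand[OF h] in auto)
    then show ?thesis using T by simp
  qed
  have "norm (polar_integral T h) \<le> (T ^ (DIM('b) - 1) * B * T) * measure lborel (cbox (- One) (One :: 'b))"
    unfolding polar_integral_def
  proof (rule integrable_bound)
    fix z :: 'b
    have "norm (ang_weight z *\<^sub>R ?J z) \<le> 1 * norm (?J z)"
    proof (cases "norm z \<le> 1")
      case True
      then have "ang_weight z \<le> 1" using ang_weight_le[of z] by simp
      then show ?thesis by (simp add: mult_left_le_one_le)
    qed (simp add: ang_weight_eq_0)
    then show "norm (ang_weight z *\<^sub>R ?J z) \<le> T ^ (DIM('b) - 1) * B * T" using J[of z] by simp
  qed (use T B continuous_polar_integrand[OF h] in auto)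
  then show ?thesis by (simp add: mult_ac)
qed

text \<open>
  A partition of unity by tents of radius \<open>d\<close>, where \<open>d\<close> comes from the uniform continuity of \<open>h\<close>.
  The sum of the tents vanishes far away; adding the distance to the ball makes the denominator
  positive everywhere and does not change it on the ball, where the weights must add up to 1.
\<close>

lemma finite_tensor_approximation:
  fixes h :: "'b::euclidean_space \<Rightarrow> 'a::banach"
  assumes h: "continuous_on UNIV h" and supp: "\<And>y. norm y > T \<Longrightarrow> h y = 0" and T: "0 \<le> T"
    and e: "\<epsilon> > 0"
  obtains P and \<phi> :: "'b \<Rightarrow> 'b \<Rightarrow> real" where "finite P"
    "\<And>p. p \<in> P \<Longrightarrow> continuous_on UNIV (\<phi> p)" "\<And>p y. p \<in> P \<Longrightarrow> 0 \<le> \<phi> p y"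
    "\<And>p y. p \<in> P \<Longrightarrow> norm y > T + 1 \<Longrightarrow> \<phi> p y = 0"
    "\<And>y. norm (h y - (\<Sum>p\<in>P. \<phi> p y *\<^sub>R h p)) \<le> \<epsilon>"
proof -
  have "uniformly_continuous_on (cball 0 (T + 1)) h"
    by (intro compact_uniformly_continuous continuous_on_subset[OF h]) auto
  from uniformly_continuous_onE[OF this e] obtain d0 where d0: "d0 > 0"
    "\<And>y y'. y \<in> cball 0 (T + 1) \<Longrightarrow> y' \<in> cball 0 (T + 1) \<Longrightarrow> dist y' y < d0 \<Longrightarrow> dist (h y') (h y) < \<epsilon>"
    by metis
  define d where "d = min d0 1"
  have d: "d > 0" "d \<le> 1" "d \<le> d0" using d0 by (auto simp: d_def)
  let ?B = "cball 0 T :: 'b set"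
  have "seq_compact ?B" by (simp add: compact_imp_seq_compact)
  from seq_compact_imp_totally_bounded[OF this] d(1)
  have "\<exists>P. finite P \<and> P \<subseteq> ?B \<and> ?B \<subseteq> (\<Union>p\<in>P. ball p d)" by blast
  then obtain P where P: "finite P" "P \<subseteq> ?B" "?B \<subseteq> (\<Union>p\<in>P. ball p d)" by blast
  define \<psi> where "\<psi> = (\<lambda>p y :: 'b. max 0 (d - dist y p))"
  define \<Psi> where "\<Psi> = (\<lambda>y. (\<Sum>p\<in>P. \<psi> p y) + infdist y ?B)"
  have \<psi>0: "0 \<le> \<psi> p y" for p y by (simp add: \<psi>_def)
  have Ball_ne: "?B \<noteq> {}" using T by simp
  have \<Psi>_pos: "0 < \<Psi> y" for y
  proof (cases "y \<in> ?B")
    case True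
    with P(3) obtain p where p: "p \<in> P" "dist y p < d" by (auto simp: dist_commute)
    then have "0 < (\<Sum>p\<in>P. \<psi> p y)"
      using P(1) \<psi>0 by (intro sum_pos2[of P p]) (auto simp: \<psi>_def)
    then show ?thesis by (simp add: \<Psi>_def add_pos_nonneg infdist_nonneg)
  next
    case False
    then have "infdist y ?B > 0"
      using in_closed_iff_infdist_zero[of ?B y] Ball_ne infdist_nonneg[of y ?B] by fastforce
    then show ?thesis by (simp add: \<Psi>_def add_nonneg_pos sum_nonneg \<psi>0)
  qed
  have \<Psi>_cont: "continuous_on UNIV \<Psi>" unfolding \<Psi>_def \<psi>_def by (intro continuous_intros)
  define \<phi> where "\<phi> = (\<lambda>p y. \<psi> p y / \<Psi> y)"
  have \<phi>0: "0 \<le> \<phi> p y" for p y using \<psi>0[of p y] \<Psi>_pos[of y] by (simp add: \<phi>_def)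
  have near: "dist y p < d" if "\<phi> p y \<noteq> 0" for p y
    using that by (auto simp: \<phi>_def \<psi>_def max_def split: if_splits)
  have in_big: "y \<in> cball 0 (T + 1) \<and> p \<in> cball 0 (T + 1)" if "p \<in> P" "dist y p < d" for p y
  proof -
    have "norm p \<le> T" using that P(2) by auto
    moreover have "norm y \<le> norm p + dist y p" using norm_triangle_sub[of y p] by (simp add: dist_norm)
    ultimately show ?thesis using that d by simp
  qed
  show ?thesis
  proof (rule that[of P \<phi>])
    show "continuous_on UNIV (\<phi> p)" for p
      unfolding \<phi>_def using \<Psi>_pos by (intro continuous_on_divide \<Psi>_cont)
        (auto simp: \<psi>_def less_imp_neq[symmetric] intro!: continuous_intros)
    show "\<phi> p y = 0" if "p \<in> P" "norm y > T + 1" for p y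
      using in_big[OF that(1), of y] near[of p y] that(2) by force
    fix y
    let ?S = "\<Sum>p\<in>P. \<phi> p y"
    have S_eq: "?S = (\<Sum>p\<in>P. \<psi> p y) / \<Psi> y" by (simp add: \<phi>_def sum_divide_distrib)
    have S1: "?S \<le> 1"
      unfolding S_eq using \<Psi>_pos[of y] infdist_nonneg[of y ?B] by (simp add: \<Psi>_def)
    have S0: "0 \<le> ?S" by (intro sum_nonneg \<phi>0)
    \<comment> \<open>The weights add up to 1 on the ball, and off the ball h vanishes.\<close>
    have "(1 - ?S) *\<^sub>R h y = 0"
    proof (cases "y \<in> ?B")
      case True
      then have "\<Psi> y = (\<Sum>p\<in>P. \<psi> p y)" by (simp add: \<Psi>_def)
      then show ?thesis using \<Psi>_pos[of y] by (simp add: S_eq)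
    qed (use supp[of y] in auto)
    then have "h y - (\<Sum>p\<in>P. \<phi> p y *\<^sub>R h p) = (\<Sum>p\<in>P. \<phi> p y *\<^sub>R (h y - h p))"
      by (simp add: scaleR_diff_right sum_subtractf scaleR_sum_left[symmetric] algebra_simps)
    also have "norm \<dots> \<le> (\<Sum>p\<in>P. \<phi> p y * \<epsilon>)"
    proof (rule sum_norm_le)
      fix p assume p: "p \<in> P"
      show "norm (\<phi> p y *\<^sub>R (h y - h p)) \<le> \<phi> p y * \<epsilon>"
      proof (cases "\<phi> p y = 0")
        case False
        from near[OF this] have "dist y p < d" .
        then have "dist (h y) (h p) < \<epsilon>" using d0(2)[of p y] in_big[OF p] d by auto
        then show ?thesis using \<phi>0[of p y] by (simp add: dist_norm mult_left_mono)
      qed simp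
    qed
    also have "\<dots> = ?S * \<epsilon>" by (simp add: sum_distrib_right)
    also have "\<dots> \<le> \<epsilon>" using S1 S0 e by (simp add: mult_left_le_one_le)
    finally show "norm (h y - (\<Sum>p\<in>P. \<phi> p y *\<^sub>R h p)) \<le> \<epsilon>" .
  qed (use P \<phi>0 in auto)
qed

lemma has_gen_bochner_integral_sum:
  fixes f :: "'p \<Rightarrow> 'b::euclidean_space \<Rightarrow> 'a::banach"
  assumes "finite P" "\<And>p. p \<in> P \<Longrightarrow> continuous_on UNIV (f p)"
    "\<And>p. p \<in> P \<Longrightarrow> has_gen_bochner_integral lborel (f p) (X p)"
  shows "has_gen_bochner_integral lborel (\<lambda>y. \<Sum>p\<in>P. f p y) (\<Sum>p\<in>P. X p)"
  using assms
proof (induction P rule: finite_induct)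
  case empty
  then show ?case by (simp add: has_gen_bochner_integral_zero)
next
  case (insert p P)
  have "continuous_on UNIV (\<lambda>y. f p y + (\<Sum>p\<in>P. f p y))"
    using insert by (intro continuous_intros) auto
  then show ?case
    using insert by (auto intro!: has_gen_bochner_integral_add borel_measurable_continuous_onI)
qed

text \<open>
  Both sides are continuous under uniform convergence with a common compact support. For a
  nonnegative scalar function times a fixed vector the claim is the scalar polar formula, and
  finite sums of such functions approximate \<open>h\<close>.
\<close>

lemma has_gen_bochner_integral_polar:
  fixes h :: "'b::euclidean_space \<Rightarrow> 'a::banach"
  assumes h: "continuous_on UNIV h" and supp: "\<And>y. norm y > T \<Longrightarrow> h y = 0" and T: "0 \<le> T"
  shows "has_gen_bochner_integral lborel (\<lambda>y. h (y - x))
           (polar_factor TYPE('b) *\<^sub>R polar_integral (T + 1) h)"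
proof -
  let ?k = "polar_factor TYPE('b)"
  let ?T = "T + 1"
  define \<epsilon> where "\<epsilon> = (\<lambda>i. inverse (real (Suc i)))"
  have \<epsilon>: "\<epsilon> i > 0" "\<epsilon> \<longlonglongrightarrow> 0" for i
    unfolding \<epsilon>_def using LIMSEQ_inverse_real_of_nat by auto
  define good where "good = (\<lambda>i Q. finite (fst Q) \<and> (\<forall>p\<in>fst Q. continuous_on UNIV (snd Q p :: 'b \<Rightarrow> real)) \<and>
    (\<forall>p\<in>fst Q. \<forall>y. 0 \<le> snd Q p y) \<and> (\<forall>p\<in>fst Q. \<forall>y. norm y > ?T \<longrightarrow> snd Q p y = 0) \<and>
    (\<forall>y. norm (h y - (\<Sum>p\<in>fst Q. snd Q p y *\<^sub>R h p)) \<le> \<epsilon> i))"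
  have "\<exists>Q. good i Q" for i
  proof (rule finite_tensor_approximation[OF h supp T \<epsilon>(1)[of i]])
    fix P and \<phi> :: "'b \<Rightarrow> 'b \<Rightarrow> real"
    assume "finite P" "\<And>p. p \<in> P \<Longrightarrow> continuous_on UNIV (\<phi> p)"
      "\<And>p y. p \<in> P \<Longrightarrow> 0 \<le> \<phi> p y" "\<And>p y. p \<in> P \<Longrightarrow> norm y > ?T \<Longrightarrow> \<phi> p y = 0"
      "\<And>y. norm (h y - (\<Sum>p\<in>P. \<phi> p y *\<^sub>R h p)) \<le> \<epsilon> i"
    then have "good i (P, \<phi>)" unfolding good_def by simp
    then show ?thesis ..
  qed
  then have "\<forall>i. \<exists>Q. good i Q" ..
  from choice[OF this] obtain Q where Q: "\<And>i. good i (Q i)" by blast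
  define P where "P = (\<lambda>i. fst (Q i))"
  define \<phi> where "\<phi> = (\<lambda>i. snd (Q i))"
  have P: "\<And>i. finite (P i)"
      "\<And>i p. p \<in> P i \<Longrightarrow> continuous_on UNIV (\<phi> i p)"
      "\<And>i p y. p \<in> P i \<Longrightarrow> 0 \<le> \<phi> i p y"
      "\<And>i p y. p \<in> P i \<Longrightarrow> norm y > ?T \<Longrightarrow> \<phi> i p y = 0"
      "\<And>i y. norm (h y - (\<Sum>p\<in>P i. \<phi> i p y *\<^sub>R h p)) \<le> \<epsilon> i"
    using Q unfolding good_def P_def \<phi>_def by blast+
  define q where "q = (\<lambda>i y. \<Sum>p\<in>P i. \<phi> i p y *\<^sub>R h p)"
  have q_cont: "continuous_on UNIV (q i)" for i
    unfolding q_def using P by (intro continuous_intros) auto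
  have q_int: "has_gen_bochner_integral lborel (\<lambda>y. q i (y - x)) (?k *\<^sub>R polar_integral ?T (q i))" for i
  proof -
    have "has_gen_bochner_integral lborel (\<lambda>y. \<phi> i p (y - x) *\<^sub>R h p) ((?k * polar_integral ?T (\<phi> i p)) *\<^sub>R h p)"
      if p: "p \<in> P i" for p
    proof -
      note c = P(2)[OF p]
      have cx: "continuous_on UNIV (\<lambda>y. \<phi> i p (y - x))"
        by (rule continuous_on_compose2[OF c]) (auto intro!: continuous_intros)
      have "(\<integral>\<^sup>+y. ennreal (\<phi> i p (y - x)) \<partial>lborel) = (\<integral>\<^sup>+y. ennreal (\<phi> i p y) \<partial>lborel)"
        using nn_integral_lborel_shift[of "\<lambda>y. ennreal (\<phi> i p y)" "- x"] borel_measurable_continuous_onI[OF c]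
        by simp
      also have "\<dots> = ennreal (?k * polar_integral ?T (\<phi> i p))"
        using P p by (intro nn_integral_polar_integral) auto
      finally have "has_bochner_integral lborel (\<lambda>y. \<phi> i p (y - x)) (?k * polar_integral ?T (\<phi> i p))"
        using P p borel_measurable_continuous_onI[OF cx] nn_integral_polar_integral(2)[of "\<phi> i p" ?T]
          polar_const_eq_polar_factor(2)[where 'b = 'b]
        by (intro has_bochner_integral_nn_integral) auto
      then have "has_gen_bochner_integral lborel (\<lambda>y. \<phi> i p (y - x)) (?k * polar_integral ?T (\<phi> i p))"
        by (simp add: has_gen_bochner_integral_iff)
      from has_gen_bochner_integral_bounded_linear[OF bounded_linear_scaleR_left this]
      show ?thesis .
    qed
    moreover have "continuous_on UNIV (\<lambda>y. \<phi> i p (y - x) *\<^sub>R h p)" if "p \<in> P i" for p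
      by (intro continuous_intros continuous_on_compose2[OF P(2)[OF that]]) auto
    ultimately have "has_gen_bochner_integral lborel (\<lambda>y. q i (y - x))
       (\<Sum>p\<in>P i. (?k * polar_integral ?T (\<phi> i p)) *\<^sub>R h p)"
      unfolding q_def using P(1) by (intro has_gen_bochner_integral_sum)
    also have "(\<Sum>p\<in>P i. (?k * polar_integral ?T (\<phi> i p)) *\<^sub>R h p) = ?k *\<^sub>R polar_integral ?T (q i)"
      unfolding q_def using P by (simp add: polar_integral_sum scaleR_sum_right)
    finally show ?thesis .
  qed
  let ?B = "cball x ?T"
  have diff: "ennreal (norm (h (y - x) - q i (y - x))) \<le> ennreal (\<epsilon> i) * indicator ?B y" for i y
  proof (cases "y \<in> ?B")
    case True
    then show ?thesis using P(5)[of "y - x" i] by (simp add: q_def ennreal_leI)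
  next
    case False
    then have y: "norm (y - x) > ?T" by (simp add: dist_norm norm_minus_commute)
    then have "h (y - x) = 0" "q i (y - x) = 0" using supp[of "y - x"] P(4) by (auto simp: q_def)
    then show ?thesis by simp
  qed
  have lim: "(\<lambda>i. \<integral>\<^sup>+y. ennreal (\<epsilon> i) * indicator ?B y \<partial>lborel) \<longlonglongrightarrow> 0"
  proof -
    have "(\<integral>\<^sup>+y. ennreal (\<epsilon> i) * indicator ?B y \<partial>lborel) = emeasure lborel ?B * ennreal (\<epsilon> i)" for i
      by (simp add: nn_integral_cmult_indicator mult.commute)
    moreover have "(\<lambda>i. emeasure lborel ?B * ennreal (\<epsilon> i)) \<longlonglongrightarrow> emeasure lborel ?B * ennreal 0"
      using T by (intro ennreal_tendsto_cmult tendsto_ennrealI \<epsilon>) (simp add: emeasure_cball)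
    ultimately show ?thesis by simp
  qed
  have "continuous_on UNIV (\<lambda>y. h (y - x))"
    by (intro continuous_on_compose2[OF h] continuous_intros) auto
  then have hx: "(\<lambda>y. h (y - x)) \<in> borel_measurable lborel"
    by (simp add: borel_measurable_continuous_onI)
  have bm: "(\<lambda>y. ennreal (\<epsilon> i) * indicator ?B y) \<in> borel_measurable lborel" for i
    by (intro borel_measurable_times_ennreal borel_measurable_const borel_measurable_indicator) simp
  obtain X where X: "has_gen_bochner_integral lborel (\<lambda>y. h (y - x)) X"
     "(\<lambda>i. ?k *\<^sub>R polar_integral ?T (q i)) \<longlonglongrightarrow> X"
    by (rule has_gen_bochner_integral_limit[OF hx q_int bm diff lim]) auto
  have "(\<lambda>i. polar_integral ?T h - polar_integral ?T (q i)) \<longlonglongrightarrow> 0"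
  proof (rule Lim_null_comparison)
    let ?C = "?T ^ (DIM('b) - 1) * ?T * measure lborel (cbox (- One) (One :: 'b))"
    show "\<forall>\<^sub>F i in sequentially. norm (polar_integral ?T h - polar_integral ?T (q i)) \<le> \<epsilon> i * ?C"
    proof (intro always_eventually allI)
      fix i
      have "norm (polar_integral ?T (\<lambda>y. h y - q i y)) \<le> \<epsilon> i * ?C"
        using P(5) T h q_cont[of i] unfolding q_def[symmetric]
        by (intro norm_polar_integral_le continuous_intros) (auto simp: q_def)
      then show "norm (polar_integral ?T h - polar_integral ?T (q i)) \<le> \<epsilon> i * ?C"
        by (simp add: polar_integral_diff[OF h q_cont])
    qed
    show "(\<lambda>i. \<epsilon> i * ?C) \<longlonglongrightarrow> 0" using tendsto_mult_left_zero[OF \<epsilon>(2)] by blast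
  qed
  then have "(\<lambda>i. polar_integral ?T h - (polar_integral ?T h - polar_integral ?T (q i))) \<longlonglongrightarrow> polar_integral ?T h - 0"
    by (intro tendsto_diff tendsto_const)
  then have "(\<lambda>i. ?k *\<^sub>R polar_integral ?T (q i)) \<longlonglongrightarrow> ?k *\<^sub>R polar_integral ?T h"
    by (intro tendsto_scaleR tendsto_const) simp
  with X(2) have "X = ?k *\<^sub>R polar_integral ?T h" by (rule LIMSEQ_unique)
  with X(1) show ?thesis by simp
qed

section \<open>Iterated partial derivatives along a line\<close>

lemma partial_has_vector_derivative:
  fixes F :: "real ^ 'n::finite \<Rightarrow> 'a::real_normed_vector"
  assumes "\<And>x. partial_at_exists i F x"
  shows "((\<lambda>t. F (x + t *\<^sub>R axis i 1)) has_vector_derivative partial i F (x + t *\<^sub>R axis i 1)) (at t within A)"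
proof -
  let ?y = "x + t *\<^sub>R axis i 1"
  have "((\<lambda>s. F (?y + s *\<^sub>R axis i 1)) has_vector_derivative partial i F ?y) (at (t - t))"
    using assms[of ?y] by (simp add: partial_at_exists_def partial_def vector_derivative_works)
  moreover have "((\<lambda>s. s - t) has_vector_derivative 1) (at t)"
    by (auto intro!: derivative_eq_intros)
  ultimately have "((\<lambda>s. F (?y + s *\<^sub>R axis i 1)) \<circ> (\<lambda>s. s - t) has_vector_derivative 1 *\<^sub>R partial i F ?y) (at t)"
    by (intro vector_diff_chain_at)
  then have "((\<lambda>s. F (x + s *\<^sub>R axis i 1)) has_vector_derivative partial i F ?y) (at t)"
    by (simp add: o_def algebra_simps)
  then show ?thesis by (rule has_vector_derivative_at_within)
qed

text \<open>
  The increment of \<open>F\<close> telescopes over the coordinates. Each one-coordinate increment is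
  controlled by the mean value inequality along a segment that stays within distance \<open>norm h\<close>
  of \<open>x\<close>, where the partial derivative is nearly constant.
\<close>

lemma continuous_partials_imp_has_derivative:
  fixes F :: "real ^ 'n::finite \<Rightarrow> 'a::real_normed_vector"
  assumes ex: "\<And>i x. partial_at_exists i F x" and cont: "\<And>i. continuous_on UNIV (partial i F)"
  shows "(F has_derivative (\<lambda>h. \<Sum>i\<in>UNIV. h $ i *\<^sub>R partial i F x)) (at x)"
proof -
  let ?e = "\<lambda>i. axis i 1 :: real ^ 'n"
  let ?p = "\<lambda>S h. \<Sum>i\<in>S. h $ i *\<^sub>R ?e i"
  have p_comp: "?p S h $ j = (if j \<in> S then h $ j else 0)" for S h j
    by (simp add: axis_def if_distrib[of "\<lambda>c. _ * c"] cong: if_cong)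
  have main: "\<forall>\<epsilon>>0. \<exists>\<delta>>0. \<forall>h. norm h < \<delta> \<longrightarrow>
      norm (F (x + ?p S h) - F x - (\<Sum>i\<in>S. h $ i *\<^sub>R partial i F x)) \<le> \<epsilon> * norm h" if "finite S" for S :: "'n set"
    using that
  proof (induction S rule: finite_induct)
    case empty
    then show ?case by (auto intro: exI[of _ 1])
  next
    case (insert i S)
    show ?case
    proof (intro allI impI)
      fix \<epsilon> :: real assume \<epsilon>: "\<epsilon> > 0"
      from insert.IH \<epsilon> obtain \<delta>1 where d1: "\<delta>1 > 0" "\<And>h. norm h < \<delta>1 \<Longrightarrow>
          norm (F (x + ?p S h) - F x - (\<Sum>i\<in>S. h $ i *\<^sub>R partial i F x)) \<le> \<epsilon> / 2 * norm h"
        by (meson half_gt_zero)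
      have "isCont (partial i F) x" using cont by (simp add: continuous_on_eq_continuous_at)
      then obtain \<delta>2 where d2: "\<delta>2 > 0" "\<And>y. norm (y - x) < \<delta>2 \<Longrightarrow> norm (partial i F y - partial i F x) < \<epsilon> / 2"
        using \<epsilon> unfolding continuous_at_eps_delta dist_norm by (meson half_gt_zero)
      show "\<exists>\<delta>>0. \<forall>h. norm h < \<delta> \<longrightarrow> norm (F (x + ?p (insert i S) h) - F x
          - (\<Sum>i\<in>insert i S. h $ i *\<^sub>R partial i F x)) \<le> \<epsilon> * norm h"
      proof (intro exI[of _ "min \<delta>1 \<delta>2"] conjI allI impI)
        fix h :: "real ^ 'n" assume h: "norm h < min \<delta>1 \<delta>2"
        let ?y = "x + ?p S h"
        let ?g = "\<lambda>t. F (?y + t *\<^sub>R ?e i) - t *\<^sub>R partial i F x"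
        have "norm (?g (h $ i) - ?g 0) \<le> \<epsilon> / 2 * norm (h $ i - 0)"
        proof (rule differentiable_bound[where S = "closed_segment 0 (h $ i)"])
          fix t assume t: "t \<in> closed_segment 0 (h $ i)"
          have "(?g has_vector_derivative partial i F (?y + t *\<^sub>R ?e i) - 1 *\<^sub>R partial i F x)
             (at t within closed_segment 0 (h $ i))"
            by (intro derivative_intros partial_has_vector_derivative ex
                has_vector_derivative_scaleR[THEN has_vector_derivative_eq_rhs]) (auto intro!: derivative_eq_intros)
          then show "(?g has_derivative (\<lambda>u. u *\<^sub>R (partial i F (?y + t *\<^sub>R ?e i) - partial i F x)))
             (at t within closed_segment 0 (h $ i))"
            by (simp add: has_vector_derivative_def)
          have "norm (?p S h + t *\<^sub>R ?e i) \<le> norm h"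
          proof (rule norm_le_componentwise_cart)
            fix j
            have "\<bar>t\<bar> \<le> \<bar>h $ i\<bar>" using t by (auto simp: closed_segment_eq_real_ivl split: if_splits)
            then show "norm ((?p S h + t *\<^sub>R ?e i) $ j) \<le> norm (h $ j)"
              using insert.hyps by (auto simp only: vector_add_component p_comp) (auto simp: axis_def)
          qed
          then have lt: "norm (partial i F (?y + t *\<^sub>R ?e i) - partial i F x) < \<epsilon> / 2"
            using h by (intro d2) (simp add: algebra_simps)
          show "onorm (\<lambda>u. u *\<^sub>R (partial i F (?y + t *\<^sub>R ?e i) - partial i F x)) \<le> \<epsilon> / 2"
          proof (rule onorm_bound)
            fix u :: real
            show "norm (u *\<^sub>R (partial i F (?y + t *\<^sub>R ?e i) - partial i F x)) \<le> \<epsilon> / 2 * norm u"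
              using mult_right_mono[OF less_imp_le[OF lt], of "norm u"] by (simp add: mult.commute)
          qed (use \<epsilon> in simp)
        qed auto
        also have "\<dots> \<le> \<epsilon> / 2 * norm h"
          using \<epsilon> component_le_norm_cart[of h i] by (intro mult_left_mono) auto
        finally have 1: "norm (?g (h $ i) - ?g 0) \<le> \<epsilon> / 2 * norm h" .
        have 2: "norm (F ?y - F x - (\<Sum>i\<in>S. h $ i *\<^sub>R partial i F x)) \<le> \<epsilon> / 2 * norm h"
          using d1(2)[of h] h by simp
        have "F (x + ?p (insert i S) h) - F x - (\<Sum>i\<in>insert i S. h $ i *\<^sub>R partial i F x)
           = (?g (h $ i) - ?g 0) + (F ?y - F x - (\<Sum>i\<in>S. h $ i *\<^sub>R partial i F x))"
          using insert.hyps by (simp add: algebra_simps)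
        also have "norm \<dots> \<le> \<epsilon> / 2 * norm h + \<epsilon> / 2 * norm h"
          by (rule norm_triangle_mono[OF 1 2])
        finally show "norm (F (x + ?p (insert i S) h) - F x
          - (\<Sum>i\<in>insert i S. h $ i *\<^sub>R partial i F x)) \<le> \<epsilon> * norm h" by simp
      qed (use d1 d2 in auto)
    qed
  qed
  have p_UNIV: "?p UNIV h = h" for h by (simp only: vec_eq_iff p_comp) simp
  show ?thesis
    unfolding has_derivative_at_alt
  proof (intro conjI allI impI)
    show "bounded_linear (\<lambda>h. \<Sum>i\<in>UNIV. h $ i *\<^sub>R partial i F x)"
      by (intro bounded_linear_sum bounded_linear_compose[OF bounded_linear_scaleR_left] bounded_linear_vec_nth)
    fix \<epsilon> :: real assume "0 < \<epsilon>"
    with main[OF finite, of UNIV] obtain \<delta> where d: "\<delta> > 0" "\<forall>h. norm h < \<delta> \<longrightarrow>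
      norm (F (x + h) - F x - (\<Sum>i\<in>UNIV. h $ i *\<^sub>R partial i F x)) \<le> \<epsilon> * norm h"
      unfolding p_UNIV by blast
    have "norm (F y - F x - (\<Sum>i\<in>UNIV. (y - x) $ i *\<^sub>R partial i F x)) \<le> \<epsilon> * norm (y - x)"
      if "norm (y - x) < \<delta>" for y
      using d(2)[rule_format, OF that] by (simp only: add.commute[of x] diff_add_cancel)
    with d(1) show "\<exists>d>0. \<forall>y. norm (y - x) < d \<longrightarrow>
        norm (F y - F x - (\<Sum>i\<in>UNIV. (y - x) $ i *\<^sub>R partial i F x)) \<le> \<epsilon> * norm (y - x)"
      by blast
  qed
qed

lemma cont_diff_mono: "cont_diff m F \<Longrightarrow> j \<le> m \<Longrightarrow> cont_diff j F"
proof (induction m arbitrary: j F)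
  case (Suc m)
  then show ?case by (cases j) auto
qed auto

lemma cont_diff_imp_continuous: "cont_diff m F \<Longrightarrow> continuous_on UNIV F"
  by (cases m) auto

lemma cont_diff_Suc_has_vector_derivative:
  fixes F :: "real ^ 'n::finite \<Rightarrow> 'a::real_normed_vector"
  assumes "cont_diff (Suc m) F"
  shows "((\<lambda>s. F (x + s *\<^sub>R w)) has_vector_derivative
     (\<Sum>i\<in>UNIV. w $ i *\<^sub>R partial i F (x + s *\<^sub>R w))) (at s within A)"
proof -
  have F: "(F has_derivative (\<lambda>h. \<Sum>i\<in>UNIV. h $ i *\<^sub>R partial i F (x + s *\<^sub>R w))) (at (x + s *\<^sub>R w))"
    using assms cont_diff_imp_continuous by (intro continuous_partials_imp_has_derivative) auto
  have L: "((\<lambda>s. x + s *\<^sub>R w) has_derivative (\<lambda>h. h *\<^sub>R w)) (at s)"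
    by (auto intro!: derivative_eq_intros)
  have "((\<lambda>s. F (x + s *\<^sub>R w)) has_vector_derivative
     (\<Sum>i\<in>UNIV. w $ i *\<^sub>R partial i F (x + s *\<^sub>R w))) (at s)"
    using has_derivative_compose[OF L F] by (simp add: has_vector_derivative_def scaleR_sum_right)
  then show ?thesis by (rule has_vector_derivative_at_within)
qed

lemma cont_diff_foldr_partial:
  "cont_diff (m + length u) F \<Longrightarrow> cont_diff m (foldr partial u F)"
  by (induction u arbitrary: F rule: rev_induct) auto

text \<open>
  \<open>F (x + s e + t f) - F (x + s e)\<close> is the integral of \<open>partial j F\<close> over the segment in direction \<open>f\<close>.
  Differentiating under the integral at \<open>s = 0\<close>, and then with respect to the upper limit at
  \<open>t = 0\<close>, gives the mixed derivatives in the two orders.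
\<close>

lemma partial_commute:
  fixes F :: "real ^ 'n::finite \<Rightarrow> 'a::banach"
  assumes F: "cont_diff (Suc (Suc 0)) F"
  shows "partial i (partial j F) = partial j (partial i F)"
proof
  fix x :: "real ^ 'n"
  let ?e = "axis i 1 :: real ^ 'n" and ?f = "axis j 1 :: real ^ 'n"
  have exF: "partial_at_exists l F y" and exP: "partial_at_exists l (partial l' F) y"
    and cP: "continuous_on UNIV (partial l F)" and cPP: "continuous_on UNIV (partial l (partial l' F))" for l l' y
    using F by auto
  have key: "partial i F (x + t *\<^sub>R ?f) - partial i F x
      = integral {0..t} (\<lambda>\<tau>. partial i (partial j F) (x + \<tau> *\<^sub>R ?f))" if t: "0 \<le> t" for t
  proof -
    have ftc: "F (x + s *\<^sub>R ?e + t *\<^sub>R ?f) - F (x + s *\<^sub>R ?e)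
        = integral {0..t} (\<lambda>\<tau>. partial j F (x + s *\<^sub>R ?e + \<tau> *\<^sub>R ?f))" for s
      using fundamental_theorem_of_calculus[OF t partial_has_vector_derivative[OF exF[of j]],
          of "x + s *\<^sub>R ?e"]
      by (simp add: integral_unique)
    have shift: "x + s *\<^sub>R ?e + \<tau> *\<^sub>R ?f = (x + \<tau> *\<^sub>R ?f) + s *\<^sub>R ?e" for s \<tau> by simp
    have lhs: "((\<lambda>s. F (x + s *\<^sub>R ?e + t *\<^sub>R ?f) - F (x + s *\<^sub>R ?e)) has_vector_derivative
         partial i F ((x + t *\<^sub>R ?f) + 0 *\<^sub>R ?e) - partial i F (x + 0 *\<^sub>R ?e)) (at 0 within UNIV)"
      unfolding shift by (intro derivative_intros partial_has_vector_derivative exF)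
    have rhs: "((\<lambda>s. integral (cbox 0 t) (\<lambda>\<tau>. partial j F (x + s *\<^sub>R ?e + \<tau> *\<^sub>R ?f))) has_vector_derivative
         integral (cbox 0 t) (\<lambda>\<tau>. partial i (partial j F) (x + 0 *\<^sub>R ?e + \<tau> *\<^sub>R ?f))) (at 0 within UNIV)"
    proof (rule leibniz_rule_vector_derivative)
      show "((\<lambda>s. partial j F (x + s *\<^sub>R ?e + \<tau> *\<^sub>R ?f)) has_vector_derivative
          partial i (partial j F) (x + s *\<^sub>R ?e + \<tau> *\<^sub>R ?f)) (at s within UNIV)" for s \<tau>
        unfolding shift by (intro partial_has_vector_derivative exP)
      show "(\<lambda>\<tau>. partial j F (x + s *\<^sub>R ?e + \<tau> *\<^sub>R ?f)) integrable_on cbox 0 t" for s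
        by (intro integrable_continuous continuous_on_compose2[OF cP] continuous_intros) auto
      show "continuous_on (UNIV \<times> cbox 0 t) (\<lambda>(s, \<tau>). partial i (partial j F) (x + s *\<^sub>R ?e + \<tau> *\<^sub>R ?f))"
        unfolding split_beta by (intro continuous_on_compose2[OF cPP] continuous_intros) auto
    qed auto
    from rhs lhs show ?thesis
      using vector_derivative_unique_at[of "\<lambda>s. F (x + s *\<^sub>R ?e + t *\<^sub>R ?f) - F (x + s *\<^sub>R ?e)"]
      by (simp add: ftc)
  qed
  have "((\<lambda>t. partial i F (x + t *\<^sub>R ?f) - partial i F x) has_vector_derivative
      partial j (partial i F) (x + 0 *\<^sub>R ?f) - 0) (at 0 within {0..1})"
    by (intro derivative_intros partial_has_vector_derivative exP)
  moreover have "((\<lambda>t. integral {0..t} (\<lambda>\<tau>. partial i (partial j F) (x + \<tau> *\<^sub>R ?f))) has_vector_derivative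
      partial i (partial j F) (x + 0 *\<^sub>R ?f)) (at 0 within {0..1})"
    by (intro integral_has_vector_derivative continuous_on_compose2[OF cPP] continuous_intros) auto
  then have "((\<lambda>t. partial i F (x + t *\<^sub>R ?f) - partial i F x) has_vector_derivative
      partial i (partial j F) (x + 0 *\<^sub>R ?f)) (at 0 within {0..1})"
    by (rule has_vector_derivative_transform[rotated 2]) (use key in auto)
  ultimately have "partial j (partial i F) (x + 0 *\<^sub>R ?f) - 0 = partial i (partial j F) (x + 0 *\<^sub>R ?f)"
    by (intro vector_derivative_unique_within[of 0 "{0..1}"]) (auto simp: trivial_limit_within islimpt_Icc)
  then show "partial i (partial j F) x = partial j (partial i F) x" by simp
qed

lemma foldr_partial_rotate:
  fixes F :: "real ^ 'n::finite \<Rightarrow> 'a::banach"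
  assumes "cont_diff (Suc (length u)) F"
  shows "foldr partial (i # u) F = foldr partial (u @ [i]) F"
  using assms
proof (induction u)
  case (Cons j u)
  have "cont_diff (Suc (Suc 0)) (foldr partial u F)"
    using Cons.prems by (intro cont_diff_foldr_partial) simp
  from partial_commute[OF this]
  have eq: "foldr partial (i # j # u) F = partial j (foldr partial (i # u) F)" by simp
  have "cont_diff (Suc (length u)) F"
    by (rule cont_diff_mono[OF Cons.prems]) simp
  from Cons.IH[OF this] show ?case unfolding eq by simp
qed simp

lemma foldr_partial_mset:
  fixes F :: "real ^ 'n::finite \<Rightarrow> 'a::banach"
  assumes "cont_diff (length u) F" "mset u = mset v"
  shows "foldr partial u F = foldr partial v F"
  using assms
proof (induction u arbitrary: v)
  case (Cons i u)
  have "i \<in> set v" using Cons.prems(2) by (metis list.set_intros(1) mset_eq_setD)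
  then obtain a b where v: "v = a @ i # b" by (meson split_list)
  have m: "mset u = mset (a @ b)" using Cons.prems(2) by (simp add: v)
  then have len: "length u = length a + length b" by (metis length_append size_mset)
  have "foldr partial v F = foldr partial (a @ [i]) (foldr partial b F)" by (simp add: v)
  also have "\<dots> = foldr partial (i # a) (foldr partial b F)"
    using Cons.prems(1) len
    by (intro foldr_partial_rotate[symmetric] cont_diff_foldr_partial) simp
  also have "\<dots> = partial i (foldr partial (a @ b) F)" by simp
  also have "foldr partial (a @ b) F = foldr partial u F"
    using Cons.IH[OF _ m] cont_diff_mono[OF Cons.prems(1)] by simp
  finally show ?case by simp
qed simp

lemma nabla_eq_foldr_partial:
  fixes F :: "real ^ 'n::finite \<Rightarrow> 'a::real_normed_vector"
  shows "nabla \<alpha> F = foldr partial (concat (map (\<lambda>i. replicate (\<alpha> i) i) coords)) F"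
proof -
  have r: "foldr partial (replicate m i) G = (partial i ^^ m) G" for m i and G :: "real ^ 'n \<Rightarrow> 'a"
    by (induction m) auto
  have "foldr (\<lambda>i. partial i ^^ \<alpha> i) L F = foldr partial (concat (map (\<lambda>i. replicate (\<alpha> i) i) L)) F" for L
    by (induction L) (simp_all add: r)
  then show ?thesis by (simp add: nabla_def)
qed

text \<open>
  Differentiating along a line produces the coordinates in every order, whereas \<open>nabla\<close> lists
  them in one fixed order; by symmetry of mixed derivatives only the multiplicities matter.
\<close>

lemma foldr_partial_eq_nabla:
  fixes F :: "real ^ 'n::finite \<Rightarrow> 'a::banach"
  assumes "cont_diff m F" "length u \<le> m"
  shows "foldr partial u F = nabla (count (mset u)) F" "multi_order (count (mset u)) = length u"
proof -
  have c: "distinct (coords :: 'n list)" "set (coords :: 'n list) = UNIV"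
    using someI_ex[OF finite_distinct_list[of "UNIV :: 'n set"]]
    unfolding coords_def by (auto simp: conj_commute)
  have "count (mset (concat (map (\<lambda>i. replicate (\<alpha> i) i) L))) j = (if j \<in> set L then \<alpha> j else 0)"
    if "distinct L" for L and \<alpha> :: "'n \<Rightarrow> nat" and j
    using that by (induction L) auto
  then have "mset u = mset (concat (map (\<lambda>i. replicate (count (mset u) i) i) coords))"
    using c by (intro multiset_eqI) simp
  from foldr_partial_mset[OF cont_diff_mono[OF assms] this]
  show "foldr partial u F = nabla (count (mset u)) F" by (simp add: nabla_eq_foldr_partial)
  have "multi_order (count (mset u)) = (\<Sum>i\<in>set_mset (mset u). count (mset u) i)"
    unfolding multi_order_def by (rule sum.mono_neutral_right) (auto simp: not_in_iff)
  then show "multi_order (count (mset u)) = length u"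
    by (simp only: size_multiset_overloaded_eq[symmetric] size_mset)
qed

text \<open>
  The \<open>j\<close>-th derivative of \<open>F\<close> in direction \<open>w\<close>, expanded into words of coordinates. The expansion
  makes it jointly continuous in \<open>w\<close> and \<open>y\<close> and bounds it by the partial derivatives of \<open>F\<close>.
\<close>

definition dir_deriv :: "nat \<Rightarrow> real ^ 'n::finite \<Rightarrow> (real ^ 'n \<Rightarrow> 'a::real_normed_vector) \<Rightarrow> real ^ 'n \<Rightarrow> 'a" where
  "dir_deriv j w F y = (\<Sum>u | length u = j. prod_list (map (\<lambda>i. w $ i) u) *\<^sub>R foldr partial u F y)"

lemma dir_deriv_0 [simp]: "dir_deriv 0 w F = F"
  by (simp add: dir_deriv_def fun_eq_iff)

lemma dir_deriv_has_vector_derivative: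
  fixes F :: "real ^ 'n::finite \<Rightarrow> 'a::real_normed_vector"
  assumes F: "cont_diff k F" and j: "j < k"
  shows "((\<lambda>s. dir_deriv j w F (x + s *\<^sub>R w)) has_vector_derivative dir_deriv (Suc j) w F (x + s *\<^sub>R w)) (at s within A)"
proof -
  let ?c = "\<lambda>u. prod_list (map (\<lambda>i. w $ i) u)"
  let ?y = "x + s *\<^sub>R w"
  have "((\<lambda>s. dir_deriv j w F (x + s *\<^sub>R w)) has_vector_derivative
     (\<Sum>u | length u = j. ?c u *\<^sub>R (\<Sum>i\<in>UNIV. w $ i *\<^sub>R partial i (foldr partial u F) ?y))) (at s within A)"
    unfolding dir_deriv_def
  proof (rule has_vector_derivative_sum)
    fix u :: "'n list" assume "u \<in> {u. length u = j}"
    then have "cont_diff (Suc 0) (foldr partial u F)"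
      using j by (intro cont_diff_foldr_partial cont_diff_mono[OF F]) auto
    from bounded_linear.has_vector_derivative[OF bounded_linear_scaleR_right cont_diff_Suc_has_vector_derivative[OF this]]
    show "((\<lambda>s. ?c u *\<^sub>R foldr partial u F (x + s *\<^sub>R w)) has_vector_derivative
       ?c u *\<^sub>R (\<Sum>i\<in>UNIV. w $ i *\<^sub>R partial i (foldr partial u F) ?y)) (at s within A)" .
  qed
  also have "(\<Sum>u | length u = j. ?c u *\<^sub>R (\<Sum>i\<in>UNIV. w $ i *\<^sub>R partial i (foldr partial u F) ?y))
     = (\<Sum>(u, i)\<in>{u. length u = j} \<times> UNIV. ?c (i # u) *\<^sub>R foldr partial (i # u) F ?y)"
    by (simp add: scaleR_sum_right sum.cartesian_product mult.commute)
  also have "\<dots> = dir_deriv (Suc j) w F ?y"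
    unfolding dir_deriv_def
    by (rule sum.reindex_bij_witness[of _ "\<lambda>u. (tl u, hd u)" "\<lambda>(u, i). i # u"])
       (auto simp: length_Suc_conv)
  finally show ?thesis .
qed

lemma continuous_on_dir_deriv:
  fixes F :: "real ^ 'n::finite \<Rightarrow> 'a::real_normed_vector"
  assumes F: "cont_diff k F" and j: "j \<le> k" and f: "continuous_on A f" and g: "continuous_on A g"
  shows "continuous_on A (\<lambda>z. dir_deriv j (f z) F (g z))"
proof -
  have p: "continuous_on A (\<lambda>z. prod_list (map (\<lambda>i. f z $ i) u))" for u
    by (induction u) (auto intro!: continuous_intros f)
  have d: "continuous_on A (\<lambda>z. foldr partial u F (g z))" if "length u = j" for u
  proof -
    have "cont_diff 0 (foldr partial u F)"
      using j that by (intro cont_diff_foldr_partial cont_diff_mono[OF F]) auto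
    from continuous_on_compose2[OF cont_diff_imp_continuous[OF this] g] show ?thesis by auto
  qed
  show ?thesis unfolding dir_deriv_def
    by (intro continuous_intros p d) auto
qed

lemma norm_dir_deriv_le:
  fixes F :: "real ^ 'n::finite \<Rightarrow> 'a::real_normed_vector"
  assumes "norm w \<le> 1"
  shows "norm (dir_deriv j w F y) \<le> (\<Sum>u | length u = j. norm (foldr partial u F y))"
  unfolding dir_deriv_def
proof (rule sum_norm_le)
  fix u :: "'n list"
  have "\<bar>prod_list (map (\<lambda>i. w $ i) u)\<bar> \<le> 1"
  proof (induction u)
    case (Cons i u)
    have "\<bar>w $ i\<bar> \<le> 1" using component_le_norm_cart[of w i] assms by simp
    then show ?case using Cons by (simp add: abs_mult mult_le_one)
  qed simp
  then show "norm (prod_list (map (\<lambda>i. w $ i) u) *\<^sub>R foldr partial u F y) \<le> norm (foldr partial u F y)"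
    by (simp add: mult_left_le_one_le)
qed

section \<open>Repeated integration by parts along a ray\<close>

text \<open>
  One integration by parts lowers the order \<open>Suc p\<close> of the kernel by one. The boundary term
  \<open>s ^ (2 * p + 1) * slice_cos p (R * s)\<close> times \<open>V s\<close> vanishes at 0 because of the positive power
  of \<open>s\<close> and at \<open>T\<close> because \<open>V\<close> does.
\<close>

lemma integral_slice_cos_by_parts:
  fixes V :: "real \<Rightarrow> 'a::banach"
  assumes V: "\<And>s. s \<in> {0..T} \<Longrightarrow> (V has_vector_derivative V' s) (at s within {0..T})"
    and W: "\<And>s. s \<in> {0..T} \<Longrightarrow> W s = (2 * real p + 1) *\<^sub>R V s + s *\<^sub>R V' s"
    and W_cont: "continuous_on {0..T} W" and VT: "V T = 0" and T: "0 \<le> T" and R: "R > 0"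
  shows "integral {0..T} (\<lambda>s. (s ^ (2 * Suc p) * slice_cos (Suc p) (R * s)) *\<^sub>R V s)
    = (2 * real (Suc p) / R\<^sup>2) *\<^sub>R integral {0..T} (\<lambda>s. (s ^ (2 * p) * slice_cos p (R * s)) *\<^sub>R W s)"
proof -
  let ?H = "\<lambda>s. (s ^ (2 * p + 1) * slice_cos p (R * s)) *\<^sub>R V s"
  let ?c = "R\<^sup>2 / (2 * real (Suc p))"
  let ?A = "\<lambda>s. (s ^ (2 * p) * slice_cos p (R * s)) *\<^sub>R W s"
  let ?B = "\<lambda>s. (s ^ (2 * Suc p) * slice_cos (Suc p) (R * s)) *\<^sub>R V s"
  have V_cont: "continuous_on {0..T} V"
    using V by (meson continuous_on_eq_continuous_within has_vector_derivative_continuous)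
  have "((\<lambda>s. ?A s - ?c *\<^sub>R ?B s) has_integral ?H T - ?H 0) {0..T}"
  proof (rule fundamental_theorem_of_calculus[OF T])
    fix s assume s: "s \<in> {0..T}"
    let ?a' = "real (2 * p + 1) * s ^ (2 * p) * slice_cos p (R * s)
        + s ^ (2 * p + 1) * (- (R * s / (2 * (real p + 1))) * slice_cos (Suc p) (R * s) * R)"
    have sc: "((\<lambda>s. slice_cos p (R * s)) has_real_derivative - (R * s / (2 * (real p + 1))) * slice_cos (Suc p) (R * s) * R)
        (at s within {0..T})"
    proof -
      have "((\<lambda>s. R * s) has_real_derivative R) (at s within {0..T})"
        by (auto intro!: derivative_eq_intros)
      from DERIV_chain2[OF has_real_derivative_slice_cos this] show ?thesis .
    qed
    have "((\<lambda>s. s ^ (2 * p + 1) * slice_cos p (R * s)) has_real_derivative ?a') (at s within {0..T})"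
      by (rule DERIV_cong[OF DERIV_mult[OF DERIV_power[OF DERIV_ident] sc]]) simp
    then have "(?H has_vector_derivative (s ^ (2 * p + 1) * slice_cos p (R * s)) *\<^sub>R V' s + ?a' *\<^sub>R V s)
        (at s within {0..T})"
      by (rule has_vector_derivative_scaleR[OF _ V[OF s]])
    also have "(s ^ (2 * p + 1) * slice_cos p (R * s)) *\<^sub>R V' s + ?a' *\<^sub>R V s = ?A s - ?c *\<^sub>R ?B s"
    proof -
      have "?a' = (2 * real p + 1) * (s ^ (2 * p) * slice_cos p (R * s))
          - ?c * (s ^ (2 * Suc p) * slice_cos (Suc p) (R * s))"
        by (simp add: field_simps power2_eq_square)
      then show ?thesis unfolding W[OF s] by (simp add: algebra_simps)
    qed
    finally show "(?H has_vector_derivative ?A s - ?c *\<^sub>R ?B s) (at s within {0..T})" .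
  qed
  then have "integral {0..T} (\<lambda>s. ?A s - ?c *\<^sub>R ?B s) = 0"
    by (simp add: integral_unique VT)
  moreover have "integral {0..T} (\<lambda>s. ?A s - ?c *\<^sub>R ?B s) = integral {0..T} ?A - ?c *\<^sub>R integral {0..T} ?B"
    by (subst Henstock_Kurzweil_Integration.integral_diff)
       (auto intro!: integrable_continuous_real continuous_intros V_cont W_cont simp del: scaleR_scaleR)
  ultimately have "integral {0..T} ?A = ?c *\<^sub>R integral {0..T} ?B" by simp
  then have "(1 / ?c) *\<^sub>R integral {0..T} ?A = ((1 / ?c) * ?c) *\<^sub>R integral {0..T} ?B" by simp
  also have "(1 / ?c) * ?c = 1" using R by simp
  finally show ?thesis by (simp del: of_nat_Suc)
qed

text \<open>
  The effect of \<open>m\<close> integrations by parts on \<open>(1 - s / T) ^ k *\<^sub>R u s\<close> is a sum over \<open>j\<close> of \<open>j\<close>-th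
  derivatives of \<open>u\<close> with coefficients \<open>s ^ j * r (s / T)\<close>, where \<open>r = radial_poly k m j\<close>. The recursion
  is the operator that maps \<open>V\<close> to \<open>(2 * (k - m) - 1) *\<^sub>R V + s *\<^sub>R V'\<close>, read off on such coefficients. As
  the cut-off enters through \<open>s / T\<close> only, all bounds are uniform in \<open>T\<close>.
\<close>

fun radial_poly :: "nat \<Rightarrow> nat \<Rightarrow> nat \<Rightarrow> real poly" where
  "radial_poly k 0 j = (if j = 0 then [:1, - 1:] ^ k else 0)"
| "radial_poly k (Suc m) j = smult (2 * real (k - m) - 1 + real j) (radial_poly k m j)
     + pCons 0 (pderiv (radial_poly k m j)) + (if j = 0 then 0 else radial_poly k m (j - 1))"

lemma radial_poly_eq_0: "m < j \<Longrightarrow> radial_poly k m j = 0"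
  by (induction m arbitrary: j) auto

lemma power_dvd_pderiv:
  fixes q :: "real poly"
  assumes "q ^ Suc l dvd p"
  shows "q ^ l dvd pderiv p"
proof -
  obtain r where r: "p = q ^ Suc l * r" using assms by (rule dvdE)
  have "q ^ l dvd q ^ Suc l * pderiv r" by simp
  moreover have "q ^ l dvd r * (smult (of_nat (Suc l)) (q ^ l) * pderiv q)"
    by (intro dvd_mult dvd_mult2 dvd_smult dvd_refl)
  ultimately show ?thesis unfolding r pderiv_mult pderiv_power_Suc by (rule dvd_add)
qed

lemma radial_poly_dvd_step:
  fixes q :: "real poly"
  assumes "\<And>j. q ^ Suc l dvd radial_poly k m j"
  shows "q ^ l dvd radial_poly k (Suc m) j"
proof -
  have 1: "q ^ l dvd radial_poly k m j" for j
    by (rule dvd_trans[OF le_imp_power_dvd assms]) simp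
  have "q ^ l dvd pCons 0 (pderiv (radial_poly k m j))"
    using dvd_mult[OF power_dvd_pderiv[OF assms], of "[:0, 1:]" j] by simp
  moreover have "q ^ l dvd (if j = 0 then 0 else radial_poly k m (j - 1))"
    using 1 by (simp split: if_split)
  ultimately show ?thesis
    unfolding radial_poly.simps(2) by (intro dvd_add dvd_smult[OF 1])
qed

text \<open>
  Each integration by parts costs one order of vanishing at \<open>s = T\<close>, so the cut-off of order \<open>k\<close>
  kills the boundary terms of exactly \<open>k\<close> steps.
\<close>

lemma radial_poly_dvd: "m \<le> k \<Longrightarrow> [:1, - 1:] ^ (k - m) dvd radial_poly k m j"
proof (induction m arbitrary: j)
  case 0
  then show ?case by (cases "j = 0") simp_all
next
  case (Suc m)
  have "[:1, - 1:] ^ Suc (k - Suc m) dvd radial_poly k m j" for j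
  proof -
    have "m \<le> k" and e: "Suc (k - Suc m) = k - m" using Suc.prems by simp_all
    from Suc.IH[OF this(1), of j] show ?thesis unfolding e .
  qed
  then show ?case by (rule radial_poly_dvd_step)
qed

lemma poly_radial_poly_1: "m < k \<Longrightarrow> poly (radial_poly k m j) 1 = 0"
  using radial_poly_dvd[of m k j] by (auto elim!: dvdE simp: poly_power)

lemma poly_radial_poly_0: "poly (radial_poly k m 0) 0 = (\<Prod>i<m. 2 * real (k - i) - 1)"
  by (induction m) (auto simp: poly_power mult.commute)

definition radial_sum :: "nat \<Rightarrow> nat \<Rightarrow> real \<Rightarrow> (nat \<Rightarrow> real \<Rightarrow> 'a::real_vector) \<Rightarrow> real \<Rightarrow> 'a" where
  "radial_sum k m T d s = (\<Sum>j\<le>m. (s ^ j * poly (radial_poly k m j) (s / T)) *\<^sub>R d j s)"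

lemma radial_sum_step:
  fixes d :: "nat \<Rightarrow> real \<Rightarrow> 'a::real_normed_vector"
  assumes d: "\<And>j. j \<le> m \<Longrightarrow> (d j has_vector_derivative d (Suc j) s) (at s within A)" and T: "T > 0"
  obtains D where "(radial_sum k m T d has_vector_derivative D) (at s within A)"
    "radial_sum k (Suc m) T d s = (2 * real (k - m) - 1) *\<^sub>R radial_sum k m T d s + s *\<^sub>R D"
proof -
  let ?r = "radial_poly k m"
  let ?a = "\<lambda>j s. s ^ j * poly (?r j) (s / T)"
  let ?a' = "\<lambda>j. real j * s ^ (j - 1) * poly (?r j) (s / T) + s ^ j * (poly (pderiv (?r j)) (s / T) * (1 / T))"
  define D where "D = (\<Sum>j\<le>m. ?a j s *\<^sub>R d (Suc j) s + ?a' j *\<^sub>R d j s)"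
  have "(radial_sum k m T d has_vector_derivative D) (at s within A)"
    unfolding radial_sum_def[abs_def] D_def
  proof (rule has_vector_derivative_sum)
    fix j assume j: "j \<in> {..m}"
    have "((\<lambda>s. poly (?r j) (s / T)) has_real_derivative poly (pderiv (?r j)) (s / T) * (1 / T)) (at s within A)"
      by (rule DERIV_chain2[OF poly_DERIV]) (use T in \<open>auto intro!: derivative_eq_intros\<close>)
    from DERIV_mult[OF DERIV_power[OF DERIV_ident] this]
    have "(?a j has_real_derivative ?a' j) (at s within A)"
      by (rule DERIV_cong) simp
    then show "((\<lambda>s. ?a j s *\<^sub>R d j s) has_vector_derivative ?a j s *\<^sub>R d (Suc j) s + ?a' j *\<^sub>R d j s) (at s within A)"
      using d[of j] j by (intro has_vector_derivative_scaleR) auto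
  qed
  moreover have "radial_sum k (Suc m) T d s = (2 * real (k - m) - 1) *\<^sub>R radial_sum k m T d s + s *\<^sub>R D"
  proof -
    let ?c = "2 * real (k - m) - 1"
    let ?b = "\<lambda>j. s ^ j * ((?c + real j) * poly (?r j) (s / T) + (s / T) * poly (pderiv (?r j)) (s / T))"
    let ?e = "\<lambda>j. (s ^ j * (if j = 0 then 0 else poly (?r (j - 1)) (s / T))) *\<^sub>R d j s"
    have "radial_sum k (Suc m) T d s = (\<Sum>j\<le>Suc m. ?b j *\<^sub>R d j s + ?e j)"
      unfolding radial_sum_def by (intro sum.cong refl) (simp add: algebra_simps)
    also have "\<dots> = (\<Sum>j\<le>Suc m. ?b j *\<^sub>R d j s) + (\<Sum>j\<le>Suc m. ?e j)" by (rule sum.distrib)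
    also have "(\<Sum>j\<le>Suc m. ?b j *\<^sub>R d j s) = (\<Sum>j\<le>m. ?b j *\<^sub>R d j s)"
      by (simp add: radial_poly_eq_0)
    also have "(\<Sum>j\<le>Suc m. ?e j) = (\<Sum>j\<le>m. s *\<^sub>R (?a j s *\<^sub>R d (Suc j) s))"
      by (subst sum.atMost_Suc_shift) (simp add: mult.assoc)
    finally have lhs: "radial_sum k (Suc m) T d s
      = (\<Sum>j\<le>m. ?b j *\<^sub>R d j s + s *\<^sub>R (?a j s *\<^sub>R d (Suc j) s))" by (simp only: sum.distrib)
    have gen: "c *\<^sub>R (a *\<^sub>R u) + s *\<^sub>R (a *\<^sub>R v + a' *\<^sub>R u) = (c * a + s * a') *\<^sub>R u + s *\<^sub>R (a *\<^sub>R v)"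
      for c a a' :: real and u v :: 'a
      by (simp add: algebra_simps)
    have "?c *\<^sub>R radial_sum k m T d s + s *\<^sub>R D
       = (\<Sum>j\<le>m. ?c *\<^sub>R (?a j s *\<^sub>R d j s) + s *\<^sub>R (?a j s *\<^sub>R d (Suc j) s + ?a' j *\<^sub>R d j s))"
      unfolding radial_sum_def D_def by (simp only: scaleR_sum_right sum.distrib[symmetric])
    also have "\<dots> = (\<Sum>j\<le>m. ?b j *\<^sub>R d j s + s *\<^sub>R (?a j s *\<^sub>R d (Suc j) s))"
    proof (rule sum.cong[OF refl])
      fix j
      have "s * (real j * s ^ (j - 1)) = real j * s ^ j" by (cases j) auto
      moreover have "s * ?a' j = (s * (real j * s ^ (j - 1))) * poly (?r j) (s / T)
          + s ^ j * ((s / T) * poly (pderiv (?r j)) (s / T))"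
        by (simp add: distrib_left mult_ac)
      ultimately have "s * ?a' j = real j * s ^ j * poly (?r j) (s / T)
          + s ^ j * ((s / T) * poly (pderiv (?r j)) (s / T))"
        by (simp only:)
      then have "?c * ?a j s + s * ?a' j = ?b j" by (simp add: algebra_simps)
      then show "?c *\<^sub>R (?a j s *\<^sub>R d j s) + s *\<^sub>R (?a j s *\<^sub>R d (Suc j) s + ?a' j *\<^sub>R d j s)
         = ?b j *\<^sub>R d j s + s *\<^sub>R (?a j s *\<^sub>R d (Suc j) s)"
        by (simp only: gen)
    qed
    finally show ?thesis using lhs by simp
  qed
  ultimately show ?thesis using that by blast
qed

lemma continuous_on_radial_sum:
  fixes d :: "nat \<Rightarrow> real \<Rightarrow> 'a::real_normed_vector"
  assumes "\<And>j. j \<le> m \<Longrightarrow> continuous_on A (d j)" "T > 0"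
  shows "continuous_on A (radial_sum k m T d)"
  unfolding radial_sum_def[abs_def] using assms by (intro continuous_intros) auto

text \<open>
  All \<open>k\<close> radial derivatives have been moved from the kernel to the function; what is left of the
  kernel is \<open>slice_cos 0 (R * s)\<close>, that is, \<open>2 * sin (R * s) / (R * s)\<close>.
\<close>

lemma integral_slice_cos_iterated_by_parts:
  fixes d :: "nat \<Rightarrow> real \<Rightarrow> 'a::banach"
  assumes d: "\<And>j s. j < k \<Longrightarrow> s \<in> {0..T} \<Longrightarrow> (d j has_vector_derivative d (Suc j) s) (at s within {0..T})"
    and dk: "continuous_on {0..T} (d k)" and T: "T > 0" and R: "R > 0"
  shows "integral {0..T} (\<lambda>s. (s ^ (2 * k) * slice_cos k (R * s) * (1 - s / T) ^ k) *\<^sub>R d 0 s)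
    = (2 ^ k * fact k / R ^ (2 * k)) *\<^sub>R integral {0..T} (\<lambda>s. slice_cos 0 (R * s) *\<^sub>R radial_sum k k T d s)"
proof -
  have d_cont: "continuous_on {0..T} (d j)" if "j \<le> k" for j
  proof (cases "j = k")
    case False
    then show ?thesis using d[of j] that
      by (meson continuous_on_eq_continuous_within has_vector_derivative_continuous le_neq_implies_less)
  qed (use dk in simp)
  let ?I = "\<lambda>m. integral {0..T} (\<lambda>s. (s ^ (2 * (k - m)) * slice_cos (k - m) (R * s)) *\<^sub>R radial_sum k m T d s)"
  have iter: "?I 0 = (\<Prod>i<m. 2 * real (k - i) / R\<^sup>2) *\<^sub>R ?I m" if "m \<le> k" for m
    using that
  proof (induction m)
    case (Suc m)
    then have m: "m < k" by simp
    define p where "p = k - Suc m"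
    have km: "k - m = Suc p" using m by (simp add: p_def)
    have "\<exists>D. (radial_sum k m T d has_vector_derivative D) (at s within {0..T}) \<and>
       radial_sum k (Suc m) T d s = (2 * real (k - m) - 1) *\<^sub>R radial_sum k m T d s + s *\<^sub>R D"
      if s: "s \<in> {0..T}" for s
    proof -
      have "(d j has_vector_derivative d (Suc j) s) (at s within {0..T})" if "j \<le> m" for j
        using d[of j s] that m s by simp
      from radial_sum_step[where d = d and m = m and k = k and s = s and A = "{0..T}", OF this T] show ?thesis by blast
    qed
    then obtain D where D: "\<And>s. s \<in> {0..T} \<Longrightarrow> (radial_sum k m T d has_vector_derivative D s) (at s within {0..T})"
      "\<And>s. s \<in> {0..T} \<Longrightarrow>
         radial_sum k (Suc m) T d s = (2 * real (k - m) - 1) *\<^sub>R radial_sum k m T d s + s *\<^sub>R D s"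
      by metis
    have "?I m = (2 * real (k - m) / R\<^sup>2) *\<^sub>R ?I (Suc m)"
      unfolding km p_def[symmetric]
    proof (rule integral_slice_cos_by_parts[OF D(1)])
      show "radial_sum k (Suc m) T d s = (2 * real p + 1) *\<^sub>R radial_sum k m T d s + s *\<^sub>R D s" if "s \<in> {0..T}" for s
        using D(2)[OF that] km by simp
      show "continuous_on {0..T} (radial_sum k (Suc m) T d)"
        using Suc.prems T by (intro continuous_on_radial_sum d_cont) auto
      show "radial_sum k m T d T = 0"
        using T m by (simp add: radial_sum_def poly_radial_poly_1)
    qed (use T R in auto)
    then show ?case using Suc.IH m by simp
  qed simp
  have "(\<Prod>i<k. 2 * real (k - i) / R\<^sup>2) = (\<Prod>i<k. (2 / R\<^sup>2) * real (k - i))"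
    by (intro prod.cong) auto
  also have "\<dots> = (\<Prod>i<k. 2 / R\<^sup>2) * (\<Prod>i<k. real (k - i))"
    by (rule prod.distrib)
  also have "(\<Prod>i<k. real (k - i)) = fact k"
    by (simp add: fact_prod_rev atLeast0LessThan)
  also have "(\<Prod>i<k. 2 / R\<^sup>2) = 2 ^ k / R ^ (2 * k)"
    by (simp add: power_divide power_mult)
  finally have "(\<Prod>i<k. 2 * real (k - i) / R\<^sup>2) = 2 ^ k * fact k / R ^ (2 * k)" by simp
  moreover have "?I 0 = integral {0..T} (\<lambda>s. (s ^ (2 * k) * slice_cos k (R * s) * (1 - s / T) ^ k) *\<^sub>R d 0 s)"
    by (simp add: radial_sum_def poly_power)
  ultimately show ?thesis using iter[of k] by simp
qed

section \<open>Dirichlet integrals along a ray\<close>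

lemma norm_integral_sin_short:
  fixes g :: "real \<Rightarrow> 'a::banach"
  assumes g: "continuous_on {a..a + h} g" and h: "0 \<le> h" and R: "R > 0"
    and M: "norm (g a) \<le> M" and \<eta>: "\<And>s. s \<in> {a..a + h} \<Longrightarrow> norm (g s - g a) \<le> \<eta>"
  shows "norm (integral {a..a + h} (\<lambda>s. sin (R * s) *\<^sub>R g s)) \<le> 2 * M / R + \<eta> * h"
proof -
  have sin_int: "((\<lambda>s. sin (R * s)) has_integral (- cos (R * (a + h)) / R - - cos (R * a) / R)) {a..a + h}"
    using h R
    by (intro fundamental_theorem_of_calculus)
       (auto intro!: derivative_eq_intros simp flip: has_real_derivative_iff_has_vector_derivative)
  have i1: "((\<lambda>s. sin (R * s) *\<^sub>R g a) has_integral ((cos (R * a) - cos (R * (a + h))) / R) *\<^sub>R g a) {a..a + h}"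
    using has_integral_scaleR_left[OF sin_int, of "g a"] by (simp add: diff_divide_distrib)
  have i2: "(\<lambda>s. sin (R * s) *\<^sub>R (g s - g a)) integrable_on {a..a + h}"
    by (intro integrable_continuous_real continuous_intros g)
  have "integral {a..a + h} (\<lambda>s. sin (R * s) *\<^sub>R g s)
      = integral {a..a + h} (\<lambda>s. sin (R * s) *\<^sub>R g a + sin (R * s) *\<^sub>R (g s - g a))"
    by (simp flip: scaleR_add_right)
  also have "\<dots> = ((cos (R * a) - cos (R * (a + h))) / R) *\<^sub>R g a
      + integral {a..a + h} (\<lambda>s. sin (R * s) *\<^sub>R (g s - g a))"
    using i1 i2 by (subst Henstock_Kurzweil_Integration.integral_add) (auto simp: integral_unique)
  also have "norm \<dots> \<le> 2 * M / R + \<eta> * h"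
  proof (rule norm_triangle_mono)
    have "\<bar>cos (R * a) - cos (R * (a + h))\<bar> \<le> 2"
      using abs_cos_le_one[of "R * a"] abs_cos_le_one[of "R * (a + h)"] by linarith
    then have "\<bar>cos (R * a) - cos (R * (a + h))\<bar> / R * norm (g a) \<le> 2 / R * M"
      using R M by (intro mult_mono divide_right_mono) auto
    then show "norm (((cos (R * a) - cos (R * (a + h))) / R) *\<^sub>R g a) \<le> 2 * M / R"
      using R by simp
    have "0 \<le> \<eta>" using \<eta>[of a] h by simp
    then have "norm (integral (cbox a (a + h)) (\<lambda>s. sin (R * s) *\<^sub>R (g s - g a)))
        \<le> \<eta> * measure lborel (cbox a (a + h))"
    proof (rule integrable_bound)
      fix s assume "s \<in> cbox a (a + h)"
      then have "norm (g s - g a) \<le> \<eta>" using \<eta> by simp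
      moreover have "\<bar>sin (R * s)\<bar> * norm (g s - g a) \<le> 1 * norm (g s - g a)"
        by (intro mult_right_mono) auto
      ultimately show "norm (sin (R * s) *\<^sub>R (g s - g a)) \<le> \<eta>" by simp
    qed (use i2 in simp)
    then show "norm (integral {a..a + h} (\<lambda>s. sin (R * s) *\<^sub>R (g s - g a))) \<le> \<eta> * h"
      using h by simp
  qed
  finally show ?thesis .
qed

text \<open>
  Joint continuity on a compact set gives one modulus of continuity for the whole family. On
  \<open>N\<close> intervals so short that every member is constant up to \<open>\<eta>\<close>, the constant part contributes
  \<open>O(1 / R)\<close> per interval by oscillation, and the rest at most \<open>\<eta>\<close> times the length.
\<close>

lemma uniform_riemann_lebesgue:
  fixes f :: "'p::metric_space \<Rightarrow> real \<Rightarrow> 'a::banach"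
  assumes P: "compact P" and f: "continuous_on (P \<times> {0..b}) (\<lambda>(p, s). f p s)" and b: "0 < b"
    and \<epsilon>: "\<epsilon> > 0"
  obtains R0 where "R0 > 0"
    "\<And>R p. R \<ge> R0 \<Longrightarrow> p \<in> P \<Longrightarrow> norm (integral {0..b} (\<lambda>s. sin (R * s) *\<^sub>R f p s)) \<le> \<epsilon>"
proof -
  have PB: "compact (P \<times> {0..b})" using P by (intro compact_Times) auto
  define \<eta> where "\<eta> = \<epsilon> / (2 * b)"
  have \<eta>: "\<eta> > 0" using \<epsilon> b by (simp add: \<eta>_def)
  obtain \<delta> where \<delta>: "\<delta> > 0" "\<And>z z'. z \<in> P \<times> {0..b} \<Longrightarrow> z' \<in> P \<times> {0..b} \<Longrightarrow> dist z' z < \<delta> \<Longrightarrow>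
      dist (case z' of (p, s) \<Rightarrow> f p s) (case z of (p, s) \<Rightarrow> f p s) < \<eta>"
    using uniformly_continuous_onE[OF compact_uniformly_continuous[OF f PB] \<eta>] by metis
  have "compact ((\<lambda>(p, s). f p s) ` (P \<times> {0..b}))" by (rule compact_continuous_image[OF f PB])
  then obtain M where M: "M > 0" "\<And>p s. p \<in> P \<Longrightarrow> s \<in> {0..b} \<Longrightarrow> norm (f p s) \<le> M"
    by (force dest!: compact_imp_bounded simp: bounded_pos)
  obtain N :: nat where N: "b / \<delta> < real N" using reals_Archimedean2 by blast
  have "0 < b / \<delta>" using b \<delta> by simp
  then have N0: "N > 0" using N by (cases N) auto
  define h where "h = b / real N"
  have h: "0 < h" "h < \<delta>" "real N * h = b"
    using b N N0 \<delta>(1) by (auto simp: h_def field_simps)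
  show ?thesis
  proof (rule that[of "real N * (2 * M) * 2 / \<epsilon>"])
    show "real N * (2 * M) * 2 / \<epsilon> > 0" using N0 M \<epsilon> by simp
    fix R p assume R: "R \<ge> real N * (2 * M) * 2 / \<epsilon>" and p: "p \<in> P"
    then have R0: "R > 0" using N0 M(1) \<epsilon> by (metis divide_pos_pos less_le_trans mult_pos_pos of_nat_0_less_iff zero_less_numeral)
    let ?g = "\<lambda>s. sin (R * s) *\<^sub>R f p s"
    have fp: "continuous_on {0..b} (f p)"
      using continuous_on_compose2[OF f continuous_on_Pair[OF continuous_on_const continuous_on_id], of p "{0..b}"] p
      by (simp add: image_subset_iff)
    have "norm (integral {0..real m * h} ?g) \<le> real m * (2 * M / R + \<eta> * h)" if "m \<le> N" for m
      using that
    proof (induction m)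
      case (Suc m)
      have le: "real (Suc m) * h \<le> b"
        using Suc.prems h by (metis mult_right_mono of_nat_le_iff less_imp_le)
      have eq: "real (Suc m) * h = real m * h + h" by (simp add: algebra_simps)
      have mh: "0 \<le> real m * h" using h by simp
      have sub: "{real m * h..real m * h + h} \<subseteq> {0..b}" using le eq mh by auto
      have "integral {0..real (Suc m) * h} ?g = integral {0..real m * h} ?g + integral {real m * h..real m * h + h} ?g"
      proof -
        have "?g integrable_on {0..real (Suc m) * h}"
          using le by (intro integrable_continuous_real continuous_intros continuous_on_subset[OF fp]) auto
        then show ?thesis unfolding eq using mh h by (intro Henstock_Kurzweil_Integration.integral_combine[symmetric]) auto
      qed
      also have "norm \<dots> \<le> real m * (2 * M / R + \<eta> * h) + (2 * M / R + \<eta> * h)"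
      proof (rule norm_triangle_mono)
        show "norm (integral {real m * h..real m * h + h} ?g) \<le> 2 * M / R + \<eta> * h"
        proof (rule norm_integral_sin_short)
          show "continuous_on {real m * h..real m * h + h} (f p)" by (rule continuous_on_subset[OF fp sub])
          have m_in: "real m * h \<in> {0..b}" using le eq mh h by auto
          then show "norm (f p (real m * h)) \<le> M" using M(2)[OF p] by blast
          fix s assume s: "s \<in> {real m * h..real m * h + h}"
          then have "dist (p, s) (p, real m * h) < \<delta>" using h by (simp add: dist_Pair_Pair dist_real_def)
          moreover have "0 \<le> s" using order_trans[OF mh] s by auto
          ultimately show "norm (f p s - f p (real m * h)) \<le> \<eta>"
            using \<delta>(2)[of "(p, real m * h)" "(p, s)"] s sub m_in p mh by (auto simp: dist_norm)
        qed (use h R0 in auto)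
      qed (use Suc in auto)
      finally show ?case by (simp add: algebra_simps add_divide_distrib)
    qed simp
    from this[of N] have "norm (integral {0..b} ?g) \<le> real N * (2 * M) / R + \<eta> * b"
      using h by (simp add: algebra_simps)
    also have "\<dots> \<le> \<epsilon> / 2 + \<epsilon> / 2"
      using R R0 \<epsilon> b by (intro add_mono) (auto simp: \<eta>_def field_simps)
    finally show "norm (integral {0..b} ?g) \<le> \<epsilon>" by simp
  qed
qed

lemma slice_cos_0_eq_sinc: "slice_cos 0 r = 2 * sinc r"
proof (cases "r = 0")
  case True
  then show ?thesis by (simp add: slice_cos_def)
next
  case False
  then show ?thesis using slice_cos_0[of r] by (simp add: field_simps)
qed

lemma integral_slice_cos_0:
  assumes b: "0 \<le> b"
  shows "integral {0..b} (\<lambda>s. R / 2 * slice_cos 0 (R * s)) = Si (R * b)"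
proof -
  have "((\<lambda>s. sinc (R * s) * R) has_integral Si (R * b) - Si (R * 0)) {0..b}"
  proof (rule fundamental_theorem_of_calculus[OF b])
    fix s
    have "((\<lambda>s. R * s) has_real_derivative R) (at s within {0..b})" by (auto intro!: derivative_eq_intros)
    from DERIV_chain2[OF DERIV_Si this]
    show "((\<lambda>s. Si (R * s)) has_vector_derivative sinc (R * s) * R) (at s within {0..b})"
      by (simp only: has_real_derivative_iff_has_vector_derivative)
  qed
  moreover have "Si (R * 0) = 0" by (simp add: Si_def zero_ereal_def)
  moreover have "(\<lambda>s. sinc (R * s) * R) = (\<lambda>s. R / 2 * slice_cos 0 (R * s))"
    by (simp add: slice_cos_0_eq_sinc fun_eq_iff)
  ultimately have "((\<lambda>s. R / 2 * slice_cos 0 (R * s)) has_integral Si (R * b)) {0..b}"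
    by (simp only: diff_0_right)
  then show ?thesis by (rule integral_unique)
qed

text \<open>
  The difference quotient at 0 of \<open>radial_sum\<close> along the ray from \<open>x\<close> in direction \<open>w\<close>, with
  \<open>\<kappa> = 1 / T\<close>, written without a division: \<open>(F (x + s *\<^sub>R w) - F x) / s\<close> becomes an average of first
  derivatives, which is where \<open>k \<ge> 1\<close> enters. It is thus continuous up to \<open>s = 0\<close> and \<open>\<kappa> = 0\<close>, and the
  parameters range over a compact set.
\<close>

definition dini_quotient :: "nat \<Rightarrow> (real ^ 'n::finite \<Rightarrow> 'a::banach) \<Rightarrow>
    (real ^ 'n) \<times> (real ^ 'n) \<times> real \<Rightarrow> real \<Rightarrow> 'a" where
  "dini_quotient k F = (\<lambda>(x, w, \<kappa>) s.
     (\<Sum>j<k. (s ^ j * poly (radial_poly k k (Suc j)) (s * \<kappa>)) *\<^sub>R dir_deriv (Suc j) w F (x + s *\<^sub>R w))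
     + poly (radial_poly k k 0) (s * \<kappa>) *\<^sub>R integral {0..1} (\<lambda>\<tau>. dir_deriv (Suc 0) w F (x + (\<tau> * s) *\<^sub>R w))
     + (\<kappa> * poly (synthetic_div (radial_poly k k 0) 0) (s * \<kappa>)) *\<^sub>R F x)"

lemma continuous_on_dini_quotient:
  fixes F :: "real ^ 'n::finite \<Rightarrow> 'a::banach"
  assumes F: "cont_diff k F" and k: "1 \<le> k"
  shows "continuous_on (A \<times> B) (\<lambda>(p, s). dini_quotient k F p s)"
proof -
  have int: "continuous_on (A \<times> B) (\<lambda>z. integral {0..1}
      (\<lambda>\<tau>. dir_deriv (Suc 0) (fst (snd (fst z))) F (fst (fst z) + (\<tau> * snd z) *\<^sub>R fst (snd (fst z)))))"
    using k unfolding interval_cbox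
    by (intro integral_continuous_on_param)
       (auto simp: split_beta intro!: continuous_on_dir_deriv[OF F] continuous_intros)
  have F_cont: "continuous_on (A \<times> B) (\<lambda>z. F (fst (fst z)))"
    by (rule continuous_on_compose2[OF cont_diff_imp_continuous[OF F]]) (auto intro!: continuous_intros)
  show ?thesis
    unfolding dini_quotient_def split_beta
    by (intro continuous_intros int F_cont continuous_on_dir_deriv[OF F]) auto
qed

lemma radial_sum_eq_dini_quotient:
  fixes F :: "real ^ 'n::finite \<Rightarrow> 'a::banach"
  assumes F: "cont_diff k F" and k: "1 \<le> k"
  shows "radial_sum k k T (\<lambda>j s. dir_deriv j w F (x + s *\<^sub>R w)) s
    = poly (radial_poly k k 0) 0 *\<^sub>R F x + s *\<^sub>R dini_quotient k F (x, w, 1 / T) s"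
proof -
  let ?r = "radial_poly k k"
  let ?D = "\<lambda>j s. dir_deriv j w F (x + s *\<^sub>R w)"
  have "((\<lambda>\<tau>. s *\<^sub>R ?D (Suc 0) (\<tau> * s)) has_integral F (x + (1 * s) *\<^sub>R w) - F (x + (0 * s) *\<^sub>R w)) {0..1}"
  proof (rule fundamental_theorem_of_calculus)
    fix \<tau> :: real
    have "((\<lambda>s. F (x + s *\<^sub>R w)) has_vector_derivative ?D (Suc 0) (\<tau> * s)) (at (\<tau> * s))"
      using dir_deriv_has_vector_derivative[OF F, of 0 w x "\<tau> * s" UNIV] k by simp
    moreover have "((\<lambda>\<tau>. \<tau> * s) has_vector_derivative s) (at \<tau>)"
      by (auto intro!: derivative_eq_intros)
    ultimately have "((\<lambda>s. F (x + s *\<^sub>R w)) \<circ> (\<lambda>\<tau>. \<tau> * s) has_vector_derivative s *\<^sub>R ?D (Suc 0) (\<tau> * s)) (at \<tau>)"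
      by (intro vector_diff_chain_at)
    then show "((\<lambda>\<tau>. F (x + (\<tau> * s) *\<^sub>R w)) has_vector_derivative s *\<^sub>R ?D (Suc 0) (\<tau> * s)) (at \<tau> within {0..1})"
      by (simp add: o_def has_vector_derivative_at_within)
  qed simp
  from integral_unique[OF this] have ftc: "s *\<^sub>R integral {0..1} (\<lambda>\<tau>. ?D (Suc 0) (\<tau> * s)) = F (x + s *\<^sub>R w) - F x"
    by (simp only: integral_cmul mult_1 mult_zero_left scaleR_zero_left add_0_right)
  have r0: "poly (?r 0) y = poly (?r 0) 0 + y * poly (synthetic_div (?r 0) 0) y" for y
    using arg_cong[OF synthetic_div_correct'[of 0 "?r 0"], of "\<lambda>p. poly p y"] by simp
  have "radial_sum k k T ?D s = poly (?r 0) (s / T) *\<^sub>R F (x + s *\<^sub>R w)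
      + (\<Sum>j<k. (s ^ Suc j * poly (?r (Suc j)) (s / T)) *\<^sub>R ?D (Suc j) s)"
    unfolding radial_sum_def
    by (subst lessThan_Suc_atMost[symmetric], subst sum.lessThan_Suc_shift) simp
  also have "(\<Sum>j<k. (s ^ Suc j * poly (?r (Suc j)) (s / T)) *\<^sub>R ?D (Suc j) s)
     = s *\<^sub>R (\<Sum>j<k. (s ^ j * poly (?r (Suc j)) (s * (1 / T))) *\<^sub>R ?D (Suc j) s)"
    by (simp add: scaleR_sum_right mult.assoc)
  also have "poly (?r 0) (s / T) *\<^sub>R F (x + s *\<^sub>R w)
     = poly (?r 0) (s / T) *\<^sub>R (s *\<^sub>R integral {0..1} (\<lambda>\<tau>. ?D (Suc 0) (\<tau> * s)))
       + poly (?r 0) (s / T) *\<^sub>R F x"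
    unfolding ftc by (simp flip: scaleR_add_right)
  also have "poly (?r 0) (s / T) *\<^sub>R F x
     = poly (?r 0) 0 *\<^sub>R F x + s *\<^sub>R ((1 / T * poly (synthetic_div (?r 0) 0) (s * (1 / T))) *\<^sub>R F x)"
    by (subst r0) (simp add: scaleR_left_distrib)
  finally show ?thesis
    unfolding dini_quotient_def prod.case scaleR_add_right by (simp add: scaleR_left_commute)
qed

text \<open>
  The part of the ray integral on \<open>{0..b}\<close>. The value at 0 contributes a sine integral, which tends
  to \<open>pi / 2\<close>; the remaining difference quotient is continuous and is removed by the
  Riemann-Lebesgue lemma, uniformly in the base point, the direction and the cut-off.
\<close>

lemma near_estimate:
  fixes F :: "real ^ 'n::finite \<Rightarrow> 'a::banach"
  assumes F: "cont_diff k F" and k: "1 \<le> k" and K: "compact K" and b: "0 < b" and \<epsilon>: "\<epsilon> > 0"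
  obtains R0 where "R0 > 0"
    "\<And>R T x w. R \<ge> R0 \<Longrightarrow> T \<ge> 1 \<Longrightarrow> x \<in> K \<Longrightarrow> norm w = 1 \<Longrightarrow>
       norm ((R / 2) *\<^sub>R integral {0..b} (\<lambda>s. slice_cos 0 (R * s) *\<^sub>R
          radial_sum k k T (\<lambda>j s. dir_deriv j w F (x + s *\<^sub>R w)) s)
        - (pi / 2 * poly (radial_poly k k 0) 0) *\<^sub>R F x) \<le> \<epsilon>"
proof -
  let ?P = "K \<times> sphere (0 :: real ^ 'n) 1 \<times> {0..1 :: real}"
  let ?c = "poly (radial_poly k k 0) 0"
  let ?Y = "\<lambda>x w T s. dini_quotient k F (x, w, 1 / T) s"
  have P: "compact ?P" using K by (intro compact_Times) auto
  obtain R1 where R1: "R1 > 0"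
    "\<And>R p. R \<ge> R1 \<Longrightarrow> p \<in> ?P \<Longrightarrow> norm (integral {0..b} (\<lambda>s. sin (R * s) *\<^sub>R dini_quotient k F p s)) \<le> \<epsilon> / 2"
    using uniform_riemann_lebesgue[OF P continuous_on_dini_quotient[OF F k] b, of "\<epsilon> / 2"] \<epsilon> by auto
  have "compact (F ` K)"
    by (intro compact_continuous_image continuous_on_subset[OF cont_diff_imp_continuous[OF F]] K) auto
  then obtain M where M: "M > 0" "\<And>x. x \<in> K \<Longrightarrow> norm (F x) \<le> M"
    by (force dest!: compact_imp_bounded simp: bounded_pos)
  define \<eta> where "\<eta> = \<epsilon> / (2 * ((\<bar>?c\<bar> + 1) * M))"
  have c1: "0 < (\<bar>?c\<bar> + 1) * M" using M(1) by (intro mult_pos_pos) auto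
  then have \<eta>: "\<eta> > 0" using \<epsilon> by (simp add: \<eta>_def)
  have "((\<lambda>R. Si (R * b)) \<longlongrightarrow> pi / 2) at_top"
    using b by (intro filterlim_compose[OF Si_at_top] filterlim_at_top_mult_tendsto_pos[OF tendsto_const _ filterlim_ident])
  from tendstoD[OF this \<eta>] obtain R2 where R2: "\<And>R. R \<ge> R2 \<Longrightarrow> dist (Si (R * b)) (pi / 2) < \<eta>"
    by (auto simp: eventually_at_top_linorder)
  show ?thesis
  proof (rule that[of "max R1 (max R2 1)"])
    show "0 < max R1 (max R2 1)" by simp
    fix R T :: real and x w :: "real ^ 'n"
    assume R: "max R1 (max R2 1) \<le> R" and T: "1 \<le> T" and x: "x \<in> K" and w: "norm w = 1"
    have R0: "R > 0" using R by simp
    let ?S = "\<lambda>s. radial_sum k k T (\<lambda>j s. dir_deriv j w F (x + s *\<^sub>R w)) s"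
    have p: "(x, w, 1 / T) \<in> ?P" using x w T by simp
    have Y_cont: "continuous_on {0..b} (?Y x w T)"
      using continuous_on_compose2[OF continuous_on_dini_quotient[OF F k, of UNIV UNIV]
          continuous_on_Pair[OF continuous_on_const continuous_on_id], of "(x, w, 1 / T)" "{0..b}"]
      by simp
    have pt: "(R / 2) *\<^sub>R (slice_cos 0 (R * s) *\<^sub>R ?S s)
        = (R / 2 * slice_cos 0 (R * s)) *\<^sub>R (?c *\<^sub>R F x) + sin (R * s) *\<^sub>R ?Y x w T s" for s
    proof -
      have "R / 2 * slice_cos 0 (R * s) * s = sin (R * s)"
        using slice_cos_0[of "R * s"] by (simp add: field_simps)
      then have sY: "(R / 2 * slice_cos 0 (R * s)) *\<^sub>R (s *\<^sub>R ?Y x w T s) = sin (R * s) *\<^sub>R ?Y x w T s" by simp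
      have "(R / 2) *\<^sub>R (slice_cos 0 (R * s) *\<^sub>R (u + v))
          = (R / 2 * slice_cos 0 (R * s)) *\<^sub>R u + (R / 2 * slice_cos 0 (R * s)) *\<^sub>R v" for u v :: 'a
        by (simp add: scaleR_add_right)
      then show ?thesis unfolding radial_sum_eq_dini_quotient[OF F k] by (simp only: sY)
    qed
    have "(R / 2) *\<^sub>R integral {0..b} (\<lambda>s. slice_cos 0 (R * s) *\<^sub>R ?S s)
       = integral {0..b} (\<lambda>s. (R / 2 * slice_cos 0 (R * s)) *\<^sub>R (?c *\<^sub>R F x) + sin (R * s) *\<^sub>R ?Y x w T s)"
      unfolding pt[symmetric] by (rule integral_cmul[symmetric])
    also have "\<dots> = integral {0..b} (\<lambda>s. (R / 2 * slice_cos 0 (R * s)) *\<^sub>R (?c *\<^sub>R F x))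
        + integral {0..b} (\<lambda>s. sin (R * s) *\<^sub>R ?Y x w T s)"
      by (intro Henstock_Kurzweil_Integration.integral_add integrable_continuous_real continuous_intros Y_cont)
    also have "integral {0..b} (\<lambda>s. (R / 2 * slice_cos 0 (R * s)) *\<^sub>R (?c *\<^sub>R F x)) = Si (R * b) *\<^sub>R (?c *\<^sub>R F x)"
    proof -
      have "(\<lambda>s. R / 2 * slice_cos 0 (R * s)) integrable_on {0..b}"
        by (intro integrable_continuous_real continuous_intros)
      from integral_unique[OF has_integral_scaleR_left[OF integrable_integral[OF this]]] b
      show ?thesis by (simp only: integral_slice_cos_0 less_imp_le)
    qed
    finally have eq: "(R / 2) *\<^sub>R integral {0..b} (\<lambda>s. slice_cos 0 (R * s) *\<^sub>R ?S s) - (pi / 2 * ?c) *\<^sub>R F x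
       = (Si (R * b) - pi / 2) *\<^sub>R (?c *\<^sub>R F x) + integral {0..b} (\<lambda>s. sin (R * s) *\<^sub>R ?Y x w T s)"
      by (simp add: scaleR_left_diff_distrib left_diff_distrib)
    have "norm ((Si (R * b) - pi / 2) *\<^sub>R (?c *\<^sub>R F x)) \<le> \<eta> * ((\<bar>?c\<bar> + 1) * M)"
    proof -
      have "\<bar>Si (R * b) - pi / 2\<bar> \<le> \<eta>" using R2[of R] R by (simp add: dist_real_def)
      moreover have "\<bar>?c\<bar> * norm (F x) \<le> (\<bar>?c\<bar> + 1) * M" using M x by (intro mult_mono) auto
      ultimately show ?thesis using \<eta> by (simp only: norm_scaleR real_norm_def) (rule mult_mono, simp_all)
    qed
    also have "\<dots> = \<epsilon> / 2"
    proof -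
      have "\<epsilon> / (2 * X) * X = \<epsilon> / 2" if "0 < X" for X using that by simp
      from this[OF c1] show ?thesis unfolding \<eta>_def .
    qed
    finally have "norm ((Si (R * b) - pi / 2) *\<^sub>R (?c *\<^sub>R F x)) \<le> \<epsilon> / 2" .
    moreover have "norm (integral {0..b} (\<lambda>s. sin (R * s) *\<^sub>R ?Y x w T s)) \<le> \<epsilon> / 2"
      using R1(2)[OF _ p] R by simp
    ultimately have "norm ((Si (R * b) - pi / 2) *\<^sub>R (?c *\<^sub>R F x) + integral {0..b} (\<lambda>s. sin (R * s) *\<^sub>R ?Y x w T s))
        \<le> \<epsilon> / 2 + \<epsilon> / 2" by (rule norm_triangle_mono)
    then show "norm ((R / 2) *\<^sub>R integral {0..b} (\<lambda>s. slice_cos 0 (R * s) *\<^sub>R ?S s) - (pi / 2 * ?c) *\<^sub>R F x) \<le> \<epsilon>"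
      unfolding eq by simp
  qed
qed

text \<open>
  Words are summed rather than multi-indices, so that mixed derivatives count with
  multiplicity.
\<close>

definition jet_norm :: "nat \<Rightarrow> (real ^ 'n::finite \<Rightarrow> 'a::real_normed_vector) \<Rightarrow> real ^ 'n \<Rightarrow> real" where
  "jet_norm k F y = (\<Sum>j\<le>k. \<Sum>u | length u = j. norm (foldr partial u F y))"

lemma jet_norm_nonneg: "0 \<le> jet_norm k F y"
  by (simp add: jet_norm_def sum_nonneg)

lemma continuous_on_jet_norm:
  fixes F :: "real ^ 'n::finite \<Rightarrow> 'a::real_normed_vector"
  assumes F: "cont_diff k F" and g: "continuous_on A g"
  shows "continuous_on A (\<lambda>z. jet_norm k F (g z))"
proof -
  have "continuous_on A (\<lambda>z. foldr partial u F (g z))" if "length u \<le> k" for u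
  proof -
    have "cont_diff 0 (foldr partial u F)"
      using that by (intro cont_diff_foldr_partial cont_diff_mono[OF F]) auto
    from continuous_on_compose2[OF cont_diff_imp_continuous[OF this] g] show ?thesis by auto
  qed
  then show ?thesis unfolding jet_norm_def by (intro continuous_intros) auto
qed

lemma radial_poly_bound:
  obtains C where "C > 0" "\<And>j t. j \<le> k \<Longrightarrow> 0 \<le> t \<Longrightarrow> t \<le> 1 \<Longrightarrow> \<bar>poly (radial_poly k k j) t\<bar> \<le> C"
proof -
  define \<Theta> where "\<Theta> = (\<lambda>t. \<Sum>j\<le>k. \<bar>poly (radial_poly k k j) t\<bar>)"
  have "compact (\<Theta> ` {0..1})"
    unfolding \<Theta>_def by (intro compact_continuous_image continuous_intros) auto
  then obtain C where C: "C > 0" "\<And>t. t \<in> {0..1} \<Longrightarrow> norm (\<Theta> t) \<le> C"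
    by (force dest!: compact_imp_bounded simp: bounded_pos)
  have "\<bar>poly (radial_poly k k j) t\<bar> \<le> C" if "j \<le> k" "0 \<le> t" "t \<le> 1" for j t
  proof -
    have "\<bar>poly (radial_poly k k j) t\<bar> \<le> \<Theta> t"
      unfolding \<Theta>_def using that by (intro member_le_sum) auto
    also have "\<dots> \<le> C" using C(2)[of t] that by simp
    finally show ?thesis .
  qed
  with C(1) show ?thesis using that by blast
qed

text \<open>
  On \<open>{b..T}\<close> the factor \<open>1 / s\<close> of the kernel \<open>sin (R * s) / s\<close> and the largest power \<open>s ^ k\<close> in \<open>radial_sum\<close> combine
  to \<open>s ^ (k - 1)\<close>. In polar coordinates in dimension \<open>n = 2 * k + 1\<close> this is the weight
  \<open>norm y powi (k - n)\<close> of the integrability condition on the derivatives.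
\<close>

lemma far_estimate:
  fixes F :: "real ^ 'n::finite \<Rightarrow> 'a::banach"
  assumes F: "cont_diff k F" and k: "1 \<le> k" and w: "norm w \<le> 1" and b: "1 \<le> b" "b \<le> T" and R: "R > 0"
    and C: "0 < C" "\<And>j t. j \<le> k \<Longrightarrow> 0 \<le> t \<Longrightarrow> t \<le> 1 \<Longrightarrow> \<bar>poly (radial_poly k k j) t\<bar> \<le> C"
  shows "norm ((R / 2) *\<^sub>R integral {b..T} (\<lambda>s. slice_cos 0 (R * s) *\<^sub>R
          radial_sum k k T (\<lambda>j s. dir_deriv j w F (x + s *\<^sub>R w)) s))
      \<le> C * integral {b..T} (\<lambda>s. s ^ (k - 1) * jet_norm k F (x + s *\<^sub>R w))"
proof -
  let ?D = "\<lambda>j s. dir_deriv j w F (x + s *\<^sub>R w)"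
  let ?S = "radial_sum k k T ?D"
  have T: "T > 0" using b by simp
  have S_cont: "continuous_on {b..T} ?S"
    using T by (intro continuous_on_radial_sum continuous_on_dir_deriv[OF F] continuous_intros) auto
  have jet_cont: "continuous_on {b..T} (\<lambda>s. jet_norm k F (x + s *\<^sub>R w))"
    by (intro continuous_on_jet_norm[OF F] continuous_intros)
  have "norm (integral {b..T} (\<lambda>s. (R / 2) *\<^sub>R (slice_cos 0 (R * s) *\<^sub>R ?S s)))
     \<le> integral {b..T} (\<lambda>s. C * (s ^ (k - 1) * jet_norm k F (x + s *\<^sub>R w)))"
  proof (rule Henstock_Kurzweil_Integration.integral_norm_bound_integral)
    show "(\<lambda>s. (R / 2) *\<^sub>R (slice_cos 0 (R * s) *\<^sub>R ?S s)) integrable_on {b..T}"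
      by (intro integrable_continuous_real continuous_intros S_cont)
    show "(\<lambda>s. C * (s ^ (k - 1) * jet_norm k F (x + s *\<^sub>R w))) integrable_on {b..T}"
      by (intro integrable_continuous_real continuous_intros jet_cont)
    fix s assume s: "s \<in> {b..T}"
    then have s1: "1 \<le> s" "s \<le> T" using b by auto
    have "norm (?S s) \<le> (\<Sum>j\<le>k. s ^ k * C * (\<Sum>u | length u = j. norm (foldr partial u F (x + s *\<^sub>R w))))"
      unfolding radial_sum_def
    proof (rule sum_norm_le)
      fix j assume j: "j \<in> {..k}"
      have "\<bar>s ^ j * poly (radial_poly k k j) (s / T)\<bar> \<le> s ^ k * C"
        unfolding abs_mult using s1 T j C by (intro mult_mono) (auto intro!: power_increasing)
      moreover have "norm (?D j s) \<le> (\<Sum>u | length u = j. norm (foldr partial u F (x + s *\<^sub>R w)))"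
        by (rule norm_dir_deriv_le[OF w])
      ultimately show "norm ((s ^ j * poly (radial_poly k k j) (s / T)) *\<^sub>R ?D j s)
         \<le> s ^ k * C * (\<Sum>u | length u = j. norm (foldr partial u F (x + s *\<^sub>R w)))"
        unfolding norm_scaleR real_norm_def using s1 C(1) by (intro mult_mono) auto
    qed
    also have "\<dots> = s ^ k * C * jet_norm k F (x + s *\<^sub>R w)" by (simp add: jet_norm_def sum_distrib_left)
    finally have S_le: "norm (?S s) \<le> s ^ k * C * jet_norm k F (x + s *\<^sub>R w)" .
    have "R / 2 * slice_cos 0 (R * s) = sin (R * s) / s"
      using slice_cos_0[of "R * s"] s1 by (simp add: field_simps)
    then have "\<bar>R / 2 * slice_cos 0 (R * s)\<bar> \<le> 1 / s"
      using s1 by (simp add: divide_right_mono)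
    then have "\<bar>R / 2 * slice_cos 0 (R * s)\<bar> * norm (?S s) \<le> 1 / s * (s ^ k * C * jet_norm k F (x + s *\<^sub>R w))"
      using s1 S_le by (intro mult_mono) auto
    also have "\<dots> = C * (s ^ (k - 1) * jet_norm k F (x + s *\<^sub>R w))"
      using s1 k by (simp add: power_eq_if)
    finally show "norm ((R / 2) *\<^sub>R (slice_cos 0 (R * s) *\<^sub>R ?S s))
       \<le> C * (s ^ (k - 1) * jet_norm k F (x + s *\<^sub>R w))" by (simp add: abs_mult)
  qed
  then show ?thesis by (simp only: integral_cmul integral_mult_right)
qed

section \<open>Averages over the directions\<close>

lemma norm_ang_weight_integral_le:
  fixes J :: "'b::euclidean_space \<Rightarrow> 'a::banach"
  assumes c: "continuous_on UNIV (\<lambda>z. ang_weight z *\<^sub>R J z)"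
  shows "ennreal (norm (integral (cbox (- One) One) (\<lambda>z. ang_weight z *\<^sub>R J z)))
    \<le> (\<integral>\<^sup>+z. ennreal (ang_weight z) * ennreal (norm (J z)) \<partial>lborel)"
proof -
  have n: "continuous_on UNIV (\<lambda>z. ang_weight z * norm (J z))"
    using continuous_on_norm[OF c] by simp
  have "norm (integral (cbox (- One) One) (\<lambda>z. ang_weight z *\<^sub>R J z))
      \<le> integral (cbox (- One) One) (\<lambda>z. ang_weight z * norm (J z))"
    by (intro Henstock_Kurzweil_Integration.integral_norm_bound_integral integrable_continuous
        continuous_on_subset[OF c] continuous_on_subset[OF n]) auto
  then show ?thesis
    using nn_integral_ang_weight_integral[OF n] by (simp add: ennreal_leI)
qed

definition ang_total :: "'b::euclidean_space itself \<Rightarrow> real" where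
  "ang_total _ = integral (cbox (- One) One) (ang_weight :: 'b \<Rightarrow> real)"

lemma nn_integral_ang_total:
  "(\<integral>\<^sup>+z. ennreal (ang_weight (z :: 'b::euclidean_space)) \<partial>lborel) = ennreal (ang_total TYPE('b))"
  using nn_integral_ang_weight_integral[of "\<lambda>_ :: 'b. 1"]
  by (simp add: ang_total_def continuous_on_ang_weight[OF continuous_on_id, unfolded id_def])

lemma ang_total_nonneg: "0 \<le> ang_total TYPE('b::euclidean_space)"
  unfolding ang_total_def
  by (intro integral_nonneg integrable_continuous continuous_intros) auto

lemma polar_factor_ang_total:
  "polar_factor TYPE('b::euclidean_space) * ang_total TYPE('b) = DIM('b) * unit_ball_vol (DIM('b))"
proof -
  have k: "0 < polar_factor TYPE('b)" by (rule polar_const_eq_polar_factor)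
  have "ennreal (ang_total TYPE('b)) = ennreal (DIM('b) * unit_ball_vol (DIM('b)) * (1 / polar_factor TYPE('b)))"
    using nn_integral_ang_weight[where 'b = 'b] k
    unfolding nn_integral_ang_total polar_const_eq_polar_factor(1) by (subst ennreal_mult) auto
  then have "ang_total TYPE('b) = DIM('b) * unit_ball_vol (DIM('b)) * (1 / polar_factor TYPE('b))"
    using k ang_total_nonneg[where 'b = 'b] by (subst (asm) ennreal_inj) auto
  then show ?thesis using k by simp
qed

lemma odd_product: "(\<Prod>i<k. 2 * real (k - i) - 1) * (2 ^ k * fact k) = fact (2 * k)"
proof (induction k)
  case (Suc k)
  have "(\<Prod>i<Suc k. 2 * real (Suc k - i) - 1) = (2 * real k + 1) * (\<Prod>i<k. 2 * real (k - i) - 1)"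
    by (subst prod.lessThan_Suc_shift) (simp add: o_def)
  then have "(\<Prod>i<Suc k. 2 * real (Suc k - i) - 1) * (2 ^ Suc k * fact (Suc k))
     = (2 * real k + 1) * (2 * (real k + 1)) * ((\<Prod>i<k. 2 * real (k - i) - 1) * (2 ^ k * fact k))"
    by (simp add: algebra_simps)
  also have "\<dots> = fact (2 * Suc k)" unfolding Suc.IH by (simp add: algebra_simps)
  finally show ?case .
qed simp

text \<open>
  The factors come from the spherical average in dimension \<open>2 * k + 1\<close>, the ball kernel together
  with the \<open>k\<close> integrations by parts, and the sine integral. Their product is the power of \<open>2 * pi\<close>
  in the definition of \<open>S_R\<close>, so the limit is \<open>F x\<close> and not a multiple of it.
\<close>

lemma normalisation_constant:
  "real (2 * k + 1) * unit_ball_vol (real (2 * k + 1)) * (unit_ball_vol (real (2 * k)) * 2 ^ (k + 1) * fact k)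
     * (pi / 2 * poly (radial_poly k k 0) 0) = (2 * pi) ^ (2 * k + 1)"
proof -
  define c where "c = (\<Prod>i<k. 2 * real (k - i) - 1)"
  have c: "c * 2 ^ k * fact k = fact (2 * k)" using odd_product[of k] by (simp add: c_def mult.assoc)
  have f: "fact (2 * Suc k) = (2 * (real k + 1)) * ((2 * real k + 1) * fact (2 * k))"
    by (simp add: algebra_simps)
  have g: "fact (Suc k) = (real k + 1) * fact k" by (simp add: algebra_simps)
  have "real (2 * k + 1) * (2 ^ (2 * Suc k) * fact (Suc k) / fact (2 * Suc k)) = 2 * 4 ^ k * fact k / fact (2 * k)"
  proof -
    have "real (2 * k + 1) = 2 * real k + 1" by simp
    moreover have "2 * real k + 1 \<noteq> 0" "real k + 1 \<noteq> 0" by linarith+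
    ultimately show ?thesis unfolding f g by (simp add: divide_simps power_mult) (simp add: algebra_simps)
  qed
  then have "real (2 * k + 1) * (2 ^ (2 * Suc k) * fact (Suc k) / fact (2 * Suc k)) * pi ^ k
      = 2 * 4 ^ k * fact k / fact (2 * k) * pi ^ k" by (simp only:)
  then have "real (2 * k + 1) * unit_ball_vol (real (2 * k + 1)) = 2 * 4 ^ k * fact k / fact (2 * k) * pi ^ k"
    by (simp only: unit_ball_vol_odd mult.assoc)
  moreover have "unit_ball_vol (real (2 * k)) * 2 ^ (k + 1) * fact k = pi ^ k * 2 ^ (k + 1)"
    by (simp only: unit_ball_vol_even) simp
  ultimately have "real (2 * k + 1) * unit_ball_vol (real (2 * k + 1)) * (unit_ball_vol (real (2 * k)) * 2 ^ (k + 1) * fact k)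
     * (pi / 2 * poly (radial_poly k k 0) 0)
    = 2 * 4 ^ k * fact k / fact (2 * k) * pi ^ k * (pi ^ k * 2 ^ (k + 1)) * (pi / 2 * c)"
    by (simp only: poly_radial_poly_0 c_def)
  also have "\<dots> = 2 * 4 ^ k * (pi ^ k * pi ^ k * pi) * (c * 2 ^ k * fact k / fact (2 * k))"
    by simp
  also have "\<dots> = 2 * 4 ^ k * (pi ^ k * pi ^ k * pi)" unfolding c by simp
  also have "\<dots> = (2 * pi) ^ (2 * k + 1)"
  proof -
    have four: "(4 :: real) = 2 * 2" by simp
    have odd: "r ^ (2 * k + 1) = r ^ k * r ^ k * r" for r :: real
      by (simp only: mult_2 power_add power_one_right)
    show ?thesis unfolding odd four power_mult_distrib by (simp only: mult_ac)
  qed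
  finally show ?thesis .
qed

definition ray_integral :: "nat \<Rightarrow> (real ^ 'n::finite \<Rightarrow> 'a::banach) \<Rightarrow> real ^ 'n \<Rightarrow> real \<Rightarrow> real \<Rightarrow> real ^ 'n \<Rightarrow> 'a" where
  "ray_integral k F x R T w = (R / 2) *\<^sub>R integral {0..T} (\<lambda>s. slice_cos 0 (R * s) *\<^sub>R
          radial_sum k k T (\<lambda>j s. dir_deriv j w F (x + s *\<^sub>R w)) s)"

lemma continuous_on_ray_integral:
  fixes F :: "real ^ 'n::finite \<Rightarrow> 'a::banach"
  assumes F: "cont_diff k F" and T: "T > 0"
  shows "continuous_on UNIV (\<lambda>z. ang_weight z *\<^sub>R ray_integral k F x R T (sgn z))"
proof -
  have "continuous_on (UNIV \<times> {0..T}) (\<lambda>(w, s). (R / 2) *\<^sub>R (slice_cos 0 (R * s) *\<^sub>R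
          radial_sum k k T (\<lambda>j s. dir_deriv j w F (x + s *\<^sub>R w)) s))"
    unfolding radial_sum_def split_beta using T
    by (intro continuous_intros continuous_on_dir_deriv[OF F]) auto
  from continuous_on_ang_weight_integral[OF this] show ?thesis
    unfolding ray_integral_def by (simp only: integral_cmul)
qed

text \<open>
  The ball kernel times a cut-off that vanishes to order \<open>k\<close> at \<open>norm y = T\<close>.
\<close>

definition cutoff_kernel :: "nat \<Rightarrow> real \<Rightarrow> real \<Rightarrow> real ^ 'n::finite \<Rightarrow> real" where
  "cutoff_kernel k R T y = max 0 (1 - norm y / T) ^ k
     * (unit_ball_vol (real (2 * k)) * R ^ CARD('n) * slice_cos k (R * norm y))"

text \<open>
  In polar coordinates around \<open>x\<close> the volume element \<open>s ^ (2 * k)\<close> is the power of \<open>s\<close> for which the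
  \<open>k\<close> integrations by parts have no boundary terms.
\<close>

lemma has_gen_bochner_integral_cutoff_kernel:
  fixes F :: "real ^ 'n::finite \<Rightarrow> 'a::complex_banach"
  assumes F: "cont_diff k F" and k: "1 \<le> k" and n: "CARD('n) = 2 * k + 1" and T: "T > 0" and R: "R > 0"
  shows "has_gen_bochner_integral lborel (\<lambda>y. cutoff_kernel k R T (y - x) *\<^sub>R F y)
    ((polar_factor TYPE(real ^ 'n) * (unit_ball_vol (real (2 * k)) * 2 ^ (k + 1) * fact k)) *\<^sub>R
      integral (cbox (- One) One) (\<lambda>z. ang_weight z *\<^sub>R ray_integral k F x R T (sgn z)))"
proof -
  let ?V = "unit_ball_vol (real (2 * k))"
  define h where "h = (\<lambda>y. cutoff_kernel k R T y *\<^sub>R F (x + y))"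
  have h_cont: "continuous_on UNIV h"
    unfolding h_def cutoff_kernel_def using T
    by (intro continuous_intros continuous_on_compose2[OF cont_diff_imp_continuous[OF F]]) auto
  have h_supp: "h y = 0" if "norm y > T" for y
  proof -
    have "1 - norm y / T \<le> 0" using that T by simp
    then show ?thesis using k by (simp add: h_def cutoff_kernel_def)
  qed
  have "polar_integral (T + 1) h
      = (?V * 2 ^ (k + 1) * fact k) *\<^sub>R integral (cbox (- One) One) (\<lambda>z. ang_weight z *\<^sub>R ray_integral k F x R T (sgn z))"
  proof -
    have "ang_weight z *\<^sub>R integral {0..T + 1} (\<lambda>s. s ^ (DIM(real ^ 'n) - 1) *\<^sub>R h (s *\<^sub>R sgn z))
       = (?V * 2 ^ (k + 1) * fact k) *\<^sub>R (ang_weight z *\<^sub>R ray_integral k F x R T (sgn z))" for z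
    proof (cases "z = 0")
      case False
      let ?w = "sgn z"
      let ?d = "\<lambda>j s. dir_deriv j ?w F (x + s *\<^sub>R ?w)"
      have w: "norm ?w = 1" using False by (simp add: norm_sgn)
      have int: "(\<lambda>s. s ^ (DIM(real ^ 'n) - 1) *\<^sub>R h (s *\<^sub>R ?w)) integrable_on {0..T + 1}"
        by (rule continuous_polar_integrand(2)[OF h_cont])
      have "integral {0..T + 1} (\<lambda>s. s ^ (DIM(real ^ 'n) - 1) *\<^sub>R h (s *\<^sub>R ?w))
         = integral {0..T} (\<lambda>s. s ^ (DIM(real ^ 'n) - 1) *\<^sub>R h (s *\<^sub>R ?w))
         + integral {T..T + 1} (\<lambda>s. s ^ (DIM(real ^ 'n) - 1) *\<^sub>R h (s *\<^sub>R ?w))"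
        using T by (intro Henstock_Kurzweil_Integration.integral_combine[symmetric] int) auto
      also have "integral {T..T + 1} (\<lambda>s. s ^ (DIM(real ^ 'n) - 1) *\<^sub>R h (s *\<^sub>R ?w)) = integral {T..T + 1} (\<lambda>s. 0)"
      proof (rule Henstock_Kurzweil_Integration.integral_cong)
        fix s assume s: "s \<in> {T..T + 1}"
        then have "norm (s *\<^sub>R ?w) = s" using w T by simp
        then have "1 - norm (s *\<^sub>R ?w) / T \<le> 0" using s T by simp
        then have "h (s *\<^sub>R ?w) = 0" using k by (simp add: h_def cutoff_kernel_def)
        then show "s ^ (DIM(real ^ 'n) - 1) *\<^sub>R h (s *\<^sub>R ?w) = 0" by simp
      qed
      also have "integral {0..T} (\<lambda>s. s ^ (DIM(real ^ 'n) - 1) *\<^sub>R h (s *\<^sub>R ?w))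
         = integral {0..T} (\<lambda>s. (?V * R ^ CARD('n)) *\<^sub>R ((s ^ (2 * k) * slice_cos k (R * s) * (1 - s / T) ^ k) *\<^sub>R ?d 0 s))"
      proof (rule Henstock_Kurzweil_Integration.integral_cong)
        fix s assume s: "s \<in> {0..T}"
        then have "norm (s *\<^sub>R ?w) = s" using w by simp
        moreover have "max 0 (1 - s / T) = 1 - s / T" using s T by simp
        ultimately have "h (s *\<^sub>R ?w) = ((1 - s / T) ^ k * (?V * R ^ CARD('n) * slice_cos k (R * s))) *\<^sub>R F (x + s *\<^sub>R ?w)"
          by (simp add: h_def cutoff_kernel_def)
        then show "s ^ (DIM(real ^ 'n) - 1) *\<^sub>R h (s *\<^sub>R ?w)
           = (?V * R ^ CARD('n)) *\<^sub>R ((s ^ (2 * k) * slice_cos k (R * s) * (1 - s / T) ^ k) *\<^sub>R ?d 0 s)"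
          using n by (simp add: mult_ac)
      qed
      also have "\<dots> = (?V * R ^ CARD('n)) *\<^sub>R ((2 ^ k * fact k / R ^ (2 * k)) *\<^sub>R
           integral {0..T} (\<lambda>s. slice_cos 0 (R * s) *\<^sub>R radial_sum k k T ?d s))"
        unfolding integral_cmul
      proof (subst integral_slice_cos_iterated_by_parts[where d = ?d])
        show "(?d j has_vector_derivative ?d (Suc j) s) (at s within {0..T})" if "j < k" for j s
          using that by (rule dir_deriv_has_vector_derivative[OF F])
        show "continuous_on {0..T} (?d k)"
          by (intro continuous_on_dir_deriv[OF F] continuous_intros) auto
      qed (use T R in auto)
      also have "\<dots> = (?V * 2 ^ (k + 1) * fact k) *\<^sub>R ray_integral k F x R T ?w"
      proof -
        have "?V * R ^ CARD('n) * (2 ^ k * fact k / R ^ (2 * k)) = ?V * 2 ^ (k + 1) * fact k * (R / 2)"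
          using R n by simp
        then show ?thesis unfolding ray_integral_def by (simp only: scaleR_scaleR)
      qed
      finally show ?thesis by simp
    qed simp
    then show ?thesis unfolding polar_integral_def by (simp only: integral_cmul)
  qed
  with has_gen_bochner_integral_polar[where h = h and T = T and x = x, OF h_cont h_supp less_imp_le[OF T]]
  show ?thesis by (simp add: h_def)
qed

text \<open>
  The error on each ray is split at \<open>b\<close>. The near part is at most \<open>\<epsilon>\<close> in every direction; the far
  parts are not small ray by ray, but their average over the directions is, by the polar formula,
  an integral over the complement of a ball.
\<close>

lemma norm_integral_spherical_mean_error:
  fixes F :: "real ^ 'n::finite \<Rightarrow> 'a::banach"
  assumes F: "cont_diff k F" and k: "1 \<le> k" and n: "CARD('n) = 2 * k + 1" and T: "b \<le> T" and b: "1 \<le> b" and R: "R > 0"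
    and C: "0 < C" "\<And>j t. j \<le> k \<Longrightarrow> 0 \<le> t \<Longrightarrow> t \<le> 1 \<Longrightarrow> \<bar>poly (radial_poly k k j) t\<bar> \<le> C"
    and \<epsilon>: "0 \<le> \<epsilon>"
    and near: "\<And>w. norm w = 1 \<Longrightarrow> norm ((R / 2) *\<^sub>R integral {0..b} (\<lambda>s. slice_cos 0 (R * s) *\<^sub>R
          radial_sum k k T (\<lambda>j s. dir_deriv j w F (x + s *\<^sub>R w)) s) - a *\<^sub>R F x) \<le> \<epsilon>"
    and tail: "(\<integral>\<^sup>+y. ennreal (inverse (norm y ^ (k + 1)) * jet_norm k F (x + y)) * indicator {y. b \<le> norm y} y \<partial>lborel)
         \<le> ennreal \<tau>" and \<tau>: "0 \<le> \<tau>"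
  shows "norm (integral (cbox (- One) One) (\<lambda>z. ang_weight z *\<^sub>R ray_integral k F x R T (sgn z))
            - (ang_total TYPE(real ^ 'n) * a) *\<^sub>R F x)
       \<le> \<epsilon> * ang_total TYPE(real ^ 'n) + C * \<tau> / polar_factor TYPE(real ^ 'n)"
proof -
  let ?W = "ang_total TYPE(real ^ 'n)" and ?pf = "polar_factor TYPE(real ^ 'n)"
  let ?B = "cbox (- One) (One :: real ^ 'n)"
  have T0: "T > 0" using T b by simp
  have pf: "0 < ?pf" by (rule polar_const_eq_polar_factor)
  let ?E = "\<lambda>z. ray_integral k F x R T (sgn z) - a *\<^sub>R F x"
  have c1: "continuous_on UNIV (\<lambda>z. ang_weight z *\<^sub>R ray_integral k F x R T (sgn z))"
    by (rule continuous_on_ray_integral[OF F T0])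
  have c2: "continuous_on UNIV (\<lambda>z :: real ^ 'n. ang_weight z *\<^sub>R (a *\<^sub>R F x))"
    by (intro continuous_intros)
  have cE: "continuous_on UNIV (\<lambda>z. ang_weight z *\<^sub>R ?E z)"
    unfolding scaleR_diff_right by (intro continuous_on_diff c1 c2)
  have aw_int: "(ang_weight :: real ^ 'n \<Rightarrow> real) integrable_on ?B"
    by (intro integrable_continuous continuous_intros)
  have "integral ?B (\<lambda>z. ang_weight z *\<^sub>R ?E z)
     = integral ?B (\<lambda>z. ang_weight z *\<^sub>R ray_integral k F x R T (sgn z)) - integral ?B (\<lambda>z. ang_weight z *\<^sub>R (a *\<^sub>R F x))"
    unfolding scaleR_diff_right
    by (intro Henstock_Kurzweil_Integration.integral_diff integrable_continuous continuous_on_subset[OF c1] continuous_on_subset[OF c2]) auto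
  also have "integral ?B (\<lambda>z. ang_weight z *\<^sub>R (a *\<^sub>R F x)) = (?W * a) *\<^sub>R F x"
    using integral_unique[OF has_integral_scaleR_left[OF integrable_integral[OF aw_int], of "a *\<^sub>R F x"]]
    by (simp add: ang_total_def)
  finally have eq: "integral ?B (\<lambda>z. ang_weight z *\<^sub>R ray_integral k F x R T (sgn z)) - (?W * a) *\<^sub>R F x
      = integral ?B (\<lambda>z. ang_weight z *\<^sub>R ?E z)" by simp
  let ?f = "\<lambda>y. ennreal (inverse (norm y ^ (k + 1)) * jet_norm k F (x + y)) * indicator {y. b \<le> norm y} y"
  have jet_meas [measurable]: "(\<lambda>y. jet_norm k F (x + y)) \<in> borel_measurable borel"
    by (intro borel_measurable_continuous_onI continuous_on_jet_norm[OF F] continuous_intros)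
  have f_meas: "?f \<in> borel_measurable borel" by measurable
  let ?I = "\<lambda>z. \<integral>\<^sup>+s. indicator {0..} s * ennreal (s ^ (DIM(real ^ 'n) - 1)) * ?f ((s / norm z) *\<^sub>R z) \<partial>lborel"
  have E_le: "ennreal (ang_weight z) * ennreal (norm (?E z))
     \<le> ennreal (ang_weight z) * (ennreal \<epsilon> + ennreal C * ?I z)" for z
  proof (cases "z = 0")
    case False
    let ?w = "sgn z"
    have w: "norm ?w = 1" using False by (simp add: norm_sgn)
    let ?g = "\<lambda>s. slice_cos 0 (R * s) *\<^sub>R radial_sum k k T (\<lambda>j s. dir_deriv j ?w F (x + s *\<^sub>R ?w)) s"
    have g_int: "?g integrable_on {0..T}"
      using T0 by (intro integrable_continuous_real continuous_intros continuous_on_radial_sum continuous_on_dir_deriv[OF F]) auto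
    have "integral {0..T} ?g = integral {0..b} ?g + integral {b..T} ?g"
      using T b by (intro Henstock_Kurzweil_Integration.integral_combine[symmetric] g_int) auto
    then have "?E z = ((R / 2) *\<^sub>R integral {0..b} ?g - a *\<^sub>R F x) + (R / 2) *\<^sub>R integral {b..T} ?g"
      by (simp add: ray_integral_def scaleR_add_right)
    also have "norm \<dots> \<le> \<epsilon> + C * integral {b..T} (\<lambda>s. s ^ (k - 1) * jet_norm k F (x + s *\<^sub>R ?w))"
      using w by (intro norm_triangle_mono near far_estimate[OF F k _ b T R C]) auto
    finally have 1: "norm (?E z) \<le> \<epsilon> + C * integral {b..T} (\<lambda>s. s ^ (k - 1) * jet_norm k F (x + s *\<^sub>R ?w))" .
    let ?j = "\<lambda>s. s ^ (k - 1) * jet_norm k F (x + s *\<^sub>R ?w)"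
    have j_int: "?j integrable_on {b..T}"
      by (intro integrable_continuous_real continuous_intros continuous_on_jet_norm[OF F])
    have j_nonneg: "0 \<le> ?j s" if "s \<in> {b..T}" for s
      using that b jet_norm_nonneg[of k F] by auto
    have "ennreal (integral {b..T} ?j) = (\<integral>\<^sup>+s. ennreal (?j s) * indicator {b..T} s \<partial>lborel)"
      using nn_integral_has_integral_lebesgue'[OF j_nonneg integrable_integral[OF j_int]] by simp
    also have "\<dots> \<le> ?I z"
    proof (rule nn_integral_mono)
      fix s
      show "ennreal (?j s) * indicator {b..T} s
         \<le> indicator {0..} s * ennreal (s ^ (DIM(real ^ 'n) - 1)) * ?f ((s / norm z) *\<^sub>R z)"
      proof (cases "s \<in> {b..T}")
        case True
        then have s: "s > 0" "b \<le> s" using b by auto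
        have e: "(s / norm z) *\<^sub>R z = s *\<^sub>R ?w" by (simp add: sgn_div_norm divide_inverse)
        have ns: "norm (s *\<^sub>R ?w) = s" using w s by simp
        have "s ^ (2 * k) * inverse (s ^ (k + 1)) = s ^ (k - 1)"
        proof -
          have "2 * k = (k - 1) + (k + 1)" using k by simp
          then have "s ^ (2 * k) = s ^ (k - 1) * s ^ (k + 1)" by (metis power_add)
          moreover have "s ^ (k + 1) * inverse (s ^ (k + 1)) = 1" using s by (intro right_inverse) simp
          ultimately show ?thesis by (simp only: mult.assoc mult_1_right)
        qed
        then have "ennreal (?j s) = ennreal (s ^ (2 * k) * (inverse (s ^ (k + 1)) * jet_norm k F (x + s *\<^sub>R ?w)))"
          by (simp only: mult.assoc[symmetric])
        also have "\<dots> = ennreal (s ^ (2 * k)) * ennreal (inverse (s ^ (k + 1)) * jet_norm k F (x + s *\<^sub>R ?w))"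
          using s jet_norm_nonneg[of k F] by (intro ennreal_mult) auto
        finally have j_eq: "ennreal (?j s)
            = ennreal (s ^ (2 * k)) * ennreal (inverse (s ^ (k + 1)) * jet_norm k F (x + s *\<^sub>R ?w))" .
        have f_eq: "?f (s *\<^sub>R ?w) = ennreal (inverse (s ^ (k + 1)) * jet_norm k F (x + s *\<^sub>R ?w))"
          using s by (simp only: indicator_def mem_Collect_eq ns) simp
        have ind: "indicator {b..T} s = (1 :: ennreal)" "indicator {0..} s = (1 :: ennreal)"
          using True s by simp_all
        have dim: "DIM(real ^ 'n) - 1 = 2 * k" using n by simp
        show ?thesis unfolding e f_eq j_eq ind dim by (simp only: mult_1 mult_1_right order_refl)
      qed simp
    qed
    finally have 2: "ennreal (integral {b..T} ?j) \<le> ?I z" .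
    have "ennreal (norm (?E z)) \<le> ennreal (\<epsilon> + C * integral {b..T} ?j)" using 1 by (rule ennreal_leI)
    also have "\<dots> = ennreal \<epsilon> + ennreal C * ennreal (integral {b..T} ?j)"
      using \<epsilon> C(1) integral_nonneg[OF j_int j_nonneg] by (simp add: ennreal_mult)
    also have "\<dots> \<le> ennreal \<epsilon> + ennreal C * ?I z" using 2 by (intro add_left_mono mult_left_mono) auto
    finally show ?thesis by (rule mult_left_mono) simp
  qed simp
  have I_meas: "?I \<in> borel_measurable borel"
  proof -
    note [measurable] = f_meas
    have "(\<lambda>(z, s). indicator {0..} s * ennreal (s ^ (DIM(real ^ 'n) - 1)) * ?f ((s / norm z) *\<^sub>R z))
        \<in> borel_measurable (borel \<Otimes>\<^sub>M lborel)" by measurable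
    from lborel.borel_measurable_nn_integral[OF this] show ?thesis by simp
  qed
  have "ennreal (norm (integral ?B (\<lambda>z. ang_weight z *\<^sub>R ?E z)))
     \<le> (\<integral>\<^sup>+z. ennreal (ang_weight z) * ennreal (norm (?E z)) \<partial>lborel)"
    by (rule norm_ang_weight_integral_le[OF cE])
  also have "\<dots> \<le> (\<integral>\<^sup>+z. ennreal (ang_weight z) * (ennreal \<epsilon> + ennreal C * ?I z) \<partial>lborel)"
    by (rule nn_integral_mono) (rule E_le)
  also have "\<dots> = (\<integral>\<^sup>+z. ennreal \<epsilon> * ennreal (ang_weight z) + ennreal C * (ennreal (ang_weight z) * ?I z) \<partial>lborel)"
    by (intro nn_integral_cong) (simp add: distrib_left mult_ac)
  also have "\<dots> = (\<integral>\<^sup>+z. ennreal \<epsilon> * ennreal (ang_weight (z :: real ^ 'n)) \<partial>lborel)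
      + (\<integral>\<^sup>+z. ennreal C * (ennreal (ang_weight z) * ?I z) \<partial>lborel)"
    using I_meas by (intro nn_integral_add) (auto intro!: borel_measurable_times_ennreal)
  also have "(\<integral>\<^sup>+z. ennreal \<epsilon> * ennreal (ang_weight (z :: real ^ 'n)) \<partial>lborel) = ennreal \<epsilon> * ennreal ?W"
    by (subst nn_integral_cmult) (auto simp: nn_integral_ang_total)
  also have "(\<integral>\<^sup>+z. ennreal C * (ennreal (ang_weight z) * ?I z) \<partial>lborel)
      = ennreal C * (\<integral>\<^sup>+z. ennreal (ang_weight z) * ?I z \<partial>lborel)"
    using I_meas by (intro nn_integral_cmult) (auto intro!: borel_measurable_times_ennreal)
  also have "(\<integral>\<^sup>+z. ennreal (ang_weight z) * ?I z \<partial>lborel) = polar_const TYPE(real ^ 'n) * (\<integral>\<^sup>+y. ?f y \<partial>lborel)"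
    by (rule polar_nn_integral[OF f_meas])
  also have "ennreal \<epsilon> * ennreal ?W + ennreal C * (polar_const TYPE(real ^ 'n) * (\<integral>\<^sup>+y. ?f y \<partial>lborel))
      \<le> ennreal \<epsilon> * ennreal ?W + ennreal C * (ennreal (1 / ?pf) * ennreal \<tau>)"
    unfolding polar_const_eq_polar_factor(1) using tail by (intro add_left_mono mult_left_mono) auto
  also have "ennreal \<epsilon> * ennreal ?W + ennreal C * (ennreal (1 / ?pf) * ennreal \<tau>) = ennreal (\<epsilon> * ?W + C * \<tau> / ?pf)"
    using \<epsilon> C(1) \<tau> pf ang_total_nonneg[where 'b = "real ^ 'n"]
    by (simp add: ennreal_mult[symmetric] ennreal_plus[symmetric] del: ennreal_plus)
  finally show ?thesis
    unfolding eq using \<epsilon> C(1) \<tau> pf ang_total_nonneg[where 'b = "real ^ 'n"]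
    by (subst (asm) ennreal_le_iff) auto
qed

section \<open>Locally uniform convergence\<close>

lemma has_gen_bochner_integral_kernel:
  fixes F :: "real ^ 'n::finite \<Rightarrow> 'a::complex_banach"
  assumes int: "gen_bochner_integrable lebesgue F" and F: "continuous_on UNIV F"
    and n: "CARD('n) = 2 * k + 1" and R: "R > 0"
  shows "has_gen_bochner_integral lborel
     (\<lambda>y. (unit_ball_vol (real (2 * k)) * R ^ CARD('n) * slice_cos k (R * norm (y - x))) *\<^sub>R F y)
     ((2 * pi) ^ CARD('n) *\<^sub>R S_R R F x)"
proof -
  note eq = ball_kernel_eq_slice_cos[OF R n]
  have "continuous_on UNIV (ball_kernel R :: real ^ 'n \<Rightarrow> complex)"
    unfolding eq[abs_def] by (intro continuous_intros)
  from S_R_eq_ball_kernel_integral[OF int F this, of x]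
  show ?thesis unfolding eq scaleC_of_real by (simp add: norm_minus_commute)
qed

text \<open>
  For fixed \<open>R\<close> the kernel is bounded and \<open>F\<close> is integrable, so the cut-off is removed by dominated
  convergence. A bound that holds for all large \<open>T\<close> therefore survives in the limit, without any
  rate of convergence in \<open>T\<close>.
\<close>

lemma norm_S_R_diff_le:
  fixes F :: "real ^ 'n::finite \<Rightarrow> 'a::complex_banach"
  assumes int: "gen_bochner_integrable lebesgue F" and F: "cont_diff k F" and k: "1 \<le> k"
    and n: "CARD('n) = 2 * k + 1" and R: "R > 0"
    and le: "\<And>T. b \<le> T \<Longrightarrow> norm ((polar_factor TYPE(real ^ 'n) * (unit_ball_vol (real (2 * k)) * 2 ^ (k + 1) * fact k)) *\<^sub>R
      integral (cbox (- One) One) (\<lambda>z. ang_weight z *\<^sub>R ray_integral k F x R T (sgn z)) - A) \<le> B"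
  shows "norm ((2 * pi) ^ CARD('n) *\<^sub>R S_R R F x - A) \<le> B"
proof -
  note F_cont = cont_diff_imp_continuous[OF F]
  let ?ker = "\<lambda>y :: real ^ 'n. unit_ball_vol (real (2 * k)) * R ^ CARD('n) * slice_cos k (R * norm y)"
  let ?X = "(2 * pi) ^ CARD('n) *\<^sub>R S_R R F x"
  let ?V = "measure lborel {\<xi> :: real ^ 'n. norm \<xi> \<le> R}"
  define T where "T = (\<lambda>m. real m + 1)"
  define X where "X = (\<lambda>m. (polar_factor TYPE(real ^ 'n) * (unit_ball_vol (real (2 * k)) * 2 ^ (k + 1) * fact k)) *\<^sub>R
      integral (cbox (- One) One) (\<lambda>z. ang_weight z *\<^sub>R ray_integral k F x R (T m) (sgn z)))"
  have T: "T m > 0" for m by (simp add: T_def)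
  define cut where "cut = (\<lambda>m y :: real ^ 'n. max 0 (1 - norm y / T m) ^ k)"
  have cut01: "0 \<le> cut m y" "cut m y \<le> 1" for m y
    using T[of m] by (auto simp: cut_def intro!: power_le_one)
  have X: "has_gen_bochner_integral lborel (\<lambda>y. ?ker (y - x) *\<^sub>R F y) ?X"
    by (rule has_gen_bochner_integral_kernel[OF int F_cont n R])
  have Xm: "has_gen_bochner_integral lborel (\<lambda>y. (cut m (y - x) * ?ker (y - x)) *\<^sub>R F y) (X m)" for m
    using has_gen_bochner_integral_cutoff_kernel[OF F k n T R, of m x]
    unfolding cutoff_kernel_def cut_def X_def .
  have ker_le: "\<bar>?ker y\<bar> \<le> ?V" for y :: "real ^ 'n"
    using norm_ball_kernel_le[of R y] unfolding ball_kernel_eq_slice_cos[OF R n] by (simp only: norm_of_real)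
  have F_meas [measurable]: "(\<lambda>y. norm (F y)) \<in> borel_measurable borel"
    by (rule borel_measurable_continuous_onI[OF continuous_on_norm[OF F_cont]])
  have cut_meas [measurable]: "(\<lambda>y. cut m (y - x)) \<in> borel_measurable borel" for m
    unfolding cut_def by (intro borel_measurable_continuous_onI continuous_intros) (use T[of m] in auto)
  define t where "t = (\<lambda>m y. ennreal (?V * (1 - cut m (y - x))) * ennreal (norm (F y)))"
  have t_meas: "t m \<in> borel_measurable lborel" for m unfolding t_def by measurable
  have pt: "ennreal (norm (?ker (y - x) *\<^sub>R F y - (cut m (y - x) * ?ker (y - x)) *\<^sub>R F y)) \<le> t m y" for m y
  proof -
    have "?ker (y - x) *\<^sub>R F y - (cut m (y - x) * ?ker (y - x)) *\<^sub>R F y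
        = (?ker (y - x) * (1 - cut m (y - x))) *\<^sub>R F y"
    proof -
      have "p *\<^sub>R v - (q * p) *\<^sub>R v = (p * (1 - q)) *\<^sub>R v" for p q :: real and v :: 'a
        by (simp add: right_diff_distrib scaleR_left_diff_distrib mult.commute)
      then show ?thesis .
    qed
    also have "norm \<dots> = \<bar>?ker (y - x)\<bar> * (1 - cut m (y - x)) * norm (F y)"
      using cut01[of m "y - x"] by (simp add: abs_mult)
    also have "\<dots> \<le> ?V * (1 - cut m (y - x)) * norm (F y)"
      using cut01[of m "y - x"] by (intro mult_right_mono ker_le) auto
    finally show ?thesis
      using cut01[of m "y - x"] unfolding t_def by (subst ennreal_mult[symmetric]) (auto intro: ennreal_leI)
  qed
  have XX: "ennreal (norm (?X - X m)) \<le> (\<integral>\<^sup>+y. t m y \<partial>lborel)" for m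
    by (rule has_gen_bochner_integral_norm_diff_le[OF X Xm t_meas pt])
  have fin: "(\<integral>\<^sup>+y. ennreal (norm (F y)) \<partial>lborel) < \<infinity>"
  proof -
    have m: "F \<in> borel_measurable lborel" using F_cont by (simp add: borel_measurable_continuous_onI)
    obtain I where "has_gen_bochner_integral lborel F I"
      using int has_gen_bochner_integral_completion[OF m] by (auto simp: gen_bochner_integrable_def)
    then show ?thesis by (rule gen_bochner_nn_integral_finite)
  qed
  have "(\<lambda>m. \<integral>\<^sup>+y. t m y \<partial>lborel) \<longlonglongrightarrow> (\<integral>\<^sup>+y. 0 \<partial>(lborel :: (real ^ 'n) measure))"
  proof (rule nn_integral_dominated_convergence[where w = "\<lambda>y. ennreal ?V * ennreal (norm (F y))"])
    show "t m \<in> borel_measurable lborel" for m by (rule t_meas)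
    show "(\<integral>\<^sup>+y. ennreal ?V * ennreal (norm (F y)) \<partial>lborel) < \<infinity>"
      using fin by (subst nn_integral_cmult) (auto simp: ennreal_mult_less_top)
    show "AE y in lborel. t m y \<le> ennreal ?V * ennreal (norm (F y))" for m
    proof (rule AE_I2)
      fix y
      have "?V * (1 - cut m (y - x)) \<le> ?V * 1" using cut01[of m "y - x"] by (intro mult_left_mono) auto
      then show "t m y \<le> ennreal ?V * ennreal (norm (F y))"
        unfolding t_def by (intro mult_right_mono ennreal_leI) auto
    qed
    show "AE y in lborel. (\<lambda>m. t m y) \<longlonglongrightarrow> 0"
    proof (rule AE_I2)
      fix y
      have "(\<lambda>m. norm (y - x) / T m) \<longlonglongrightarrow> 0"
        using tendsto_mult_right_zero[OF LIMSEQ_inverse_real_of_nat, of "norm (y - x)"]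
        by (simp add: T_def divide_inverse add.commute)
      then have "(\<lambda>m. cut m (y - x)) \<longlonglongrightarrow> max 0 (1 - 0) ^ k"
        unfolding cut_def by (intro tendsto_intros)
      then have "(\<lambda>m. ?V * (1 - cut m (y - x))) \<longlonglongrightarrow> ?V * (1 - 1)"
        by (intro tendsto_intros) simp
      then have "(\<lambda>m. ennreal (?V * (1 - cut m (y - x)))) \<longlonglongrightarrow> 0"
        using tendsto_ennrealI by fastforce
      then show "(\<lambda>m. t m y) \<longlonglongrightarrow> 0"
        unfolding t_def using ennreal_tendsto_cmult[of "ennreal (norm (F y))"] by (fastforce simp: mult.commute)
    qed
  qed auto
  then have lim: "(\<lambda>m. \<integral>\<^sup>+y. t m y \<partial>lborel) \<longlonglongrightarrow> 0" by simp
  have "(\<lambda>m. ennreal (norm (?X - X m))) \<longlonglongrightarrow> 0"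
    by (rule tendsto_sandwich[OF _ _ tendsto_const lim]) (use XX in auto)
  then have "(\<lambda>m. norm (?X - X m)) \<longlonglongrightarrow> 0"
    by (subst tendsto_ennreal_iff[symmetric]) auto
  then have "(\<lambda>m. norm (?X - X m) + B) \<longlonglongrightarrow> 0 + B" by (intro tendsto_add tendsto_const)
  then have lim2: "(\<lambda>m. norm (?X - X m) + B) \<longlonglongrightarrow> B" by simp
  have ev: "\<forall>\<^sub>F m in sequentially. norm (?X - A) \<le> norm (?X - X m) + B"
    using eventually_ge_at_top[of "nat \<lceil>b\<rceil>"]
  proof eventually_elim
    case (elim m)
    then have "b \<le> T m" unfolding T_def by linarith
    from le[OF this] have "norm (X m - A) \<le> B" unfolding X_def .
    then show ?case using norm_triangle_ineq[of "?X - X m" "X m - A"] by simp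
  qed
  show ?thesis by (rule tendsto_lowerbound[OF lim2 ev]) simp
qed

lemma jet_norm_le_majorant:
  fixes F :: "real ^ 'n::finite \<Rightarrow> 'a::complex_banach"
  assumes F: "cont_diff k F" and n: "CARD('n) = 2 * k + 1" and x: "x \<in> K"
    and g: "(SUP \<alpha>\<in>{\<alpha>. multi_order \<alpha> \<le> k}. SUP x\<in>K.
            ereal (norm y powi (- int CARD('n) + int k) * norm (nabla \<alpha> F (x + y)))) \<le> ereal (g y)"
  shows "inverse (norm y ^ (k + 1)) * jet_norm k F (x + y)
     \<le> (\<Sum>j\<le>k. real (card {u :: 'n list. length u = j})) * g y"
proof -
  have pw: "norm y powi (- int CARD('n) + int k) = inverse (norm y ^ (k + 1))"
  proof -
    have "- int CARD('n) + int k = - int (k + 1)" using n by simp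
    then show ?thesis by (simp only: power_int_minus power_int_of_nat)
  qed
  have word: "inverse (norm y ^ (k + 1)) * norm (foldr partial u F (x + y)) \<le> g y" if "length u \<le> k" for u
  proof -
    let ?\<alpha> = "count (mset u)"
    have "multi_order ?\<alpha> \<le> k" using foldr_partial_eq_nabla(2)[OF F that] that by simp
    then have "ereal (norm y powi (- int CARD('n) + int k) * norm (nabla ?\<alpha> F (x + y)))
       \<le> (SUP \<alpha>\<in>{\<alpha>. multi_order \<alpha> \<le> k}. SUP x\<in>K.
            ereal (norm y powi (- int CARD('n) + int k) * norm (nabla \<alpha> F (x + y))))"
      by (intro SUP_upper2[of ?\<alpha>] SUP_upper2[OF x]) auto
    from order_trans[OF this g] show ?thesis
      unfolding pw foldr_partial_eq_nabla(1)[OF F that] by simp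
  qed
  have "inverse (norm y ^ (k + 1)) * jet_norm k F (x + y)
     = (\<Sum>j\<le>k. \<Sum>u | length u = j. inverse (norm y ^ (k + 1)) * norm (foldr partial u F (x + y)))"
    by (simp add: jet_norm_def sum_distrib_left)
  also have "\<dots> \<le> (\<Sum>j\<le>k. \<Sum>u :: 'n list | length u = j. g y)"
    by (intro sum_mono word) auto
  also have "\<dots> = (\<Sum>j\<le>k. real (card {u :: 'n list. length u = j})) * g y"
    by (simp add: sum_distrib_right)
  finally show ?thesis .
qed

text \<open>
  What the integrability condition on the derivatives is for: one radius \<open>b\<close>
  serves for all \<open>x\<close> in \<open>K\<close>, since the majorant does not depend on \<open>x\<close>.
\<close>

lemma jet_norm_tail:
  fixes F :: "real ^ 'n::finite \<Rightarrow> 'a::complex_banach" and g :: "real ^ 'n \<Rightarrow> real"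
  assumes F: "cont_diff k F" and n: "CARD('n) = 2 * k + 1" and \<tau>: "\<tau> > 0"
    and g: "integrable lebesgue g" and maj: "\<And>y. norm y \<ge> \<delta> \<Longrightarrow> (SUP \<alpha>\<in>{\<alpha>. multi_order \<alpha> \<le> k}. SUP x\<in>K.
            ereal (norm y powi (- int CARD('n) + int k) * norm (nabla \<alpha> F (x + y)))) \<le> ereal (g y)"
  obtains b where "1 \<le> b" "\<And>x. x \<in> K \<Longrightarrow>
    (\<integral>\<^sup>+y. ennreal (inverse (norm y ^ (k + 1)) * jet_norm k F (x + y)) * indicator {y. b \<le> norm y} y \<partial>lborel)
         \<le> ennreal \<tau>"
proof -
  define N where "N = (\<Sum>j\<le>k. real (card {u :: 'n list. length u = j}))"
  have N0: "0 \<le> N" by (simp add: N_def sum_nonneg)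
  have g_meas [measurable]: "g \<in> borel_measurable lebesgue" using g by simp
  have set_meas [measurable]: "{y :: real ^ 'n. c \<le> norm y} \<in> sets lebesgue" for c
  proof -
    have "{y :: real ^ 'n. c \<le> norm y} \<in> sets lborel" by simp
    then show ?thesis by (rule sets_completionI_sets)
  qed
  let ?t = "\<lambda>m y. ennreal (N * \<bar>g y\<bar>) * indicator {y. real m \<le> norm y} y"
  have "(\<lambda>m. \<integral>\<^sup>+y. ?t m y \<partial>lebesgue) \<longlonglongrightarrow> (\<integral>\<^sup>+y. 0 \<partial>(lebesgue :: (real ^ 'n) measure))"
  proof (rule nn_integral_dominated_convergence[where w = "\<lambda>y. ennreal (N * \<bar>g y\<bar>)"])
    have "integrable lebesgue (\<lambda>y. N * \<bar>g y\<bar>)" using g by simp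
    then show "(\<integral>\<^sup>+y. ennreal (N * \<bar>g y\<bar>) \<partial>lebesgue) < \<infinity>"
      using N0 by (simp add: nn_integral_eq_integral)
    show "AE y in lebesgue. ?t m y \<le> ennreal (N * \<bar>g y\<bar>)" for m
      by (rule AE_I2) (simp add: indicator_def)
    show "AE y in lebesgue. (\<lambda>m. ?t m y) \<longlonglongrightarrow> 0"
    proof (rule AE_I2, rule tendsto_eventually)
      fix y :: "real ^ 'n"
      show "\<forall>\<^sub>F m in sequentially. ?t m y = 0"
        using eventually_gt_at_top[of "nat \<lceil>norm y\<rceil>"]
      proof eventually_elim
        case (elim m)
        then have "\<not> real m \<le> norm y" by linarith
        then show ?case by simp
      qed
    qed
  qed measurable
  then have "(\<lambda>m. \<integral>\<^sup>+y. ?t m y \<partial>lebesgue) \<longlonglongrightarrow> 0" by simp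
  from order_tendstoD(2)[OF this, of "ennreal \<tau>"] \<tau>
  have "\<forall>\<^sub>F m in sequentially. (\<integral>\<^sup>+y. ?t m y \<partial>lebesgue) < ennreal \<tau>" by simp
  then obtain m where m: "(\<integral>\<^sup>+y. ?t m y \<partial>lebesgue) < ennreal \<tau>"
    unfolding eventually_sequentially by blast
  define b where "b = max 1 (max \<delta> (real m))"
  show ?thesis
  proof (rule that[of b])
    show "1 \<le> b" by (simp add: b_def)
    fix x assume x: "x \<in> K"
    let ?f = "\<lambda>y. ennreal (inverse (norm y ^ (k + 1)) * jet_norm k F (x + y)) * indicator {y. b \<le> norm y} y"
    have [measurable]: "(\<lambda>y. jet_norm k F (x + y)) \<in> borel_measurable borel"
      by (intro borel_measurable_continuous_onI continuous_on_jet_norm[OF F] continuous_intros)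
    have "(\<integral>\<^sup>+y. ?f y \<partial>lborel) = (\<integral>\<^sup>+y. ?f y \<partial>lebesgue)"
      by (rule nn_integral_completion[symmetric])
    also have "\<dots> \<le> (\<integral>\<^sup>+y. ?t m y \<partial>lebesgue)"
    proof (rule nn_integral_mono)
      fix y :: "real ^ 'n"
      show "?f y \<le> ?t m y"
      proof (cases "b \<le> norm y")
        case True
        then have "inverse (norm y ^ (k + 1)) * jet_norm k F (x + y) \<le> N * g y"
          unfolding N_def by (intro jet_norm_le_majorant[OF F n x maj]) (simp add: b_def)
        also have "\<dots> \<le> N * \<bar>g y\<bar>" using N0 by (intro mult_left_mono) auto
        finally show ?thesis using True by (simp add: b_def ennreal_leI)
      qed simp
    qed
    finally show "(\<integral>\<^sup>+y. ?f y \<partial>lborel) \<le> ennreal \<tau>" using m by simp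
  qed
qed

theorem proposition2p10:
  fixes F :: "real ^ 'n::finite \<Rightarrow> 'a::complex_banach"
    and k :: nat
  assumes "k \<ge> 1"
    and "CARD('n) = 2 * k + 1"
    and "gen_bochner_integrable lebesgue F"
    and "cont_diff k F"
    and "\<And>K. compact K \<Longrightarrow>
      \<exists>(g :: real ^ 'n \<Rightarrow> real) \<delta>. integrable lebesgue g \<and> \<delta> > 0 \<and>
        (\<forall>y. norm y \<ge> \<delta> \<longrightarrow>
          (SUP \<alpha>\<in>{\<alpha>. multi_order \<alpha> \<le> k}. SUP x\<in>K.
            ereal (norm y powi (- int CARD('n) + int k) * norm (nabla \<alpha> F (x + y))))
          \<le> ereal (g y))"
  shows "\<And>K. compact K \<Longrightarrow> uniform_limit K (\<lambda>R. S_R R F) F at_top"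
proof -
  fix K :: "(real ^ 'n) set" assume K: "compact K"
  note k = assms(1) and n = assms(2) and int = assms(3) and F = assms(4)
  from assms(5)[OF K] obtain g :: "real ^ 'n \<Rightarrow> real" and \<delta> where g: "integrable lebesgue g"
    "\<And>y. norm y \<ge> \<delta> \<Longrightarrow> (SUP \<alpha>\<in>{\<alpha>. multi_order \<alpha> \<le> k}. SUP x\<in>K.
            ereal (norm y powi (- int CARD('n) + int k) * norm (nabla \<alpha> F (x + y)))) \<le> ereal (g y)"
    by blast
  obtain C where C: "C > 0" "\<And>j t. j \<le> k \<Longrightarrow> 0 \<le> t \<Longrightarrow> t \<le> 1 \<Longrightarrow> \<bar>poly (radial_poly k k j) t\<bar> \<le> C"
    using radial_poly_bound[of k] by blast
  let ?W = "ang_total TYPE(real ^ 'n)" and ?pf = "polar_factor TYPE(real ^ 'n)"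
  let ?a = "pi / 2 * poly (radial_poly k k 0) 0"
  define c where "c = ?pf * (unit_ball_vol (real (2 * k)) * 2 ^ (k + 1) * fact k)"
  have pf: "0 < ?pf" by (rule polar_const_eq_polar_factor)
  have W: "0 \<le> ?W" by (rule ang_total_nonneg)
  have c0: "0 \<le> c" using pf by (simp add: c_def less_imp_le)
  have const: "c * (?W * ?a) = (2 * pi) ^ CARD('n)"
  proof -
    have "c * (?W * ?a) = (?pf * ?W) * (unit_ball_vol (real (2 * k)) * 2 ^ (k + 1) * fact k) * ?a"
      by (simp add: c_def)
    also have "?pf * ?W = real (2 * k + 1) * unit_ball_vol (real (2 * k + 1))"
      using polar_factor_ang_total[where 'b = "real ^ 'n"] n by simp
    finally show ?thesis unfolding n normalisation_constant .
  qed
  let ?P = "(2 * pi) ^ CARD('n)"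
  have P: "0 < ?P" by simp
  show "uniform_limit K (\<lambda>R. S_R R F) F at_top"
    unfolding uniform_limit_iff
  proof (intro allI impI)
    fix e :: real assume e: "0 < e"
    \<comment> \<open>With the errors near and far from x both at most \<epsilon>, the total is (Q - 1) * \<epsilon>; the added 1
    keeps Q positive.\<close>
    define Q where "Q = c * (?W + C / ?pf) + 1"
    have Q: "0 < Q" using c0 W C(1) pf unfolding Q_def by (intro add_nonneg_pos mult_nonneg_nonneg) auto
    define \<epsilon> where "\<epsilon> = e * ?P / (2 * Q)"
    have \<epsilon>: "\<epsilon> > 0" using e P Q unfolding \<epsilon>_def by (intro divide_pos_pos mult_pos_pos) auto
    obtain b where b: "1 \<le> b" "\<And>x. x \<in> K \<Longrightarrow>
       (\<integral>\<^sup>+y. ennreal (inverse (norm y ^ (k + 1)) * jet_norm k F (x + y)) * indicator {y. b \<le> norm y} y \<partial>lborel)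
         \<le> ennreal \<epsilon>"
      using jet_norm_tail[OF F n \<epsilon> g] by blast
    have b0: "0 < b" using b(1) by simp
    obtain R0 where R0: "R0 > 0"
      "\<And>R T x w. R \<ge> R0 \<Longrightarrow> T \<ge> 1 \<Longrightarrow> x \<in> K \<Longrightarrow> norm w = 1 \<Longrightarrow>
       norm ((R / 2) *\<^sub>R integral {0..b} (\<lambda>s. slice_cos 0 (R * s) *\<^sub>R
          radial_sum k k T (\<lambda>j s. dir_deriv j w F (x + s *\<^sub>R w)) s) - ?a *\<^sub>R F x) \<le> \<epsilon>"
      using near_estimate[OF F k K b0 \<epsilon>] by blast
    show "\<forall>\<^sub>F R in at_top. \<forall>x\<in>K. dist (S_R R F x) (F x) < e"
      using eventually_ge_at_top[of R0]
    proof eventually_elim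
      case (elim R)
      then have R: "R > 0" using R0(1) by simp
      show ?case
      proof
        fix x assume x: "x \<in> K"
        have "norm (?P *\<^sub>R S_R R F x - ?P *\<^sub>R F x) \<le> c * (\<epsilon> * ?W + C * \<epsilon> / ?pf)"
        proof (rule norm_S_R_diff_le[OF int F k n R])
          fix T assume T: "b \<le> T"
          let ?I = "integral (cbox (- One) One) (\<lambda>z. ang_weight z *\<^sub>R ray_integral k F x R T (sgn z))"
          have "norm (?I - (?W * ?a) *\<^sub>R F x) \<le> \<epsilon> * ?W + C * \<epsilon> / ?pf"
            by (rule norm_integral_spherical_mean_error[OF F k n T b(1) R C less_imp_le[OF \<epsilon>] R0(2) b(2)[OF x] less_imp_le[OF \<epsilon>]])
               (use elim T b(1) x in auto)
          then have "c * norm (?I - (?W * ?a) *\<^sub>R F x) \<le> c * (\<epsilon> * ?W + C * \<epsilon> / ?pf)"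
            using c0 by (rule mult_left_mono)
          moreover have "c *\<^sub>R ?I - ?P *\<^sub>R F x = c *\<^sub>R (?I - (?W * ?a) *\<^sub>R F x)"
            unfolding const[symmetric] by (simp add: scaleR_diff_right)
          ultimately show "norm ((?pf * (unit_ball_vol (real (2 * k)) * 2 ^ (k + 1) * fact k)) *\<^sub>R ?I - ?P *\<^sub>R F x)
              \<le> c * (\<epsilon> * ?W + C * \<epsilon> / ?pf)"
            unfolding c_def[symmetric] using c0 by simp
        qed
        also have "c * (\<epsilon> * ?W + C * \<epsilon> / ?pf) = (Q - 1) * \<epsilon>"
          by (simp add: Q_def algebra_simps)
        also have "\<dots> < Q * \<epsilon>" using \<epsilon> by simp
        also have "Q * \<epsilon> = e * ?P / 2" using Q by (simp add: \<epsilon>_def)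
        also have "\<dots> < e * ?P" using e P by simp
        finally have "norm (?P *\<^sub>R (S_R R F x - F x)) < e * ?P" by (simp only: scaleR_diff_right)
        then have "?P * norm (S_R R F x - F x) < ?P * e" using P by (simp add: mult.commute)
        then show "dist (S_R R F x) (F x) < e" using P by (simp only: mult_less_cancel_left_pos dist_norm)
      qed
    qed
  qed
qed

end
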